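(* Let $n\ge 2$ be an integer and let $D_n$ be the dihedral group of order $2n$. The following statements are equivalent: (1) $n=6$ or $n$ is a power of a prime. (2) $Co_{\mathcal{H}}(D_n)$ is toroidal. (3) $Co_{\mathcal{H}}(D_n)$ is projective.
   Context: For $n\ge 1$, $D_n=\langle a,b \mid a^n=e,\ b^2=e,\ bab^{-1}=a^{-1}\rangle$ is the dihedral group of order $2n$ (so $D_2$ is the Klein four-group). For a group $G$, let $S$ be the set of all non-trivial proper subgroups of $G$ (i.e. subgroups different from $\{e\}$ and $G$). For subgroups $H,K$, $HK=\{hk : h\in H, k\in K\}$. The co-maximal hypergraph $Co_{\mathcal{H}}(G)$ has vertex set $V=\{H\in S : HK=G \text{ for some } K\in S\}$, and a subset $E\subseteq V$ is a hyperedge if and only if (1) $HK=G$ for all distinct $H,K\in E$, and (2) no subset $E'\subseteq V$ properly containing $E$ satisfies (1). The incidence graph $\mathcal{I}(\mathcal{H})$ of a hypergraph $\mathcal{H}$ is the bipartite graph with vertex set $V(\mathcal{H})\cup E(\mathcal{H})$ (disjoint union) in which $v\in V(\mathcal{H})$ is adjacent to $e\in E(\mathcal{H})$ if and only if $v\in e$. A graph is toroidal if it can be embedded on the torus, and projective if it can be embedded on the projective plane; in particular planar graphs are both toroidal and projective in this sense. A hypergraph is toroidal (respectively projective) if its incidence graph is toroidal (respectively projective). *)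

theory Defs
  imports
    "HOL-Analysis.Analysis"
    "HOL-Algebra.Generated_Groups"
    "HOL-Number_Theory.Prime_Powers"
begin

section \<open>Dihedral groups\<close>

text \<open>
  A group of order \<open>2 * n\<close> generated by two elements satisfying the relations
  \<open>a^n = e\<close>, \<open>b^2 = e\<close>, \<open>b a b^-1 = a^-1\<close>.  These relations force every element into the form
  \<open>a^i\<close> or \<open>a^i b\<close> with \<open>i < n\<close>, so a group generated in this way has at most \<open>2 * n\<close> elements, and
  the requirement on the order says precisely that no further relations hold.
\<close>

definition dihedral_group :: "('a, 'b) monoid_scheme \<Rightarrow> nat \<Rightarrow> bool" where
  "dihedral_group G n \<longleftrightarrow>
     group G \<and> order G = 2 * n \<and>
     (\<exists>a \<in> carrier G. \<exists>b \<in> carrier G.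
        generate G {a, b} = carrier G \<and>
        a [^]\<^bsub>G\<^esub> n = \<one>\<^bsub>G\<^esub> \<and>
        b [^]\<^bsub>G\<^esub> (2::nat) = \<one>\<^bsub>G\<^esub> \<and>
        b \<otimes>\<^bsub>G\<^esub> a \<otimes>\<^bsub>G\<^esub> inv\<^bsub>G\<^esub> b = inv\<^bsub>G\<^esub> a)"

text \<open>The pair \<open>(i, s)\<close> stands for \<open>a^i\<close> if \<open>s\<close> is false and for \<open>a^i b\<close> if \<open>s\<close> is true.\<close>

definition dihedral_model :: "nat \<Rightarrow> (int \<times> bool) monoid" where
  "dihedral_model n =
     \<lparr>carrier = {0..<int n} \<times> UNIV,
      mult = (\<lambda>(i, s) (j, t). ((if s then i - j else i + j) mod int n, s \<noteq> t)),
      one = (0, False)\<rparr>"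

lemma group_dihedral_model:
  assumes "n \<ge> 1"
  shows "group (dihedral_model n)"
proof (rule groupI)
  fix x y z
  assume "x \<in> carrier (dihedral_model n)" "y \<in> carrier (dihedral_model n)"
    "z \<in> carrier (dihedral_model n)"
  then show "x \<otimes>\<^bsub>dihedral_model n\<^esub> y \<otimes>\<^bsub>dihedral_model n\<^esub> z =
      x \<otimes>\<^bsub>dihedral_model n\<^esub> (y \<otimes>\<^bsub>dihedral_model n\<^esub> z)"
    by (cases x; cases y; cases z)
      (simp add: dihedral_model_def mod_simps, simp add: algebra_simps)
next
  fix x assume x: "x \<in> carrier (dihedral_model n)"
  obtain i s where [simp]: "x = (i, s)" by (cases x)
  have i: "0 \<le> i" "i < int n" using x by (auto simp: dihedral_model_def)
  show "\<exists>y \<in> carrier (dihedral_model n). y \<otimes>\<^bsub>dihedral_model n\<^esub> x = \<one>\<^bsub>dihedral_model n\<^esub>"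
    using i assms
    by (intro bexI[of _ "(if s then i else (- i) mod int n, s)"])
      (auto simp: dihedral_model_def mod_simps)
qed (use assms in \<open>auto simp: dihedral_model_def\<close>)

lemma dihedral_group_dihedral_model:
  assumes "n \<ge> 1"
  shows "dihedral_group (dihedral_model n) n"
proof -
  define G where "G = dihedral_model n"
  define a where "a = (1 mod int n, False)"
  define b where "b = (0::int, True)"
  interpret group G unfolding G_def by (rule group_dihedral_model[OF assms])
  have a: "a \<in> carrier G" and b: "b \<in> carrier G"
    using assms by (auto simp: G_def a_def b_def dihedral_model_def)
  have pow: "a [^]\<^bsub>G\<^esub> k = (int k mod int n, False)" for k :: nat
  proof (induction k)
    case 0 then show ?case by (simp add: G_def dihedral_model_def)
  next
    case (Suc k)
    have "a [^]\<^bsub>G\<^esub> Suc k = (int k mod int n, False) \<otimes>\<^bsub>G\<^esub> a"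
      using Suc by simp
    also have "\<dots> = (int (Suc k) mod int n, False)"
      by (simp add: G_def a_def dihedral_model_def mod_simps add.commute)
    finally show ?case .
  qed
  have bb: "b \<otimes>\<^bsub>G\<^esub> b = \<one>\<^bsub>G\<^esub>"
    by (simp add: G_def b_def dihedral_model_def)
  then have inv_b: "inv\<^bsub>G\<^esub> b = b"
    using b by (simp add: inv_equality)
  have "b \<otimes>\<^bsub>G\<^esub> a \<otimes>\<^bsub>G\<^esub> b \<otimes>\<^bsub>G\<^esub> a = \<one>\<^bsub>G\<^esub>"
    by (simp add: G_def a_def b_def dihedral_model_def mod_simps)
  then have rel: "b \<otimes>\<^bsub>G\<^esub> a \<otimes>\<^bsub>G\<^esub> inv\<^bsub>G\<^esub> b = inv\<^bsub>G\<^esub> a"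
    using a b inv_b inv_equality[of "b \<otimes>\<^bsub>G\<^esub> a \<otimes>\<^bsub>G\<^esub> b" a] by simp
  have "carrier G \<subseteq> generate G {a, b}"
  proof
    fix x assume x: "x \<in> carrier G"
    obtain i s where xis: "x = (i, s)" by (cases x)
    have i: "0 \<le> i" "i < int n" using x xis by (auto simp: G_def dihedral_model_def)
    have sub: "subgroup (generate G {a, b}) G"
      using a b by (intro generate_is_subgroup) auto
    have ab: "a \<in> generate G {a, b}" "b \<in> generate G {a, b}"
      by (auto intro: generate.incl)
    have pw: "a [^]\<^bsub>G\<^esub> k \<in> generate G {a, b}" for k :: nat
      using ab(1) subgroup.m_closed[OF sub] subgroup.one_closed[OF sub] by (induction k) auto
    have "a [^]\<^bsub>G\<^esub> nat i = (i, False)" using i by (simp add: pow)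
    moreover have "(i, False) \<otimes>\<^bsub>G\<^esub> b = (i, True)"
      using i by (simp add: G_def b_def dihedral_model_def)
    ultimately show "x \<in> generate G {a, b}"
      using pw[of "nat i"] subgroup.m_closed[OF sub pw[of "nat i"] ab(2)] xis by (cases s) simp_all
  qed
  moreover have "generate G {a, b} \<subseteq> carrier G"
    using a b generate_incl by auto
  ultimately have gen: "generate G {a, b} = carrier G" by blast
  have "order G = 2 * n"
    by (simp add: order_def G_def dihedral_model_def card_cartesian_product)
  moreover have "a [^]\<^bsub>G\<^esub> n = \<one>\<^bsub>G\<^esub>"
    using pow[of n] by (simp add: G_def dihedral_model_def)
  moreover have "b [^]\<^bsub>G\<^esub> (2::nat) = \<one>\<^bsub>G\<^esub>"
    using b bb by (simp add: numeral_2_eq_2)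
  ultimately have "dihedral_group G n"
    unfolding dihedral_group_def using group_axioms gen rel a b by blast
  then show ?thesis by (simp add: G_def)
qed


section \<open>The co-maximal hypergraph of a group\<close>

text \<open>A hypergraph is given by its vertex set and its set of hyperedges.\<close>

type_synonym 'v hypergraph = "'v set \<times> 'v set set"

definition nontrivial_proper_subgroups :: "('a, 'b) monoid_scheme \<Rightarrow> 'a set set" where
  "nontrivial_proper_subgroups G = {H. subgroup H G \<and> H \<noteq> {\<one>\<^bsub>G\<^esub>} \<and> H \<noteq> carrier G}"

definition comaximal_vertices :: "('a, 'b) monoid_scheme \<Rightarrow> 'a set set" where
  "comaximal_vertices G =
     {H \<in> nontrivial_proper_subgroups G.
        \<exists>K \<in> nontrivial_proper_subgroups G. H <#>\<^bsub>G\<^esub> K = carrier G}"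

definition pairwise_comaximal :: "('a, 'b) monoid_scheme \<Rightarrow> 'a set set \<Rightarrow> bool" where
  "pairwise_comaximal G E \<longleftrightarrow>
     (\<forall>H \<in> E. \<forall>K \<in> E. H \<noteq> K \<longrightarrow> H <#>\<^bsub>G\<^esub> K = carrier G)"

definition comaximal_hyperedges :: "('a, 'b) monoid_scheme \<Rightarrow> 'a set set set" where
  "comaximal_hyperedges G =
     {E. E \<subseteq> comaximal_vertices G \<and> pairwise_comaximal G E \<and>
         \<not> (\<exists>E'. E' \<subseteq> comaximal_vertices G \<and> E \<subset> E' \<and> pairwise_comaximal G E')}"

definition comaximal_hypergraph :: "('a, 'b) monoid_scheme \<Rightarrow> 'a set hypergraph" where
  "comaximal_hypergraph G = (comaximal_vertices G, comaximal_hyperedges G)"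


section \<open>Incidence graphs and embeddings into surfaces\<close>

text \<open>A simple graph is given by its vertex set and its set of two-element edges.\<close>

type_synonym 'v sgraph = "'v set \<times> 'v set set"

definition incidence_graph :: "'v hypergraph \<Rightarrow> ('v + 'v set) sgraph" where
  "incidence_graph = (\<lambda>(V, E). (V <+> E, {{Inl v, Inr e} | v e. v \<in> V \<and> e \<in> E \<and> v \<in> e}))"

text \<open>
  A drawing without crossings: vertices are sent to distinct points of \<open>X\<close>, every edge to an arc
  (a homeomorphic image of the unit interval) joining its two ends, and the interior of such an arc
  contains no vertex and no point of the interior of another one.  For a finite graph and a
  Hausdorff space \<open>X\<close>, this is the same as a topological embedding of the geometric
  realisation of the graph.
\<close>

definition embeddable_in :: "'p topology \<Rightarrow> 'v sgraph \<Rightarrow> bool" where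
  "embeddable_in X = (\<lambda>(V, E).
     \<exists>(\<phi> :: 'v \<Rightarrow> 'p) (\<gamma> :: 'v set \<Rightarrow> real \<Rightarrow> 'p).
       inj_on \<phi> V \<and> \<phi> ` V \<subseteq> topspace X \<and>
       (\<forall>e \<in> E. embedding_map (top_of_set {0..1}) X (\<gamma> e) \<and>
                {\<gamma> e 0, \<gamma> e 1} = \<phi> ` e \<and>
                \<gamma> e ` {0<..<1} \<inter> \<phi> ` V = {}) \<and>
       (\<forall>e \<in> E. \<forall>f \<in> E. e \<noteq> f \<longrightarrow> \<gamma> e ` {0<..<1} \<inter> \<gamma> f ` {0<..<1} = {}))"

definition torus :: "(complex \<times> complex) topology" where
  "torus = prod_topology (top_of_set (sphere 0 1)) (top_of_set (sphere 0 1))"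

text \<open>
  The quotient of the two-sphere by the antipodal map; the points are the pairs \<open>{x, -x}\<close>.
\<close>

definition projective_plane :: "(real ^ 3) set topology" where
  "projective_plane = topology (\<lambda>U.
     U \<subseteq> (\<lambda>x. {x, - x}) ` sphere 0 1 \<and>
     openin (top_of_set (sphere 0 1)) {x \<in> sphere 0 1. {x, - x} \<in> U})"

lemma openin_projective_plane:
  "openin projective_plane U \<longleftrightarrow>
     U \<subseteq> (\<lambda>x. {x, - x}) ` sphere 0 1 \<and>
     openin (top_of_set (sphere 0 1)) {x \<in> sphere 0 1. {x, - x} \<in> U}"
proof -
  define P :: "(real ^ 3) set \<Rightarrow> bool"
    where "P = openin (top_of_set (sphere 0 1))"
  define pre :: "(real ^ 3) set set \<Rightarrow> (real ^ 3) set"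
    where "pre = (\<lambda>U. {x \<in> sphere 0 1. {x, - x} \<in> U})"
  have "istopology (\<lambda>U. U \<subseteq> (\<lambda>x. {x, - x}) ` sphere 0 1 \<and> P (pre U))"
    unfolding istopology_def
  proof (intro conjI allI impI)
    fix S T :: "(real ^ 3) set set"
    assume "S \<subseteq> (\<lambda>x. {x, - x}) ` sphere 0 1 \<and> P (pre S)"
      and "T \<subseteq> (\<lambda>x. {x, - x}) ` sphere 0 1 \<and> P (pre T)"
    moreover have "pre (S \<inter> T) = pre S \<inter> pre T" by (auto simp: pre_def)
    ultimately show "S \<inter> T \<subseteq> (\<lambda>x. {x, - x}) ` sphere 0 1" "P (pre (S \<inter> T))"
      by (auto simp: P_def)
  next
    fix K :: "(real ^ 3) set set set"
    assume K: "\<forall>S\<in>K. S \<subseteq> (\<lambda>x. {x, - x}) ` sphere 0 1 \<and> P (pre S)"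
    have "pre (\<Union>K) = (\<Union>S\<in>K. pre S)" by (auto simp: pre_def)
    with K show "P (pre (\<Union>K))" by (auto simp: P_def)
    show "\<Union>K \<subseteq> (\<lambda>x. {x, - x}) ` sphere 0 1" using K by blast
  qed
  then show ?thesis
    by (simp add: projective_plane_def P_def pre_def)
qed

lemma quotient_map_projective_plane:
  "quotient_map (top_of_set (sphere 0 1)) projective_plane (\<lambda>x. {x, - x})"
proof -
  have pre: "{x \<in> sphere 0 1. {x, - x} \<in> (\<lambda>x. {x, - x}) ` sphere 0 1} = sphere (0 :: real ^ 3) 1"
    by auto
  have "openin projective_plane ((\<lambda>x. {x, - x}) ` sphere 0 1)"
    unfolding openin_projective_plane pre by simp
  then have "topspace projective_plane = (\<lambda>x. {x, - x}) ` sphere 0 1"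
    using openin_projective_plane[of "topspace projective_plane"] openin_subset by fastforce
  then show ?thesis
    by (auto simp: quotient_map_def openin_projective_plane)
qed

definition toroidal :: "'v hypergraph \<Rightarrow> bool" where
  "toroidal H \<longleftrightarrow> embeddable_in torus (incidence_graph H)"

definition projective :: "'v hypergraph \<Rightarrow> bool" where
  "projective H \<longleftrightarrow> embeddable_in projective_plane (incidence_graph H)"

end

theory Submission
  imports Defs
begin

text \<open>
  A bipartite graph drawn in the plane with \<open>V\<close> vertices and \<open>E\<close> edges has \<open>E \<le> 2 V\<close>, since every face is
  bordered by at least four edges; this needs only the Jordan curve theorem and Janiszewski's theorem.
  Lifting a drawing to a large block of the universal cover of the torus, or to the double cover of
  the projective plane by the sphere, gives the same bound on these surfaces.
  This excludes subdivisions of \<open>K\<^sub>4\<^sub>,\<^sub>5\<close> and \<open>K\<^sub>3\<^sub>,\<^sub>7\<close>, which the incidence graph contains whenever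
  \<open>n\<close> is neither \<open>6\<close> nor a prime power.

  For a prime power \<open>n\<close>, the rotation subgroup \<open>\<langle>a\<rangle>\<close> is comaximal to all other vertices, and among these the
  only large cliques involve \<open>\<langle>a\<^sup>2, b\<rangle>\<close> and \<open>\<langle>a\<^sup>2, a b\<rangle>\<close>; the incidence graph is planar. For \<open>n = 6\<close>, explicit
  straight-line drawings are checked by integer arithmetic.
\<close>

section \<open>Bipartite graphs in the plane\<close>

text \<open>The bound \<open>E \<le> 2 V\<close> is weaker than the planar
  \<open>E \<le> 2 V - 4\<close>, but it is the form that descends along coverings, where vertices
  and edges are multiplied by the number of sheets and additive constants are lost. On the torus it
  is what Euler's formula gives for bipartite graphs, on the projective plane it is off by 2; one
  inequality thus serves both. For complete bipartite graphs with parts a and b it says (a - 2)(b -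
  2) \<le> 4, which allows the parts 4, 4 and 3, 6 and fails at 4, 5 and 3, 7: hence these two
  obstructions. The obstacle is that arcs are arbitrary curves, so a face has no boundary walk that
  could be counted. Faces are therefore represented by points, their borders by closures, and every
  combinatorial step becomes a separation statement. For n = 6 the subgroups generated by a, by a^2
  and b, and by a^2 and ab lie together in three hyperedges, a complete bipartite graph with parts
  3, 3. So no plane drawing exists, and each surface has its own.\<close>

definition arc_drawing :: "'b::topological_space set \<Rightarrow> 'e set \<Rightarrow> ('e \<Rightarrow> real \<Rightarrow> 'b) \<Rightarrow> bool" where
  "arc_drawing P A g \<longleftrightarrow> finite P \<and> finite A \<and>
     (\<forall>e\<in>A. arc (g e) \<and> path_image (g e) \<inter> P = {pathstart (g e), pathfinish (g e)}) \<and>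
     (\<forall>e\<in>A. \<forall>f\<in>A. e \<noteq> f \<longrightarrow> path_image (g e) \<inter> path_image (g f) \<subseteq> P)"

definition frame :: "'b::topological_space set \<Rightarrow> 'e set \<Rightarrow> ('e \<Rightarrow> real \<Rightarrow> 'b) \<Rightarrow> 'b set" where
  "frame P A g = P \<union> (\<Union>e\<in>A. path_image (g e))"

text \<open>Faces are counted by representatives: the points of \<open>X\<close> lie in different
  components of the complement of \<open>K\<close>. Points, unlike components, can be kept or moved
  slightly while the drawing grows arc by arc.\<close>

definition pairwise_separated :: "'b::topological_space set \<Rightarrow> 'b set \<Rightarrow> bool" where
  "pairwise_separated K X \<longleftrightarrow> X \<inter> K = {} \<and>
     (\<forall>x\<in>X. \<forall>y\<in>X. x \<noteq> y \<longrightarrow> \<not> connected_component (- K) x y)"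

section \<open>Elementary topology of drawings by arcs\<close>

lemma arc_drawing_subset: "arc_drawing P A g \<Longrightarrow> B \<subseteq> A \<Longrightarrow> arc_drawing P B g"
  unfolding arc_drawing_def by (meson finite_subset subset_iff)

lemma frame_insert: "frame P (insert e A) g = frame P A g \<union> path_image (g e)"
  by (auto simp: frame_def)

lemma frame_mono: "B \<subseteq> A \<Longrightarrow> frame P B g \<subseteq> frame P A g"
  by (auto simp: frame_def)

lemma compact_frame:
  fixes g :: "'e \<Rightarrow> real \<Rightarrow> 'b::t2_space"
  assumes "arc_drawing P A g"
  shows "compact (frame P A g)"
  using assms unfolding arc_drawing_def frame_def
  by (intro compact_Un compact_UN) (auto intro: compact_arc_image finite_imp_compact)

lemma arc_drawing_ends:
  assumes "arc_drawing P A g" "e \<in> A"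
  shows "pathstart (g e) \<in> P" "pathfinish (g e) \<in> P" "pathstart (g e) \<noteq> pathfinish (g e)" "arc (g e)"
  using assms arc_distinct_ends unfolding arc_drawing_def by fastforce+

lemma arc_drawing_Int_frame:
  assumes "arc_drawing P A g" "e \<in> A" "B \<subseteq> A" "e \<notin> B"
  shows "path_image (g e) \<inter> frame P B g = {pathstart (g e), pathfinish (g e)}"
proof -
  have "path_image (g e) \<inter> path_image (g f) \<subseteq> P" if "f \<in> B" for f
    using assms that unfolding arc_drawing_def by (metis subsetD)
  moreover have "path_image (g e) \<inter> P = {pathstart (g e), pathfinish (g e)}"
    using assms unfolding arc_drawing_def by blast
  ultimately show ?thesis unfolding frame_def by blast
qed

lemma connected_arc_link:
  assumes "arc_drawing P A g" "e \<in> A"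
  shows "connected (path_image (g e) - P)"
proof -
  have "path_image (g e) - P = path_image (g e) - {pathstart (g e), pathfinish (g e)}"
    using assms unfolding arc_drawing_def by blast
  then show ?thesis
    using connected_simple_path_endless arc_imp_simple_path arc_drawing_ends(4)[OF assms] by metis
qed

text \<open>Otherwise the inverse of the arc maps a ball injectively onto a nondegenerate interval.
  Deleting the preimage \<open>z\<close> of an inner value \<open>m\<close> leaves the ball
  connected in dimension at least two, but cuts its image at \<open>m\<close>.\<close>

lemma interior_path_image_arc:
  fixes g :: "real \<Rightarrow> 'a::euclidean_space"
  assumes "arc g" "2 \<le> DIM('a)" "open U" "U \<subseteq> path_image g"
  shows "U = {}"
proof (rule ccontr)
  assume "U \<noteq> {}"
  then obtain x r where r: "0 < r" "ball x r \<subseteq> U"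
    using \<open>open U\<close> by (meson ex_in_conv open_contains_ball)
  define B where "B = ball x r"
  obtain h where h: "homeomorphism {0..1} (path_image g) g h"
    using homeomorphism_arc[OF \<open>arc g\<close>] by blast
  have Bsub: "B \<subseteq> path_image g" using r assms(4) by (auto simp: B_def)
  have inj: "inj_on h B"
    using h Bsub unfolding homeomorphism_def by (metis (no_types, lifting) inj_on_def subset_iff)
  have cont: "continuous_on B h"
    using h Bsub unfolding homeomorphism_def by (meson continuous_on_subset)
  have inf: "infinite B"
    unfolding B_def using r(1) finite_imp_not_open by fastforce
  have cB: "connected (h ` B)"
    using connected_continuous_image[OF cont] by (simp add: B_def)
  have "infinite (h ` B)"
    using inf inj finite_imageD by blast
  then obtain a where "a \<in> h ` B" by (metis ex_in_conv finite.emptyI)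
  have "infinite (h ` B - {a})" using \<open>infinite (h ` B)\<close> by simp
  then obtain b where "b \<in> h ` B" "b \<noteq> a" by (metis DiffE ex_in_conv finite.emptyI singletonI)
  define m where "m = (a + b) / 2"
  have m: "m \<in> h ` B"
  proof -
    have "min a b \<in> h ` B" "max a b \<in> h ` B"
      using \<open>a \<in> h ` B\<close> \<open>b \<in> h ` B\<close> by (auto simp: min_def max_def)
    moreover have "min a b \<le> m" "m \<le> max a b" by (auto simp: m_def)
    ultimately show ?thesis using cB by (meson connectedD_interval)
  qed
  then obtain z where z: "z \<in> B" "h z = m" by blast
  have "connected (B - {z})"
    unfolding B_def by (intro connected_open_delete assms) auto
  then have "connected (h ` (B - {z}))"
    by (meson connected_continuous_image cont continuous_on_subset Diff_subset)
  also have "h ` (B - {z}) = h ` B - {m}"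
    using inj z by (auto simp: inj_on_def)
  finally have c: "connected (h ` B - {m})" .
  have "min a b \<in> h ` B - {m}" "max a b \<in> h ` B - {m}" "min a b \<le> m" "m \<le> max a b"
    using \<open>a \<in> h ` B\<close> \<open>b \<in> h ` B\<close> \<open>b \<noteq> a\<close> by (auto simp: min_def max_def m_def)
  then have "m \<in> h ` B - {m}" using c by (meson connectedD_interval)
  then show False by simp
qed

text \<open>A member of the family that meets the path component lies inside it. So the component
  and its complement in the union are finite unions of closed members, which makes both available to
  Janiszewski's theorem.\<close>

lemma closed_path_component_Union:
  assumes "finite \<F>" "\<And>F. F \<in> \<F> \<Longrightarrow> path_connected F \<and> closed F" and u: "u \<in> \<Union>\<F>"
  defines "C \<equiv> path_component_set (\<Union>\<F>) u"
  shows "closed C" "closed (\<Union>\<F> - C)"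
proof -
  have *: "F \<subseteq> C" if "F \<in> \<F>" "F \<inter> C \<noteq> {}" for F
  proof -
    from that obtain x where "x \<in> F" "x \<in> C" by blast
    then have "F \<subseteq> path_component_set (\<Union>\<F>) x"
      using assms(2)[OF \<open>F \<in> \<F>\<close>] \<open>F \<in> \<F>\<close> by (intro path_component_maximal) auto
    also have "\<dots> = C" using \<open>x \<in> C\<close> unfolding C_def by (rule path_component_eq)
    finally show ?thesis .
  qed
  have "C \<subseteq> \<Union>\<F>" unfolding C_def by (rule path_component_subset)
  then have "C = \<Union>{F\<in>\<F>. F \<inter> C \<noteq> {}}" using * by blast
  then show "closed C"
  proof (rule ssubst)
    show "closed (\<Union>{F\<in>\<F>. F \<inter> C \<noteq> {}})"
      using assms(1,2) by (intro closed_Union) auto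
  qed
  have "\<Union>\<F> - C = \<Union>{F\<in>\<F>. F \<inter> C = {}}" using * by blast
  then show "closed (\<Union>\<F> - C)"
  proof (rule ssubst)
    show "closed (\<Union>{F\<in>\<F>. F \<inter> C = {}})"
      using assms(1,2) by (intro closed_Union) auto
  qed
qed

lemma frame_component_split:
  fixes g :: "'e \<Rightarrow> real \<Rightarrow> 'b::t2_space"
  assumes d: "arc_drawing P A g" and u: "u \<in> P"
  defines "C \<equiv> path_component_set (frame P A g) u"
  shows "closed C" "closed (frame P A g - C)"
proof -
  let ?F = "(\<lambda>p. {p}) ` P \<union> (\<lambda>e. path_image (g e)) ` A"
  have eq: "\<Union>?F = frame P A g" by (auto simp: frame_def)
  have "finite ?F" using d by (auto simp: arc_drawing_def)
  moreover have "path_connected F \<and> closed F" if "F \<in> ?F" for F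
    using that
  proof
    assume "F \<in> (\<lambda>e. path_image (g e)) ` A"
    then obtain e where e: "e \<in> A" "F = path_image (g e)" by blast
    then have "arc (g e)" using d by (simp add: arc_drawing_def)
    then show ?thesis
      using e(2) by (simp add: arc_imp_path compact_arc_image compact_imp_closed path_connected_path_image)
  qed auto
  moreover have "u \<in> \<Union>?F" using u by auto
  ultimately have "closed (path_component_set (\<Union>?F) u) \<and> closed (\<Union>?F - path_component_set (\<Union>?F) u)"
    by (metis (no_types, lifting) closed_path_component_Union)
  then show "closed C" "closed (frame P A g - C)" unfolding eq C_def by (rule conjunct1, rule conjunct2)
qed

text \<open>A path between the ends of \<open>g e\<close> inside the frame contains an arc
  \<open>h\<close>. Since \<open>g e\<close> meets that frame only in its two ends, the two arcs
  form a Jordan curve.\<close>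

lemma frame_cycle:
  fixes g :: "'e \<Rightarrow> real \<Rightarrow> complex"
  assumes d: "arc_drawing P A g" and e: "e \<in> A" "B \<subseteq> A" "e \<notin> B"
    and pc: "path_component (frame P B g) (pathstart (g e)) (pathfinish (g e))"
  obtains c h where "simple_path c" "pathfinish c = pathstart c" "arc h"
    "path_image c = path_image (g e) \<union> path_image h" "path_image h \<subseteq> frame P B g"
    "pathstart h = pathstart (g e)" "pathfinish h = pathfinish (g e)"
proof -
  let ?u = "pathstart (g e)" and ?v = "pathfinish (g e)"
  have "?u \<noteq> ?v" and arc: "arc (g e)" using arc_drawing_ends[OF d e(1)] by auto
  then obtain h where h: "arc h" "path_image h \<subseteq> frame P B g" "pathstart h = ?u" "pathfinish h = ?v"
    using pc path_contains_arc unfolding path_component_def by (metis order_trans)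
  have "path_image (g e) \<inter> path_image h \<subseteq> {?u, ?v}"
    using arc_drawing_Int_frame[OF d e] h by blast
  then have "simple_path (g e +++ reversepath h)"
    using h arc by (intro simple_path_join_loop) (auto simp: arc_reversepath)
  moreover have "path_image (g e +++ reversepath h) = path_image (g e) \<union> path_image h"
    using h by (simp add: path_image_join)
  ultimately show ?thesis
    using that[of "g e +++ reversepath h" h] h by simp
qed

section \<open>A lower bound for the number of faces\<close>

lemma pairwise_separated_Un:
  assumes "pairwise_separated K X" "X \<inter> L = {}"
  shows "pairwise_separated (K \<union> L) X"
proof -
  have "- (K \<union> L) \<subseteq> - K" by auto
  then have "connected_component (- K) x y" if "connected_component (- (K \<union> L)) x y" for x y
    using that connected_component_of_subset by metis
  then show ?thesis using assms unfolding pairwise_separated_def Int_Un_distrib Un_empty by metis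
qed

text \<open>The edge \<open>g e\<close> without its ends is connected and avoids the frame of the
  edges in \<open>B\<close>, so it runs inside one face of that frame.\<close>

lemma connected_component_link:
  fixes g :: "'e \<Rightarrow> real \<Rightarrow> complex"
  assumes d: "arc_drawing P A g" and e: "e \<in> A" "B \<subseteq> A" "e \<notin> B"
    and "p \<in> path_image (g e) - P" "q \<in> path_image (g e) - P"
  shows "connected_component (- frame P B g) p q"
proof -
  have "path_image (g e) - P \<subseteq> - frame P B g"
  proof -
    have "path_image (g e) \<inter> P = {pathstart (g e), pathfinish (g e)}"
      using d e(1) unfolding arc_drawing_def by blast
    then show ?thesis using arc_drawing_Int_frame[OF d e] by blast
  qed
  then show ?thesis
    using connected_arc_link[OF d e(1)] assms(5,6) unfolding connected_component_def by blast
qed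

lemma arc_link_nonempty:
  fixes g :: "'e \<Rightarrow> real \<Rightarrow> 'b::t2_space"
  assumes d: "arc_drawing P A g" and e: "e \<in> A"
  obtains m where "m \<in> path_image (g e) - P"
proof -
  have arc: "arc (g e)" using arc_drawing_ends[OF d e] by auto
  have "g e (1/2) \<in> path_image (g e)" by (auto simp: path_image_def)
  moreover have "g e (1/2) \<noteq> g e 0" "g e (1/2) \<noteq> g e 1"
    using arc inj_on_contraD[of "g e" "{0..1}" "1/2"] by (auto simp: arc_def)
  moreover have "path_image (g e) \<inter> P = {pathstart (g e), pathfinish (g e)}"
    using d e unfolding arc_drawing_def by blast
  ultimately show ?thesis using that[of "g e (1/2)"] by (auto simp: pathstart_def pathfinish_def)
qed

text \<open>A new arc never costs a face. It runs inside one face of the old frame, so it hits at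
  most one representative, and this one can be moved off it within its open face because an arc has
  empty interior.\<close>

lemma pairwise_separated_add_arc:
  fixes g :: "'e \<Rightarrow> real \<Rightarrow> complex"
  assumes d: "arc_drawing P A g" and e: "e \<in> A" "B \<subseteq> A" "e \<notin> B"
    and X: "pairwise_separated (frame P B g) X" "finite X"
  shows "\<exists>X'. pairwise_separated (frame P (insert e B) g) X' \<and> finite X' \<and> card X' = card X"
proof (cases "X \<inter> path_image (g e) = {}")
  case True
  then show ?thesis using X pairwise_separated_Un[OF X(1) True] by (auto simp: frame_insert)
next
  case False
  then obtain x where x: "x \<in> X" "x \<in> path_image (g e)" by blast
  let ?K = "frame P B g"
  let ?U = "connected_component_set (- ?K) x"
  have XK: "X \<inter> ?K = {}" using X by (simp add: pairwise_separated_def)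
  have "P \<subseteq> ?K" by (auto simp: frame_def)
  have "closed ?K" using compact_frame[OF arc_drawing_subset[OF d e(2)]] compact_imp_closed by blast
  then have "open ?U" by (simp add: open_connected_component open_Compl)
  have "x \<in> ?U" using x XK by auto
  then have "\<not> ?U \<subseteq> path_image (g e)"
    using interior_path_image_arc[OF arc_drawing_ends(4)[OF d e(1)] _ \<open>open ?U\<close>]
    by (metis DIM_complex empty_iff order_refl)
  then obtain p where p: "p \<in> ?U" "p \<notin> path_image (g e)" by blast
  have pK: "p \<notin> ?K" using p connected_component_in by fastforce
  have other: "y \<notin> path_image (g e)" if "y \<in> X" "y \<noteq> x" for y
  proof
    assume "y \<in> path_image (g e)"
    then have "x \<in> path_image (g e) - P" "y \<in> path_image (g e) - P"
      using x that XK \<open>P \<subseteq> ?K\<close> by auto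
    then have "connected_component (- ?K) x y"
      by (rule connected_component_link[OF d e])
    then show False using X x that unfolding pairwise_separated_def by metis
  qed
  let ?X = "insert p (X - {x})"
  have sep: "\<not> connected_component (- ?K) p y" "p \<noteq> y" if "y \<in> X - {x}" for y
  proof -
    show "\<not> connected_component (- ?K) p y"
    proof
      assume "connected_component (- ?K) p y"
      then have "connected_component (- ?K) x y" using p connected_component_trans by fastforce
      then show False using X x that unfolding pairwise_separated_def by (metis DiffD1 DiffD2 singletonI)
    qed
    then show "p \<noteq> y" using pK by force
  qed
  have "pairwise_separated ?K ?X"
    using X sep pK unfolding pairwise_separated_def
    by (auto dest: connected_component_sym)
  moreover have "?X \<inter> path_image (g e) = {}" using p other by blast
  ultimately have "pairwise_separated (frame P (insert e B) g) ?X"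
    unfolding frame_insert by (rule pairwise_separated_Un)
  moreover have "card ?X = card X"
  proof -
    have "p \<notin> X - {x}" using sep(2) by blast
    then have "card ?X = Suc (card (X - {x}))" using X(2) by simp
    also have "\<dots> = card X" using X(2) x by (metis card.remove)
    finally show ?thesis .
  qed
  ultimately show ?thesis using X(2) by (intro exI[of _ ?X]) auto
qed

text \<open>The new arc closes a Jordan curve, and near an inner point of the arc the face around it
  reaches both sides of the curve. This face breaks in two: its representative, if it has one, is
  replaced by \<open>p\<close> and \<open>q\<close> on the two sides.\<close>

lemma pairwise_separated_add_cycle:
  fixes g :: "'e \<Rightarrow> real \<Rightarrow> complex"
  assumes d: "arc_drawing P A g" and e: "e \<in> A" "B \<subseteq> A" "e \<notin> B"
    and pc: "path_component (frame P B g) (pathstart (g e)) (pathfinish (g e))"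
    and X: "pairwise_separated (frame P B g) X" "finite X"
  shows "\<exists>X'. pairwise_separated (frame P (insert e B) g) X' \<and> finite X' \<and> card X' \<ge> card X + 1"
proof -
  let ?K = "frame P B g"
  obtain c h where c: "simple_path c" "pathfinish c = pathstart c" 
    "path_image c = path_image (g e) \<union> path_image h" "path_image h \<subseteq> ?K"
    using frame_cycle[OF d e pc] by metis
  obtain m where m: "m \<in> path_image (g e) - P" using arc_link_nonempty[OF d e(1)] .
  obtain V W where VW: "open V" "open W" "V \<inter> W = {}" "V \<union> W = - path_image c"
     "frontier V = path_image c" "frontier W = path_image c"
    using Jordan_curve[OF c(1,2)] by metis
  let ?U = "connected_component_set (- ?K) m"
  have XK: "X \<inter> ?K = {}" using X by (simp add: pairwise_separated_def)
  have "closed ?K" using compact_frame[OF arc_drawing_subset[OF d e(2)]] compact_imp_closed by blast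
  then have "open ?U" by (simp add: open_connected_component open_Compl)
  have "m \<in> ?U" using connected_component_link[OF d e m m] by simp
  have "m \<in> closure V" "m \<in> closure W"
    using m c(3) VW(5,6) by (auto simp: frontier_def)
  then have "?U \<inter> V \<noteq> {}" "?U \<inter> W \<noteq> {}"
    using open_Int_closure_eq_empty[OF \<open>open ?U\<close>] \<open>m \<in> ?U\<close> by (metis disjoint_iff)+
  then obtain p q where p: "p \<in> V" "p \<in> ?U" and q: "q \<in> W" "q \<in> ?U"
    by (metis disjoint_iff)
  have pq: "p \<notin> path_image c" "q \<notin> path_image c" "p \<noteq> q" "p \<notin> ?K" "q \<notin> ?K"
  proof -
    have "p \<in> - path_image c" "q \<in> - path_image c" using p q VW(4) by auto
    then show "p \<notin> path_image c" "q \<notin> path_image c" by auto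
    show "p \<noteq> q" using p q VW(3) by auto
    show "p \<notin> ?K" "q \<notin> ?K" using p q connected_component_subset by fast+
  qed
  have sepc: "\<not> connected_component (- path_image c) p q"
  proof
    assume "connected_component (- path_image c) p q"
    then obtain T where "connected T" "T \<subseteq> V \<union> W" "p \<in> T" "q \<in> T"
      unfolding connected_component_def VW(4) by blast
    moreover have "V \<inter> W \<inter> T = {}" using VW(3) by simp
    ultimately have "V \<inter> T = {} \<or> W \<inter> T = {}" using connectedD VW(1,2) by metis
    then show False using p(1) q(1) \<open>p \<in> T\<close> \<open>q \<in> T\<close> by blast
  qed
  have sub: "connected_component (- path_image c) x y" if "connected_component (- (?K \<union> path_image (g e))) x y" for x y
    using that by (rule connected_component_of_subset) (use c in auto)
  have subK: "connected_component (- ?K) x y" if "connected_component (- (?K \<union> path_image (g e))) x y" for x y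
    using that by (rule connected_component_of_subset) auto
  \<comment> \<open>The face \<open>?U\<close> loses at most one representative and receives two, so
    the gain is at least one.\<close>
  define Y where "Y = X - ?U"
  have "P \<subseteq> ?K" by (auto simp: frame_def)
  have YU: "\<not> connected_component (- ?K) z y" if "y \<in> Y" "z \<in> ?U" for y z
    using that connected_component_trans[of "- ?K" m z y] by (auto simp: Y_def)
  have Ye: "y \<notin> path_image (g e)" if "y \<in> Y" for y
    using connected_component_link[OF d e m, of y] XK \<open>P \<subseteq> ?K\<close> that by (auto simp: Y_def)
  let ?X = "insert p (insert q Y)"
  have "p \<notin> Y" "q \<notin> Y" using p q by (auto simp: Y_def)
  have "pairwise_separated (?K \<union> path_image (g e)) ?X"
    unfolding pairwise_separated_def
  proof (intro conjI ballI impI)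
    show "?X \<inter> (?K \<union> path_image (g e)) = {}"
      using pq c(3) XK Ye by (auto simp: Y_def)
    fix x y assume xy: "x \<in> ?X" "y \<in> ?X" "x \<noteq> y"
    show "\<not> connected_component (- (?K \<union> path_image (g e))) x y"
    proof
      assume cc: "connected_component (- (?K \<union> path_image (g e))) x y"
      have "\<not> (x \<in> Y \<and> y \<in> Y)" using subK[OF cc] X xy by (auto simp: Y_def pairwise_separated_def)
      moreover have "\<not> (x \<in> Y \<and> y \<in> {p,q})" "\<not> (y \<in> Y \<and> x \<in> {p,q})"
        using YU subK[OF cc] p q by (auto dest: connected_component_sym)
      ultimately have "{x,y} = {p,q}" using xy by auto
      then show False using sub[OF cc] sepc by (auto simp: doubleton_eq_iff dest: connected_component_sym)
    qed
  qed
  moreover have "card ?X \<ge> card X + 1"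
  proof -
    have "card (X \<inter> ?U) \<le> 1"
    proof (rule ccontr)
      assume "\<not> card (X \<inter> ?U) \<le> 1"
      then obtain x y where "x \<in> X" "y \<in> X" "x \<in> ?U" "y \<in> ?U" "x \<noteq> y"
        using card_le_Suc0_iff_eq[of "X \<inter> ?U"] X(2) by auto
      moreover then have "connected_component (- ?K) x y"
        by (metis connected_component_sym connected_component_trans mem_Collect_eq)
      ultimately show False using X by (auto simp: pairwise_separated_def)
    qed
    moreover have "card X = card (X \<inter> ?U) + card Y"
      unfolding Y_def using X(2) card_Int_Diff by blast
    moreover have "card ?X = card Y + 2"
      using \<open>p \<notin> Y\<close> \<open>q \<notin> Y\<close> pq(3) X(2) by (simp add: Y_def)
    ultimately show ?thesis by simp
  qed
  ultimately show ?thesis using X(2) by (intro exI[of _ ?X]) (auto simp: frame_insert Y_def)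
qed

text \<open>Euler's inequality F - 1 \<ge> E - V + C, with the edges added one by one: an edge
  within a component creates a face, an edge between two components lowers C. Components enter
  through a labelling \<open>l\<close> such that equal labels are connected in the frame. A nonempty
  \<open>P\<close> has at least one label, which gives the constant 2.\<close>

lemma ex_pairwise_separated:
  fixes g :: "'e \<Rightarrow> real \<Rightarrow> complex"
  assumes d: "arc_drawing P A g"
  shows "\<exists>X. finite X \<and> pairwise_separated (frame P A g) X \<and> card A + 2 \<le> card X + card P \<or> P = {}"
proof -
  have "\<exists>X. \<exists>l :: complex \<Rightarrow> complex. finite X \<and> pairwise_separated (frame P A g) X \<and> card A + 1 + card (l ` P) \<le> card X + card P \<and>
    (\<forall>u\<in>P. \<forall>v\<in>P. l u = l v \<longrightarrow> path_component (frame P A g) u v)"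
    if "finite A" "arc_drawing P A g" for A
    using that
  proof (induction A rule: finite_induct)
    case empty
    then have "finite P" by (simp add: arc_drawing_def)
    then obtain x :: complex where "x \<notin> P" using ex_new_if_finite infinite_UNIV_char_0 by blast
    then show ?case
      by (intro exI[of _ "{x}"] exI[of _ id]) (auto simp: frame_def pairwise_separated_def path_component_refl)
  next
    case (insert e B)
    let ?A = "insert e B" and ?u = "pathstart (g e)" and ?v = "pathfinish (g e)"
    have dB: "arc_drawing P B g" using insert.prems arc_drawing_subset by blast
    have e: "e \<in> ?A" "B \<subseteq> ?A" "e \<notin> B" using insert.hyps by auto
    note ends = arc_drawing_ends[OF insert.prems e(1)]
    from insert.IH[OF dB] obtain X and l :: "complex \<Rightarrow> complex"
      where X: "finite X" "pairwise_separated (frame P B g) X" "card B + 1 + card (l ` P) \<le> card X + card P"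
        and l': "\<forall>u\<in>P. \<forall>v\<in>P. l u = l v \<longrightarrow> path_component (frame P B g) u v"
      by (elim exE conjE) (rule that)
    have l: "path_component (frame P B g) u v" if "u \<in> P" "v \<in> P" "l u = l v" for u v
      using l' that by simp
    have up: "path_component (frame P ?A g) u v" if "path_component (frame P B g) u v" for u v
      using that frame_mono[OF e(2)] path_component_of_subset by metis
    show ?case
    proof (cases "l ?u = l ?v")
      case True
      then have "path_component (frame P B g) ?u ?v" using l ends by blast
      from pairwise_separated_add_cycle[OF insert.prems e this X(2,1)]
      obtain X' where "pairwise_separated (frame P ?A g) X'" "finite X'" "card X + 1 \<le> card X'" by blast
      then show ?thesis
        using X(3) insert.hyps l up by (intro exI[of _ X'] exI[of _ l]) auto
    next
      case False
      from pairwise_separated_add_arc[OF insert.prems e X(2,1)]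
      obtain X' where X': "pairwise_separated (frame P ?A g) X'" "finite X'" "card X' = card X" by blast
      \<comment> \<open>The label of \<open>?u\<close> is renamed to that of \<open>?v\<close>, so
        the number of labels drops by at least one, and the new edge connects the two classes that
        are merged.\<close>
      define m where "m w = (if l w = l ?u then l ?v else l w)" for w
      have "finite P" using insert.prems by (simp add: arc_drawing_def)
      have "m ` P \<subseteq> l ` P - {l ?u}" using ends False by (auto simp: m_def)
      then have "card (m ` P) \<le> card (l ` P - {l ?u})" using \<open>finite P\<close> by (intro card_mono) auto
      also have "\<dots> = card (l ` P) - 1" using ends(1) \<open>finite P\<close> by (simp add: card_Diff_singleton)
      finally have cm: "card (m ` P) \<le> card (l ` P) - 1" .
      have "card (l ` P) \<ge> 1" using ends(1) \<open>finite P\<close> by (metis card_0_eq empty_iff finite_imageI image_is_empty less_one not_le)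
      then have "card ?A + 1 + card (m ` P) \<le> card X' + card P"
        using X(3) X'(3) cm insert.hyps by simp
      moreover have "path_component (frame P ?A g) a b" if "a \<in> P" "b \<in> P" "m a = m b" for a b
      proof -
        have "path_image (g e) \<subseteq> frame P ?A g" by (auto simp: frame_def)
        then have uv: "path_component (frame P ?A g) ?u ?v"
          using arc_imp_path[OF ends(4)] unfolding path_component_def by blast
        have *: "path_component (frame P ?A g) w (if l w = l ?u then ?v else w)" if "w \<in> P" for w
        proof (cases "l w = l ?u")
          case True
          then show ?thesis using path_component_trans[OF up[OF l[OF \<open>w \<in> P\<close> ends(1) True]] uv] by simp
        next
          case False
          have "w \<in> frame P ?A g" using \<open>w \<in> P\<close> by (simp add: frame_def)
          then show ?thesis using False by (simp add: path_component_refl)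
        qed
        have ml: "m w = l (if l w = l ?u then ?v else w)" for w by (simp add: m_def)
        have "path_component (frame P ?A g) (if l a = l ?u then ?v else a) (if l b = l ?u then ?v else b)"
        proof (intro up l)
          show "l (if l a = l ?u then ?v else a) = l (if l b = l ?u then ?v else b)"
            using that(3) unfolding ml .
        qed (use that ends(2) in simp_all)
        then show ?thesis
          using path_component_trans[OF path_component_trans[OF *[OF that(1)]] path_component_sym[OF *[OF that(2)]]]
          by simp
      qed
      ultimately show ?thesis using X'(1,2) by (intro exI[of _ X'] exI[of _ m]) blast
    qed
  qed
  moreover have "finite A" using d by (simp add: arc_drawing_def)
  ultimately have "\<exists>X. \<exists>l :: complex \<Rightarrow> complex. finite X \<and> pairwise_separated (frame P A g) X \<and>
    card A + 1 + card (l ` P) \<le> card X + card P"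
    using d by meson
  then obtain X and l :: "complex \<Rightarrow> complex" where X: "finite X" "pairwise_separated (frame P A g) X"
    "card A + 1 + card (l ` P) \<le> card X + card P"
    by (elim exE conjE) (rule that)
  have "card (l ` P) \<ge> 1" if "P \<noteq> {}"
    using that d by (simp add: arc_drawing_def Suc_le_eq card_gt_0_iff)
  then show ?thesis using X by (intro exI[of _ X]) fastforce
qed

text \<open>An edge borders the face of \<open>x\<close> if an inner point of the edge lies in the
  closure of that face. The points of \<open>P\<close> are removed because a face may touch an edge
  at a vertex only.\<close>

definition incident_edges :: "'b::topological_space set \<Rightarrow> 'e set \<Rightarrow> ('e \<Rightarrow> real \<Rightarrow> 'b) \<Rightarrow> 'b \<Rightarrow> 'e set" where
  "incident_edges P A g x =
     {e \<in> A. (path_image (g e) - P) \<inter> closure (connected_component_set (- frame P A g) x) \<noteq> {}}"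

text \<open>A bridge separates nothing. If the ends of \<open>g e\<close> were in different path
  components, the frame would arise from \<open>g e\<close> by attaching first the component
  \<open>C\<close> of one end and then the remaining part, each time along a single point, and
  Janiszewski's theorem would keep \<open>x\<close> and \<open>y\<close> connected in the complement
  both times.\<close>

lemma merge_imp_cycle:
  fixes g :: "'e \<Rightarrow> real \<Rightarrow> complex"
  assumes d: "arc_drawing P A g" and e: "e \<in> A"
    and x: "x \<notin> frame P A g" and y: "y \<notin> frame P A g"
    and cc: "connected_component (- frame P (A - {e}) g) x y"
    and ncc: "\<not> connected_component (- frame P A g) x y"
  shows "path_component (frame P (A - {e}) g) (pathstart (g e)) (pathfinish (g e))"
proof (rule ccontr)
  let ?K = "frame P (A - {e}) g" and ?u = "pathstart (g e)" and ?v = "pathfinish (g e)"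
  assume npc: "\<not> path_component ?K ?u ?v"
  define C where "C = path_component_set ?K ?u"
  have dK: "arc_drawing P (A - {e}) g" using d arc_drawing_subset by blast
  note ends = arc_drawing_ends[OF d e]
  have CK: "C \<subseteq> ?K" unfolding C_def by (rule path_component_subset)
  have cl: "closed C" "closed (?K - C)"
    unfolding C_def using frame_component_split[OF dK ends(1)] by auto
  have cptC: "compact C"
    using cl(1) compact_frame[OF dK] CK by (metis compact_Int_closed inf.absorb2)
  have eK: "path_image (g e) \<inter> ?K = {?u, ?v}"
    using arc_drawing_Int_frame[OF d e] by blast
  have "P \<subseteq> ?K" by (auto simp: frame_def)
  have uC: "?u \<in> C" unfolding C_def using ends(1) \<open>P \<subseteq> ?K\<close> by (auto simp: path_component_refl)
  have vC: "?v \<notin> C" using npc by (simp add: C_def)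
  have A: "frame P A g = ?K \<union> path_image (g e)" using e frame_insert[of P e "A - {e}" g] by (simp add: insert_absorb)
  have "connected_component (- (path_image (g e) \<union> C)) x y"
  proof (rule Janiszewski)
    show "compact (path_image (g e))" using ends(4) by (rule compact_arc_image)
    show "closed C" by fact
    have "path_image (g e) \<inter> C = {?u}" using eK uC vC CK by blast
    then show "connected (path_image (g e) \<inter> C)" by simp
    show "connected_component (- path_image (g e)) x y"
      using connected_arc_complement[OF ends(4)] x y A by (simp add: connected_iff_connected_component)
    show "connected_component (- C) x y"
      using cc by (rule connected_component_of_subset) (use CK in auto)
  qed
  then have "connected_component (- ((path_image (g e) \<union> C) \<union> (?K - C))) x y"
  proof (rule Janiszewski[rotated 3])
    show "compact (path_image (g e) \<union> C)" using ends(4) cptC compact_arc_image compact_Un by blast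
    show "closed (?K - C)" by fact
    have "(path_image (g e) \<union> C) \<inter> (?K - C) = (path_image (g e) \<inter> ?K) - C" by blast
    also have "\<dots> = {?v}" using uC vC by (auto simp: eK)
    finally have "(path_image (g e) \<union> C) \<inter> (?K - C) = {?v}" .
    then show "connected ((path_image (g e) \<union> C) \<inter> (?K - C))" by simp
    show "connected_component (- (?K - C)) x y"
      using cc by (rule connected_component_of_subset) auto
  qed
  moreover have "(path_image (g e) \<union> C) \<union> (?K - C) = frame P A g" using A CK by blast
  ultimately show False using ncc by simp
qed

text \<open>Three faces along one edge would merge when it is deleted, so the edge lies on a Jordan
  curve \<open>c\<close> by \<open>merge_imp_cycle\<close>. Two of the three faces lie on the same
  side of \<open>c\<close>, and since \<open>c\<close> meets the rest of the frame exactly in the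
  connected arc \<open>h\<close>, Janiszewski's theorem joins them.\<close>

lemma card_incident_faces:
  fixes g :: "'e \<Rightarrow> real \<Rightarrow> complex"
  assumes d: "arc_drawing P A g" and e: "e \<in> A"
    and X: "pairwise_separated (frame P A g) X" "finite X"
  shows "card {x\<in>X. e \<in> incident_edges P A g x} \<le> 2"
proof (rule ccontr)
  let ?K = "frame P (A - {e}) g"
  let ?W = "\<lambda>x. connected_component_set (- frame P A g) x"
  assume "\<not> ?thesis"
  then have "3 \<le> card {x\<in>X. e \<in> incident_edges P A g x}" by simp
  then obtain Y where Y: "Y \<subseteq> {x\<in>X. e \<in> incident_edges P A g x}" "card Y = 3"
    by (rule obtain_subset_with_card_n)
  from Y(2) obtain x1 x2 x3 where x: "Y = {x1,x2,x3}" "x1 \<noteq> x2" "x2 \<noteq> x3" "x1 \<noteq> x3"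
    unfolding card_3_iff by (elim exE conjE) (rule that)
  have XF: "x \<notin> frame P A g" if "x \<in> X" for x using X that by (auto simp: pairwise_separated_def)
  have A: "frame P A g = ?K \<union> path_image (g e)" using e frame_insert[of P e "A - {e}" g] by (simp add: insert_absorb)
  have eK: "path_image (g e) \<inter> ?K = {pathstart (g e), pathfinish (g e)}"
    using arc_drawing_Int_frame[OF d e] by blast
  obtain m where m: "m \<in> path_image (g e) - P" using arc_link_nonempty[OF d e] .
  have ccm: "connected_component (- ?K) x m" if "x \<in> Y" for x
  proof -
    from that Y obtain q where q: "q \<in> path_image (g e) - P" "q \<in> closure (?W x)" and xX: "x \<in> X"
      by (auto simp: incident_edges_def)
    have "connected (insert q (?W x))"
      using q(2) closure_subset[of "?W x"]
      by (intro connected_intermediate_closure[OF connected_connected_component]) blast+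
    moreover have "q \<notin> ?K" using connected_component_link[OF d e _ _ q(1) q(1), of "A - {e}"] by simp
    moreover have "?W x \<subseteq> - ?K" using connected_component_subset[of "- frame P A g" x] A by blast
    moreover have "x \<in> ?W x" using XF[OF xX] by simp
    ultimately have "insert q (?W x) \<subseteq> connected_component_set (- ?K) x"
      by (intro connected_component_maximal) blast+
    then have "connected_component (- ?K) x q" by blast
    moreover have "connected_component (- ?K) q m"
      using connected_component_link[OF d e _ _ q(1) m, of "A - {e}"] by simp
    ultimately show ?thesis by (rule connected_component_trans)
  qed
  have ccK: "connected_component (- ?K) x y" if "x \<in> Y" "y \<in> Y" for x y
    using ccm[OF that(1)] ccm[OF that(2)] by (meson connected_component_sym connected_component_trans)
  have sepA: "\<not> connected_component (- frame P A g) x y" if "x \<in> Y" "y \<in> Y" "x \<noteq> y" for x y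
    using X(1) Y(1) that unfolding pairwise_separated_def by blast
  have YF: "x \<notin> frame P A g" if "x \<in> Y" for x using XF Y(1) that by blast
  have x12: "x1 \<in> Y" "x2 \<in> Y" "x3 \<in> Y" using x by auto
  have pc: "path_component ?K (pathstart (g e)) (pathfinish (g e))"
    using merge_imp_cycle[OF d e YF[OF x12(1)] YF[OF x12(2)] ccK[OF x12(1,2)] sepA[OF x12(1,2) x(2)]] .
  obtain c h where c: "simple_path c" "pathfinish c = pathstart c" "arc h"
    "path_image c = path_image (g e) \<union> path_image h" "path_image h \<subseteq> ?K"
    "pathstart h = pathstart (g e)" "pathfinish h = pathfinish (g e)"
    using frame_cycle[OF d e _ _ pc] by blast
  obtain V W where VW: "connected V" "connected W" "V \<union> W = - path_image c"
    using Jordan_curve[OF c(1,2)] by metis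
  have cF: "path_image c \<subseteq> frame P A g" using c A by auto
  have same: False if "x \<in> Y" "y \<in> Y" "x \<noteq> y" "connected S" "S \<subseteq> - path_image c" "x \<in> S" "y \<in> S" for x y S
  proof -
    have "connected_component (- (path_image c \<union> ?K)) x y"
    proof (rule Janiszewski)
      show "compact (path_image c)" using c(1) by (rule compact_simple_path_image)
      show "closed ?K" using compact_frame[OF arc_drawing_subset[OF d]] compact_imp_closed by blast
      have "path_image c \<inter> ?K = {pathstart h, pathfinish h} \<union> path_image h"
        using c(5) eK unfolding c(4,6,7) by blast
      moreover have "{pathstart h, pathfinish h} \<subseteq> path_image h"
        using pathstart_in_path_image[of h] pathfinish_in_path_image[of h] by (rule insert_subsetI[OF _ insert_subsetI]) simp
      ultimately have "path_image c \<inter> ?K = path_image h"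
        by (metis subset_Un_eq)
      then show "connected (path_image c \<inter> ?K)" using c(3) connected_arc_image by simp
      show "connected_component (- path_image c) x y" using that unfolding connected_component_def by blast
      show "connected_component (- ?K) x y" using ccK that by blast
    qed
    moreover have "path_image c \<union> ?K = frame P A g" using A c(4,5) by blast
    ultimately show False using sepA that by simp
  qed
  have "x \<in> V \<or> x \<in> W" if "x \<in> Y" for x using VW(3) YF[OF that] cF by blast
  then show False
    using same[of _ _ V] same[of _ _ W] VW x x12 by (metis Un_upper1 Un_upper2)
qed

text \<open>A minimal set of edges around a face that still separates it from another point has no
  vertex of degree one, by Janiszewski's theorem.\<close>

lemma card_incident_edges:
  fixes g :: "'e \<Rightarrow> real \<Rightarrow> complex"
  assumes d: "arc_drawing P A g" and PLR: "L \<inter> R = {}"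
    and LR: "\<And>e. e \<in> A \<Longrightarrow> pathstart (g e) \<in> L \<and> pathfinish (g e) \<in> R"
    and simple: "\<And>e f. e \<in> A \<Longrightarrow> f \<in> A \<Longrightarrow> pathstart (g e) = pathstart (g f) \<Longrightarrow> pathfinish (g e) = pathfinish (g f) \<Longrightarrow> e = f"
    and x: "x \<notin> frame P A g" and y: "y \<notin> frame P A g"
    and ncc: "\<not> connected_component (- frame P A g) x y"
  shows "4 \<le> card (incident_edges P A g x)"
proof -
  let ?E = "incident_edges P A g x"
  let ?W = "connected_component_set (- frame P A g) x"
  have fin: "finite P" "finite A" using d by (auto simp: arc_drawing_def)
  have EA: "?E \<subseteq> A" by (auto simp: incident_edges_def)
  \<comment> \<open>A connected set that leaves the face of \<open>x\<close> crosses its frontier,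
    which is part of the frame, at a vertex or at an inner point of an incident edge. So
    \<open>P\<close> and the incident edges alone separate \<open>x\<close> from
    \<open>y\<close>.\<close>
  have nE: "\<not> connected_component (- frame P ?E g) x y"
  proof
    assume "connected_component (- frame P ?E g) x y"
    then obtain T where T: "connected T" "T \<subseteq> - frame P ?E g" "x \<in> T" "y \<in> T"
      unfolding connected_component_def by blast
    have "T \<inter> frontier ?W \<noteq> {}"
      using T x ncc by (intro connected_Int_frontier) auto
    then obtain q where q: "q \<in> T" "q \<in> frontier ?W" by blast
    have "closed (frame P A g)" using compact_frame[OF d] by (rule compact_imp_closed)
    then have "frontier ?W \<subseteq> frame P A g"
      using frontier_of_connected_component_subset[of "- frame P A g" x] frontier_subset_closed by fastforce
    then have "q \<in> frame P A g" using q by blast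
    moreover have "q \<notin> P" using q T by (auto simp: frame_def)
    ultimately obtain e where e: "e \<in> A" "q \<in> path_image (g e)" by (auto simp: frame_def)
    then have "e \<in> ?E" using \<open>q \<notin> P\<close> q(2) by (auto simp: incident_edges_def frontier_def)
    then show False using q(1) T(2) e(2) by (auto simp: frame_def)
  qed
  have "finite ?E" using EA fin finite_subset by blast
  define Q where "Q F \<longleftrightarrow> F \<subseteq> ?E \<and> \<not> connected_component (- frame P F g) x y" for F
  have "Q ?E" using nE by (simp add: Q_def)
  define F where "F = (ARG_MIN card F. Q F)"
  have QF: "Q F" and Fmin: "\<And>F'. Q F' \<Longrightarrow> card F \<le> card F'"
    unfolding F_def using arg_min_natI[of Q, OF \<open>Q ?E\<close>] arg_min_nat_le[of Q] by blast+
  have FE: "F \<subseteq> ?E" and nF: "\<not> connected_component (- frame P F g) x y" using QF by (auto simp: Q_def)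
  have FA: "F \<subseteq> A" using FE EA by blast
  have "finite F" using FE \<open>finite ?E\<close> finite_subset by blast
  have less: "connected_component (- frame P (F - {e}) g) x y" if "e \<in> F" for e
    using Fmin[of "F - {e}"] that FE card_Diff1_less[OF \<open>finite F\<close> that] by (auto simp: Q_def)
  have xF: "x \<notin> frame P F g" "y \<notin> frame P F g" using x y frame_mono[OF FA] by blast+
  have "F \<noteq> {}"
  proof
    assume "F = {}"
    have "path_connected (- P)" using fin(1) countable_finite by (intro path_connected_complement_countable) auto
    then have "connected_component (- P) x y"
      using xF path_connected_imp_connected by (auto simp: frame_def connected_iff_connected_component)
    then show False using nF \<open>F = {}\<close> by (simp add: frame_def)
  qed
  have leaf: "\<exists>f\<in>F. f \<noteq> e \<and> v \<in> {pathstart (g f), pathfinish (g f)}"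
    if e: "e \<in> F" and v: "v \<in> {pathstart (g e), pathfinish (g e)}" for e v
  proof (rule ccontr)
    assume no: "\<not> ?thesis"
    have eA: "e \<in> A" using e FA by blast
    note ends = arc_drawing_ends[OF d eA]
    \<comment> \<open>As no other edge of \<open>F\<close> ends in \<open>v\<close>, the frame
      without \<open>e\<close> stays closed when \<open>v\<close> is removed, and then meets
      \<open>g e\<close> in its other end only. Adding \<open>g e\<close> brings \<open>v\<close>
      back.\<close>
    let ?T = "frame P (F - {e}) g - {v}"
    have PI: "path_image (g f) \<inter> P = {pathstart (g f), pathfinish (g f)}" if "f \<in> A" for f
      using d that by (simp add: arc_drawing_def)
    have "v \<in> P" using v ends by blast
    then have T: "?T = (P - {v}) \<union> (\<Union>f\<in>F - {e}. path_image (g f))"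
      using no PI FA unfolding frame_def by blast
    have "closed ?T"
      unfolding T using fin \<open>finite F\<close> FA arc_drawing_ends(4)[OF d]
      by (intro closed_Un closed_UN) (auto intro: finite_imp_closed closed_arc_image)
    have "path_image (g e) \<inter> frame P (F - {e}) g = {pathstart (g e), pathfinish (g e)}"
      using FA by (intro arc_drawing_Int_frame[OF d eA]) auto
    then have I: "path_image (g e) \<inter> ?T = {pathstart (g e), pathfinish (g e)} - {v}" by blast
    have "connected_component (- (path_image (g e) \<union> ?T)) x y"
    proof (rule Janiszewski)
      show "compact (path_image (g e))" using ends(4) by (rule compact_arc_image)
      show "closed ?T" by fact
      show "connected (path_image (g e) \<inter> ?T)"
        unfolding I using v ends(3) by (cases "v = pathstart (g e)") (simp_all add: insert_Diff_if)
      have "x \<notin> path_image (g e)" "y \<notin> path_image (g e)" using xF e by (auto simp: frame_def)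
      then show "connected_component (- path_image (g e)) x y"
        using connected_arc_complement[OF ends(4)] by (simp add: connected_iff_connected_component)
      show "connected_component (- ?T) x y"
        using less[OF e] by (rule connected_component_of_subset) auto
    qed
    moreover have "path_image (g e) \<union> ?T = frame P F g"
      using e v pathstart_in_path_image[of "g e"] pathfinish_in_path_image[of "g e"]
      by (auto simp: frame_def)
    ultimately show False using nF by simp
  qed
  from \<open>F \<noteq> {}\<close> obtain e where e: "e \<in> F" by blast
  have LRF: "pathstart (g f) \<in> L" "pathfinish (g f) \<in> R" if "f \<in> F" for f using LR FA that by blast+
  have sF: "f = f'" if "f \<in> F" "f' \<in> F" "pathstart (g f) = pathstart (g f')" "pathfinish (g f) = pathfinish (g f')" for f f'
    using simple FA that by blast
  \<comment> \<open>Each end of an edge of \<open>F\<close> lies on a second edge of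
    \<open>F\<close>, so \<open>e\<close> can be continued at both ends and once more beyond
    \<open>e1\<close>. In a simple bipartite graph the path \<open>e2\<close>, \<open>e\<close>,
    \<open>e1\<close>, \<open>e3\<close> has four distinct edges.\<close>
  obtain e1 where e1: "e1 \<in> F" "e1 \<noteq> e" "pathstart (g e1) = pathstart (g e)"
    using leaf[OF e, of "pathstart (g e)"] LRF e PLR by (metis disjoint_iff insertE insertI1 singletonD)
  obtain e2 where e2: "e2 \<in> F" "e2 \<noteq> e" "pathfinish (g e2) = pathfinish (g e)"
    using leaf[OF e, of "pathfinish (g e)"] LRF e PLR by (metis disjoint_iff insertE insertI1 insertI2 singletonD)
  obtain e3 where e3: "e3 \<in> F" "e3 \<noteq> e1" "pathfinish (g e3) = pathfinish (g e1)"
    using leaf[OF e1(1), of "pathfinish (g e1)"] LRF e1 PLR by (metis disjoint_iff insertE insertI1 insertI2 singletonD)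
  have "e1 \<noteq> e2" using sF e e1 e2 by metis
  moreover have "e3 \<noteq> e" using sF e e1 e3 by metis
  moreover have "e3 \<noteq> e2" using sF e e1 e2 e3 by metis
  ultimately have "card {e, e1, e2, e3} = 4" using e1(2) e2(2) e3(2) by simp
  then show ?thesis
    using card_mono[OF \<open>finite ?E\<close>, of "{e,e1,e2,e3}"] e e1 e2 e3 FE by auto
qed

text \<open>A weak form of Euler's formula, double counted: it provides \<open>|A| + 2 - |P|\<close> points in distinct faces,
  each face is bordered by at least four edges, and each edge borders at most two faces.\<close>

theorem planar_bipartite_bound:
  fixes g :: "'e \<Rightarrow> real \<Rightarrow> complex"
  assumes d: "arc_drawing P A g" and PLR: "L \<inter> R = {}"
    and LR: "\<And>e. e \<in> A \<Longrightarrow> pathstart (g e) \<in> L \<and> pathfinish (g e) \<in> R"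
    and simple: "\<And>e f. e \<in> A \<Longrightarrow> f \<in> A \<Longrightarrow> pathstart (g e) = pathstart (g f) \<Longrightarrow> pathfinish (g e) = pathfinish (g f) \<Longrightarrow> e = f"
  shows "card A \<le> 2 * card P"
proof (rule ccontr)
  assume less: "\<not> ?thesis"
  have fin: "finite P" "finite A" using d by (auto simp: arc_drawing_def)
  have "A \<noteq> {}" using less by auto
  then have "P \<noteq> {}" using arc_drawing_ends(1)[OF d] by blast
  then obtain X where X: "finite X" "pairwise_separated (frame P A g) X" "card A + 2 \<le> card X + card P"
    using ex_pairwise_separated[OF d] by blast
  \<comment> \<open>The assumed excess of edges guarantees a second face, so that every face is
    separated from another one by the edges around it.\<close>
  then have "card X \<ge> 2" using less by simp
  let ?I = "incident_edges P A g"
  have four: "4 \<le> card (?I x)" if "x \<in> X" for x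
  proof -
    have "card (X - {x}) \<ge> 1" using that X(1) \<open>card X \<ge> 2\<close> by simp
    then obtain y where "y \<in> X" "y \<noteq> x" by (metis card.empty ex_in_conv Diff_iff singletonI not_one_le_zero)
    then show ?thesis using X(2) that
      by (intro card_incident_edges[OF d PLR LR simple]) (auto simp: pairwise_separated_def)
  qed
  have "4 * card X \<le> (\<Sum>x\<in>X. card (?I x))" using sum_bounded_below[of X 4 "\<lambda>x. card (?I x)"] four by simp
  also have "\<dots> = (\<Sum>x\<in>X. \<Sum>e\<in>A. if e \<in> ?I x then 1 else 0)"
  proof (rule sum.cong)
    fix x
    have "?I x = A \<inter> {e. e \<in> ?I x}" by (auto simp: incident_edges_def)
    then show "card (?I x) = (\<Sum>e\<in>A. if e \<in> ?I x then 1 else 0)"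
      using fin(2) by (simp add: sum.If_cases)
  qed simp
  also have "\<dots> = (\<Sum>e\<in>A. \<Sum>x\<in>X. if e \<in> ?I x then 1 else 0)" by (rule sum.swap)
  also have "\<dots> = (\<Sum>e\<in>A. card {x\<in>X. e \<in> ?I x})"
    using X(1) by (simp add: sum.If_cases Int_def)
  also have "\<dots> \<le> (\<Sum>e\<in>A. 2)" using card_incident_faces[OF d _ X(2,1)] by (rule sum_mono)
  finally show False using X(3) less by simp
qed

section \<open>Bipartite graphs on the torus\<close>

text \<open>Shared by both coverings: \<open>p\<close> is the covering map, and the lifted edge
  \<open>i\<close> lies over the edge \<open>q i\<close>. Since the arcs below are injective and
  meet only in vertices, the lifts are arcs, lifts of different edges meet only over vertices, and
  two lifts of one edge could meet only at equal parameters, which \<open>sep\<close> forbids. The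
  bipartition is pulled back along \<open>p\<close>.\<close>

lemma lifted_bipartite_bound:
  fixes g :: "'e \<Rightarrow> real \<Rightarrow> 'b::topological_space" and h :: "'d \<Rightarrow> real \<Rightarrow> complex"
  assumes d: "arc_drawing P A g" and PLR: "L \<inter> R = {}"
    and LR: "\<And>e. e \<in> A \<Longrightarrow> pathstart (g e) \<in> L \<and> pathfinish (g e) \<in> R"
    and simple: "\<And>e f. e \<in> A \<Longrightarrow> f \<in> A \<Longrightarrow> pathstart (g e) = pathstart (g f) \<Longrightarrow> pathfinish (g e) = pathfinish (g f) \<Longrightarrow> e = f"
    and fin: "finite P'" "finite A'"
    and pP: "\<And>x. x \<in> P' \<Longrightarrow> p x \<in> P"
    and q: "\<And>i. i \<in> A' \<Longrightarrow> q i \<in> A"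
    and path: "\<And>i. i \<in> A' \<Longrightarrow> path (h i)"
    and lift: "\<And>i t. i \<in> A' \<Longrightarrow> t \<in> {0..1} \<Longrightarrow> p (h i t) = g (q i) t"
    and ends: "\<And>i. i \<in> A' \<Longrightarrow> pathstart (h i) \<in> P' \<and> pathfinish (h i) \<in> P'"
    and sep: "\<And>i j t. i \<in> A' \<Longrightarrow> j \<in> A' \<Longrightarrow> q i = q j \<Longrightarrow> t \<in> {0..1} \<Longrightarrow> h i t = h j t \<Longrightarrow> i = j"
  shows "card A' \<le> 2 * card P'"
proof -
  have inj: "inj_on (g e) {0..1}" if "e \<in> A" for e
    using arc_drawing_ends(4)[OF d that] by (simp add: arc_def)
  have arc: "arc (h i)" if i: "i \<in> A'" for i
    unfolding arc_def inj_on_def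
  proof (intro conjI ballI impI)
    fix s t :: real assume st: "s \<in> {0..1}" "t \<in> {0..1}" "h i s = h i t"
    then have "g (q i) s = g (q i) t" using lift[OF i] by metis
    then show "s = t" using inj[OF q[OF i]] st by (auto dest: inj_onD)
  qed (rule path[OF i])
  have ver: "t = 0 \<or> t = 1" if i: "i \<in> A'" and t: "t \<in> {0..1}" and P: "g (q i) t \<in> P" for i t
  proof -
    have "g (q i) t \<in> path_image (g (q i)) \<inter> P" using t P by (auto simp: path_image_def)
    also have "\<dots> = {pathstart (g (q i)), pathfinish (g (q i))}"
      using d q[OF i] by (simp add: arc_drawing_def)
    finally have "g (q i) t = g (q i) 0 \<or> g (q i) t = g (q i) 1"
      by (auto simp: pathstart_def pathfinish_def)
    then show ?thesis using inj_onD[OF inj[OF q[OF i]], of t 0] inj_onD[OF inj[OF q[OF i]], of t 1] t by auto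
  qed
  have "arc_drawing P' A' h"
    unfolding arc_drawing_def
  proof (intro conjI ballI impI)
    fix i assume i: "i \<in> A'"
    show "path_image (h i) \<inter> P' = {pathstart (h i), pathfinish (h i)}"
    proof (intro equalityI subsetI)
      fix x assume "x \<in> path_image (h i) \<inter> P'"
      then obtain t where t: "t \<in> {0..1}" "x = h i t" "x \<in> P'" by (auto simp: path_image_def)
      then have "g (q i) t \<in> P" using lift[OF i t(1)] pP by metis
      then show "x \<in> {pathstart (h i), pathfinish (h i)}"
        using ver[OF i t(1)] t by (auto simp: pathstart_def pathfinish_def)
    qed (use ends[OF i] in auto)
    fix j assume j: "j \<in> A'" "i \<noteq> j"
    show "path_image (h i) \<inter> path_image (h j) \<subseteq> P'"
    proof
      fix x assume "x \<in> path_image (h i) \<inter> path_image (h j)"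
      then obtain s t where t: "t \<in> {0..1}" "x = h i t" "s \<in> {0..1}" "x = h j s" by (auto simp: path_image_def)
      then have eq: "g (q i) t = g (q j) s" using lift[OF i t(1)] lift[OF j(1) t(3)] by simp
      show "x \<in> P'"
      proof (cases "g (q i) t \<in> P")
        case True
        then have "t = 0 \<or> t = 1" using ver[OF i t(1)] by simp
        then show ?thesis using ends[OF i] t by (auto simp: pathstart_def pathfinish_def)
      next
        case False
        have "g (q i) t \<in> path_image (g (q i)) \<inter> path_image (g (q j))"
          using t(1,3) imageI[of s "{0..1}" "g (q j)"] by (simp add: path_image_def eq) (use eq in \<open>simp flip: eq\<close>)
        then have "q i = q j" using False d q i j unfolding arc_drawing_def by blast
        then have "s = t" using inj_onD[OF inj[OF q[OF i]], of s t] eq t by simp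
        then show ?thesis using sep[OF i j(1) \<open>q i = q j\<close> t(1)] t j by metis
      qed
    qed
  qed (use fin arc in auto)
  moreover have "p -` L \<inter> p -` R = {}" using PLR by auto
  moreover have "pathstart (h i) \<in> p -` L \<and> pathfinish (h i) \<in> p -` R" if "i \<in> A'" for i
    using LR[OF q[OF that]] lift[OF that, of 0] lift[OF that, of 1] by (simp add: pathstart_def pathfinish_def)
  moreover have "i = j" if "i \<in> A'" "j \<in> A'" "pathstart (h i) = pathstart (h j)" "pathfinish (h i) = pathfinish (h j)" for i j
  proof -
    have "q i = q j"
      using that lift[OF that(1), of 0] lift[OF that(1), of 1] lift[OF that(2), of 0] lift[OF that(2), of 1]
      by (intro simple q) (auto simp: pathstart_def pathfinish_def)
    then show ?thesis using sep[OF that(1,2), of 0] that(3) by (simp add: pathstart_def)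
  qed
  ultimately show ?thesis by (rule planar_bipartite_bound)
qed

section \<open>The universal cover of the torus\<close>

definition torus_map :: "complex \<Rightarrow> complex \<times> complex" where
  "torus_map z = (cis (2 * pi * Re z), cis (2 * pi * Im z))"

lemma cis_2pi_eq_iff: "cis (2 * pi * a) = cis (2 * pi * b) \<longleftrightarrow> (\<exists>n::int. a = b + of_int n)"
proof -
  have "cis (2 * pi * a) = cis (2 * pi * b) \<longleftrightarrow> (\<exists>n::int. 2 * pi * a = 2 * pi * b + 2 * pi * of_int n)"
  proof -
    have *: "2 * pi * a = 2 * pi * b + 2 * pi * of_int n \<longleftrightarrow>
      \<i> * complex_of_real (2 * pi * a) = \<i> * complex_of_real (2 * pi * b) + (of_int (2 * n) * pi) * \<i>" for n :: int
      by (simp add: complex_eq_iff) (auto simp: algebra_simps)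
    show ?thesis unfolding cis_conv_exp exp_eq * ..
  qed
  also have "\<dots> \<longleftrightarrow> (\<exists>n::int. a = b + of_int n)"
  proof -
    have "2 * pi * a = 2 * pi * b + 2 * pi * of_int n \<longleftrightarrow> a = b + of_int n" for n :: int
      by (metis distrib_left mult_cancel_left pi_neq_zero mult_eq_0_iff zero_neq_numeral)
    then show ?thesis by simp
  qed
  finally show ?thesis .
qed

definition lattice_point :: "int \<times> int \<Rightarrow> complex" where
  "lattice_point k = Complex (of_int (fst k)) (of_int (snd k))"

lemma lattice_point_inject [simp]: "lattice_point k = lattice_point l \<longleftrightarrow> k = l"
  by (auto simp: lattice_point_def prod_eq_iff)

lemma lattice_point_add: "lattice_point (k + l) = lattice_point k + lattice_point l"
  by (simp add: lattice_point_def complex_eq_iff)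

lemma torus_map_eq_iff: "torus_map z = torus_map w \<longleftrightarrow> (\<exists>k. z = w + lattice_point k)"
  unfolding torus_map_def prod.inject cis_2pi_eq_iff by (auto simp: lattice_point_def complex_eq_iff)

lemma torus_map_add_lattice [simp]: "torus_map (z + lattice_point k) = torus_map z"
  using torus_map_eq_iff by blast

lemma torus_map_surj:
  assumes "x \<in> sphere 0 1 \<times> sphere 0 1"
  obtains z where "torus_map z = x"
proof -
  obtain u v where x: "x = (u, v)" "cmod u = 1" "cmod v = 1" using assms by (cases x) auto
  have "torus_map (Complex (Arg u / (2 * pi)) (Arg v / (2 * pi))) = x"
    using x cis_Arg[of u] cis_Arg[of v] norm_zero by (force simp: torus_map_def sgn_div_norm)
  then show thesis by (rule that)
qed

text \<open>A continuous logarithm exists on the contractible interval, and modulus one makes it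
  purely imaginary.\<close>

lemma circle_path_lift:
  fixes g :: "real \<Rightarrow> complex"
  assumes "continuous_on {0..1} g" "\<And>t. t \<in> {0..1} \<Longrightarrow> cmod (g t) = 1"
  obtains \<theta> where "continuous_on {0..1} \<theta>" "\<And>t. t \<in> {0..1} \<Longrightarrow> g t = cis (2 * pi * \<theta> t)"
proof -
  have "contractible {0..1::real}" by (simp add: convex_imp_contractible)
  moreover have "g t \<noteq> 0" if "t \<in> {0..1}" for t using assms(2)[OF that] by auto
  ultimately obtain h where h: "continuous_on {0..1} h" "\<And>t. t \<in> {0..1} \<Longrightarrow> g t = exp (h t)"
    using continuous_logarithm_on_contractible[OF assms(1)] by metis
  show thesis
  proof
    show "continuous_on {0..1} (\<lambda>t. Im (h t) / (2 * pi))"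
      by (intro continuous_intros h) auto
    fix t :: real assume t: "t \<in> {0..1}"
    have "exp (Re (h t)) = 1" using assms(2)[OF t] h(2)[OF t] by simp
    then have "Re (h t) = 0" by simp
    then show "g t = cis (2 * pi * (Im (h t) / (2 * pi)))"
      using h(2)[OF t] by (simp add: exp_eq_polar)
  qed
qed

text \<open>Each circle factor is lifted separately; a lattice translation then moves the start to
  the prescribed point \<open>z\<close> over it.\<close>

lemma torus_path_lift:
  fixes g :: "real \<Rightarrow> complex \<times> complex"
  assumes "path g" "path_image g \<subseteq> sphere 0 1 \<times> sphere 0 1" "torus_map z = pathstart g"
  obtains h where "path h" "h 0 = z" "\<And>t. t \<in> {0..1} \<Longrightarrow> torus_map (h t) = g t"
proof -
  have c: "continuous_on {0..1} (\<lambda>t. fst (g t))" "continuous_on {0..1} (\<lambda>t. snd (g t))"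
    using assms(1) unfolding path_def by (auto intro!: continuous_intros)
  have n: "cmod (fst (g t)) = 1" "cmod (snd (g t)) = 1" if "t \<in> {0..1}" for t
  proof -
    have "g t \<in> sphere 0 1 \<times> sphere 0 1" using assms(2) that by (auto simp: path_image_def)
    then show "cmod (fst (g t)) = 1" "cmod (snd (g t)) = 1" by (auto simp: mem_Times_iff)
  qed
  obtain a where a: "continuous_on {0..1} a" "\<And>t. t \<in> {0..1} \<Longrightarrow> fst (g t) = cis (2 * pi * a t)"
    using circle_path_lift[OF c(1) n(1)] by blast
  obtain b where b: "continuous_on {0..1} b" "\<And>t. t \<in> {0..1} \<Longrightarrow> snd (g t) = cis (2 * pi * b t)"
    using circle_path_lift[OF c(2) n(2)] by blast
  define h where "h t = Complex (a t) (b t)" for t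
  have th: "torus_map (h t) = g t" if "t \<in> {0..1}" for t
    using a(2)[OF that] b(2)[OF that] by (simp add: torus_map_def h_def prod_eq_iff)
  then have "torus_map z = torus_map (h 0)" using assms(3) by (simp add: pathstart_def)
  then obtain k where k: "z = h 0 + lattice_point k" unfolding torus_map_eq_iff by blast
  show thesis
  proof
    show "path (\<lambda>t. h t + lattice_point k)"
      unfolding path_def h_def Complex_eq by (intro continuous_intros a b)
  qed (use k th in auto)
qed

text \<open>In the plane, an \<open>N \<times> N\<close> block of translates of the lifted drawing has \<open>N\<^sup>2 |P|\<close> vertices and all but
  \<open>O(N)\<close> of its \<open>N\<^sup>2 |A|\<close> edges; the bound for the plane is divided by \<open>N\<^sup>2\<close> as \<open>N\<close> grows.\<close>

lemma torus_bipartite_bound: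
  fixes g :: "'e \<Rightarrow> real \<Rightarrow> complex \<times> complex"
  assumes d: "arc_drawing P A g" and PLR: "L \<inter> R = {}"
    and LR: "\<And>e. e \<in> A \<Longrightarrow> pathstart (g e) \<in> L \<and> pathfinish (g e) \<in> R"
    and simple: "\<And>e f. e \<in> A \<Longrightarrow> f \<in> A \<Longrightarrow> pathstart (g e) = pathstart (g f) \<Longrightarrow> pathfinish (g e) = pathfinish (g f) \<Longrightarrow> e = f"
    and T: "\<And>e. e \<in> A \<Longrightarrow> path_image (g e) \<subseteq> sphere 0 1 \<times> sphere 0 1"
  shows "card A \<le> 2 * card P"
proof (rule ccontr)
  assume less: "\<not> ?thesis"
  have fin: "finite P" "finite A" using d by (auto simp: arc_drawing_def)
  define l where "l v = (SOME z. torus_map z = v)" for v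
  have l: "torus_map (l v) = v" if "v \<in> sphere 0 1 \<times> sphere 0 1" for v
    unfolding l_def by (rule someI_ex) (use torus_map_surj[OF that] in metis)
  have "\<exists>h. path h \<and> h 0 = l (pathstart (g e)) \<and> (\<forall>t\<in>{0..1}. torus_map (h t) = g e t)" if "e \<in> A" for e
  proof -
    have "torus_map (l (pathstart (g e))) = pathstart (g e)"
      using T[OF that] by (intro l) (use pathstart_in_path_image in blast)
    then show ?thesis
      using torus_path_lift[OF arc_imp_path[OF arc_drawing_ends(4)[OF d that]] T[OF that]] by metis
  qed
  then obtain h where h: "\<And>e. e \<in> A \<Longrightarrow> path (h e)" "\<And>e. e \<in> A \<Longrightarrow> h e 0 = l (pathstart (g e))"
    "\<And>e t. e \<in> A \<Longrightarrow> t \<in> {0..1} \<Longrightarrow> torus_map (h e t) = g e t"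
    by metis
  have "\<exists>k. h e 1 = l (pathfinish (g e)) + lattice_point k" if "e \<in> A" for e
  proof -
    have "torus_map (l (pathfinish (g e))) = pathfinish (g e)"
      using T[OF that] by (intro l) (use pathfinish_in_path_image in blast)
    then have "torus_map (h e 1) = torus_map (l (pathfinish (g e)))"
      using h(3)[OF that] by (simp add: pathfinish_def)
    then show ?thesis by (simp add: torus_map_eq_iff)
  qed
  then obtain z where z: "\<And>e. e \<in> A \<Longrightarrow> h e 1 = l (pathfinish (g e)) + lattice_point (z e)" by metis
  \<comment> \<open>\<open>z e\<close> is the lattice displacement of the chosen lift of
    \<open>e\<close>. As \<open>M\<close> bounds all of them, a lift that starts at distance
    \<open>M\<close> from the border of the block also ends in the block.\<close>
  define M where "M = (\<Sum>e\<in>A. nat \<bar>fst (z e)\<bar> + nat \<bar>snd (z e)\<bar>)"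
  have M: "\<bar>fst (z e)\<bar> \<le> int M" "\<bar>snd (z e)\<bar> \<le> int M" if "e \<in> A" for e
  proof -
    have "nat \<bar>fst (z e)\<bar> + nat \<bar>snd (z e)\<bar> \<le> M"
      unfolding M_def using fin(2) that by (intro member_le_sum) auto
    then show "\<bar>fst (z e)\<bar> \<le> int M" "\<bar>snd (z e)\<bar> \<le> int M" by linarith+
  qed
  define p where "p = card P"
  \<comment> \<open>Chosen such that \<open>K^2\<close> exceeds \<open>8 p M K + 8 p M^2\<close>,
    the difference of \<open>2 p (K + 2 M)^2\<close> and \<open>2 p K^2\<close>. The side
    \<open>N\<close> adds a margin of width \<open>M\<close> around an inner block of side
    \<open>K\<close>.\<close>
  define K where "K = 8 * p * M + 8 * p * M * M + 1"
  define N where "N = K + 2 * M"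
  define J where "J = {0..<int N} \<times> {0..<int N}"
  define A' where "A' = {(e, k). e \<in> A \<and> k \<in> J \<and> k + z e \<in> J}"
  define P' where "P' = (\<lambda>(v, k). l v + lattice_point k) ` (P \<times> J)"
  have "finite J" "card J = N * N" by (auto simp: J_def card_cartesian_product)
  have "finite A'" by (rule finite_subset[of _ "A \<times> J"]) (use fin \<open>finite J\<close> in \<open>auto simp: A'_def\<close>)
  have Psub: "v \<in> sphere 0 1 \<times> sphere 0 1" if "v = pathstart (g e) \<or> v = pathfinish (g e)" "e \<in> A" for v e
    using T[OF that(2)] that(1) by (metis pathfinish_in_path_image pathstart_in_path_image subsetD)
  \<comment> \<open>The arcs lie on the torus, but \<open>P\<close> may contain isolated points off
    it, which have no lifts. The vertices of the lifted drawing are taken over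
    \<open>Q\<close>.\<close>
  define Q where "Q = P \<inter> (sphere 0 1 \<times> sphere 0 1)"
  define Q' where "Q' = (\<lambda>(v, k). l v + lattice_point k) ` (Q \<times> J)"
  have "card A' \<le> 2 * card Q'"
  proof (rule lifted_bipartite_bound[where q = fst and p = torus_map and
        h = "\<lambda>(e, k) t. h e t + lattice_point k", OF d PLR LR simple])
    show "finite Q'" using fin \<open>finite J\<close> by (simp add: Q'_def Q_def)
    show "torus_map x \<in> P" if "x \<in> Q'" for x
      using that l by (auto simp: Q'_def Q_def)
    show "path ((\<lambda>(e, k) t. h e t + lattice_point k) i)" if "i \<in> A'" for i
      using that h(1) by (auto simp: A'_def path_def intro!: continuous_intros)
    show "pathstart ((\<lambda>(e, k) t. h e t + lattice_point k) i) \<in> Q' \<and>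
      pathfinish ((\<lambda>(e, k) t. h e t + lattice_point k) i) \<in> Q'" if iA: "i \<in> A'" for i
    proof -
      obtain e k where i: "i = (e, k)" "e \<in> A" "k \<in> J" "k + z e \<in> J" using iA by (auto simp: A'_def)
      note ends = arc_drawing_ends(1,2)[OF d i(2)]
      have Q: "(pathstart (g e), k) \<in> Q \<times> J" "(pathfinish (g e), k + z e) \<in> Q \<times> J"
        using i ends Psub[OF _ i(2)] by (simp_all add: Q_def)
      have "h e 0 + lattice_point k \<in> Q'"
        unfolding Q'_def h(2)[OF i(2)] using Q(1) by (intro image_eqI[of _ _ "(pathstart (g e), k)"]) auto
      moreover have "h e 1 + lattice_point k = l (pathfinish (g e)) + lattice_point (k + z e)"
        using z[OF i(2)] by (simp add: lattice_point_add algebra_simps)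
      then have "h e 1 + lattice_point k \<in> Q'"
        unfolding Q'_def using Q(2) by (intro image_eqI[of _ _ "(pathfinish (g e), k + z e)"]) auto
      ultimately show ?thesis using i by (simp add: pathstart_def pathfinish_def)
    qed
  qed (use h(3) \<open>finite A'\<close> in \<open>auto simp: A'_def\<close>)
  also have "card Q' \<le> p * (N * N)"
  proof -
    have "card Q' \<le> card (Q \<times> J)" unfolding Q'_def
      using fin \<open>finite J\<close> by (intro card_image_le) (auto simp: Q_def)
    also have "\<dots> \<le> card (P \<times> J)" using fin \<open>finite J\<close> by (intro card_mono) (auto simp: Q_def)
    finally show ?thesis by (simp add: card_cartesian_product p_def \<open>card J = N * N\<close>)
  qed
  finally have up: "card A' \<le> 2 * (p * (N * N))" by simp
  let ?I = "{int M..<int (N - M)}"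
  have "A \<times> (?I \<times> ?I) \<subseteq> A'"
  proof
    fix x assume "x \<in> A \<times> (?I \<times> ?I)"
    then obtain e a b where x: "x = (e, a, b)" "e \<in> A" "a \<in> ?I" "b \<in> ?I" by auto
    then show "x \<in> A'"
      using M[OF x(2)] by (cases "z e") (auto simp: A'_def J_def abs_le_iff)
  qed
  then have "card (A \<times> (?I \<times> ?I)) \<le> card A'" using card_mono[OF \<open>finite A'\<close>] by blast
  moreover have "card ?I = K" by (simp add: N_def)
  ultimately have "card A * (K * K) \<le> card A'" by (simp add: card_cartesian_product)
  with up have "card A * (K * K) \<le> 2 * (p * (N * N))" by simp
  moreover have "(2 * p + 1) * (K * K) \<le> card A * (K * K)" using less by (intro mult_right_mono) (auto simp: p_def)
  ultimately have "(2 * p + 1) * (K * K) \<le> 2 * (p * (N * N))" by simp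
  then have "K * K \<le> 8 * p * M * K + 8 * p * M * M"
    unfolding N_def by (simp add: algebra_simps)
  moreover have "8 * p * M * M \<le> 8 * p * M * M * K" by (simp add: K_def)
  ultimately have "K * K \<le> (8 * p * M + 8 * p * M * M) * K" unfolding distrib_right by linarith
  then have "K \<le> 8 * p * M + 8 * p * M * M" by (simp add: K_def)
  then show False by (simp add: K_def)
qed

section \<open>Bipartite graphs on the projective plane\<close>

text \<open>The projective plane is realised in Euclidean space by the rank one projections.\<close>

definition outer_square :: "real ^ 3 \<Rightarrow> real ^ 3 ^ 3" where
  "outer_square x = (\<chi> i. x $ i *\<^sub>R x)"

lemma outer_square_mult: "outer_square x *v y = (x \<bullet> y) *\<^sub>R x"
  by (simp add: vec_eq_iff outer_square_def matrix_vector_mult_def inner_vec_def sum_distrib_left sum_distrib_right mult_ac)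

lemma outer_square_uminus [simp]: "outer_square (- x) = outer_square x"
  by (simp add: outer_square_def)

text \<open>A unit vector is fixed by its own projection. If the projections agree, \<open>x\<close>
  is a multiple of \<open>y\<close>, and the lengths leave only the factors 1 and -1.\<close>

lemma outer_square_eq_iff:
  assumes "x \<in> sphere 0 1" "y \<in> sphere 0 1"
  shows "outer_square x = outer_square y \<longleftrightarrow> y = x \<or> y = - x"
proof
  assume eq: "outer_square x = outer_square y"
  have "x = (x \<bullet> x) *\<^sub>R x" using assms(1) by (simp add: norm_eq_1)
  also have "\<dots> = (y \<bullet> x) *\<^sub>R y" using eq outer_square_mult by metis
  finally have x: "x = (y \<bullet> x) *\<^sub>R y" .
  then have "norm x = \<bar>y \<bullet> x\<bar> * norm y" by (metis norm_scaleR)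
  then have "y \<bullet> x = 1 \<or> y \<bullet> x = -1" using assms by auto
  then show "y = x \<or> y = - x" using x by (metis minus_minus scaleR_minus1_left scaleR_one)
qed auto

lemma continuous_on_outer_square: "continuous_on S outer_square"
  unfolding outer_square_def[abs_def] by (intro continuous_on_vec_lambda continuous_intros)

lemma continuous_on_matrix_vector_mult: "continuous_on S (\<lambda>M :: real ^ 3 ^ 3. M *v y)"
  unfolding matrix_vector_mult_def by (intro continuous_on_vec_lambda continuous_intros)

text \<open>The lines not orthogonal to \<open>y\<close> form a neighbourhood of the line of
  \<open>y\<close> that is evenly covered by two open hemispheres, given by
  \<open>0 < c * (z \<bullet> y)\<close> for \<open>c = 1\<close> and \<open>c = -1\<close>. In
  terms of the projection \<open>M\<close> of \<open>z\<close> the condition is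
  \<open>0 < y \<bullet> (M *v y)\<close>, as this number is the square of
  \<open>z \<bullet> y\<close>. The inverse on a sheet normalises \<open>M *v y\<close> and
  multiplies by the sign \<open>c\<close>.\<close>

lemma covering_space_outer_square:
  "covering_space (sphere 0 1) outer_square (outer_square ` sphere 0 1)"
  unfolding covering_space_def
proof (intro conjI ballI continuous_on_outer_square refl)
  let ?S = "outer_square ` sphere 0 1"
  fix M0 assume "M0 \<in> ?S"
  then obtain y where y: "norm y = 1" "M0 = outer_square y" by auto
  define T where "T = ?S \<inter> {M. 0 < y \<bullet> (M *v y)}"
  define u where "u c = {z \<in> sphere 0 1. 0 < c * (z \<bullet> y)}" for c :: real
  define q where "q c M = (c / norm (M *v y)) *\<^sub>R (M *v y)" for c :: real and M :: "real ^ 3 ^ 3"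
  have in_T: "outer_square z \<in> T \<longleftrightarrow> z \<bullet> y \<noteq> 0" if "z \<in> sphere 0 1" for z
  proof -
    have "y \<bullet> (outer_square z *v y) = (z \<bullet> y) * (z \<bullet> y)"
      by (simp add: outer_square_mult inner_commute)
    then show ?thesis using that by (auto simp: T_def zero_less_mult_iff)
  qed
  have "M0 \<in> T" using in_T[of y] y by (auto simp: norm_eq_1)
  moreover have "openin (top_of_set ?S) T"
    unfolding T_def by (intro openin_open_Int open_Collect_less continuous_intros continuous_on_matrix_vector_mult)
  moreover have "\<Union>(u ` {1, -1}) = sphere 0 1 \<inter> outer_square -` T"
    using in_T by (auto simp: u_def)
  moreover have "openin (top_of_set (sphere 0 1)) U" if "U \<in> u ` {1, -1}" for U
  proof -
    have "openin (top_of_set (sphere 0 1)) (u c)" for c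
    proof -
      have "open {z. 0 < c * (z \<bullet> y)}" by (intro open_Collect_less continuous_intros)
      moreover have "u c = sphere 0 1 \<inter> {z. 0 < c * (z \<bullet> y)}" by (auto simp: u_def)
      ultimately show ?thesis by (simp add: openin_open_Int)
    qed
    then show ?thesis using that by blast
  qed
  moreover have "pairwise disjnt (u ` {1, -1})"
    by (auto simp: pairwise_def disjnt_def u_def)
  moreover have "\<exists>q. homeomorphism U T outer_square q" if "U \<in> u ` {1, -1}" for U
  proof -
    from that obtain c where "U = u c" "c \<in> {1, -1}" by (rule imageE)
    then have c: "U = u c" "c = 1 \<or> c = -1" by auto
    have qz: "q c (outer_square z) = z" if "z \<in> u c" for z
    proof -
      have z: "0 < c * (z \<bullet> y)" "norm z = 1" using that by (auto simp: u_def)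
      have "q c (outer_square z) = (c / \<bar>z \<bullet> y\<bar> * (z \<bullet> y)) *\<^sub>R z"
        by (simp add: q_def outer_square_mult z(2))
      also have "c / \<bar>z \<bullet> y\<bar> * (z \<bullet> y) = 1" using c(2) z(1) by (elim disjE) simp_all
      finally show ?thesis by simp
    qed
    have lift: "\<exists>z\<in>u c. M = outer_square z" if "M \<in> T" for M
    proof -
      from that obtain z where z: "z \<in> sphere 0 1" "M = outer_square z" unfolding T_def by blast
      then have "z \<bullet> y \<noteq> 0" using in_T that by blast
      then have "z \<in> u c \<or> - z \<in> u c" using z c(2) by (auto simp: u_def)
      then show ?thesis using z(2) by (metis outer_square_uminus)
    qed
    have "homeomorphism (u c) T outer_square (q c)"
      unfolding homeomorphism_def
    proof (intro conjI ballI continuous_on_outer_square)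
      show "outer_square ` u c = T" using lift in_T by (force simp: u_def)
      show "q c ` T = u c" using lift qz \<open>outer_square ` u c = T\<close> by (force simp: image_iff)
      show "continuous_on T (q c)"
      proof -
        have "M *v y \<noteq> 0" if "M \<in> T" for M using that by (auto simp: T_def)
        then show ?thesis
          unfolding q_def[abs_def] by (intro continuous_intros continuous_on_matrix_vector_mult) auto
      qed
      show "outer_square (q c M) = M" if "M \<in> T" for M using lift[OF that] qz by auto
    qed (use qz in blast)
    then show ?thesis using c(1) by blast
  qed
  ultimately show "\<exists>T. M0 \<in> T \<and> openin (top_of_set ?S) T \<and>
      (\<exists>v. \<Union>v = sphere 0 1 \<inter> outer_square -` T \<and> (\<forall>u\<in>v. openin (top_of_set (sphere 0 1)) u) \<and>
        pairwise disjnt v \<and> (\<forall>u\<in>v. \<exists>q. homeomorphism u T outer_square q))"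
    by (intro exI[of _ T] exI[of _ "u ` {1, -1}"] conjI ballI) assumption+
qed

lemma outer_square_path_lift:
  assumes "path g" "path_image g \<subseteq> outer_square ` sphere 0 1"
  obtains h where "path h" "\<And>t. t \<in> {0..1} \<Longrightarrow> h t \<in> sphere 0 1" "\<And>t. t \<in> {0..1} \<Longrightarrow> outer_square (h t) = g t"
proof -
  obtain h where h: "path h" "path_image h \<subseteq> sphere 0 1" "\<And>t. t \<in> {0..1} \<Longrightarrow> outer_square (h t) = g t"
    using covering_space_lift_path[OF covering_space_outer_square assms] by metis
  show thesis
  proof (rule that[OF h(1) _ h(3)])
    show "h t \<in> sphere 0 1" if "t \<in> {0..1}" for t using h(2) that unfolding path_image_def by blast
  qed
qed

lemma finite_outer_square_preimage:
  assumes "finite P"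
  shows "finite {x \<in> sphere 0 1. outer_square x \<in> P}" "card {x \<in> sphere 0 1. outer_square x \<in> P} \<le> 2 * card P"
proof -
  let ?Q = "{x \<in> sphere 0 1. outer_square x \<in> P}"
  define s where "s v = (SOME x. x \<in> sphere 0 1 \<and> outer_square x = v)" for v
  have s: "s v \<in> sphere 0 1 \<and> outer_square (s v) = v" if "x \<in> sphere 0 1" "outer_square x = v" for x v
    unfolding s_def by (rule someI[of _ x]) (use that in auto)
  have sub: "?Q \<subseteq> s ` P \<union> (\<lambda>v. - s v) ` P"
  proof
    fix x assume x: "x \<in> ?Q"
    then have "x = s (outer_square x) \<or> x = - s (outer_square x)"
      using outer_square_eq_iff[of "s (outer_square x)" x] s[of x "outer_square x"] by auto
    then show "x \<in> s ` P \<union> (\<lambda>v. - s v) ` P" using x by blast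
  qed
  show "finite ?Q" by (rule finite_subset[OF sub]) (use assms in auto)
  have "card ?Q \<le> card (s ` P \<union> (\<lambda>v. - s v) ` P)" using assms by (intro card_mono sub) auto
  also have "\<dots> \<le> card (s ` P) + card ((\<lambda>v. - s v) ` P)" by (rule card_Un_le)
  also have "\<dots> \<le> card P + card P" using assms by (intro add_mono card_image_le)
  finally show "card ?Q \<le> 2 * card P" by simp
qed

text \<open>The lifted drawing on the sphere is moved to the plane by stereographic projection from an
  interior point of one of the lifted edges, which has to be given up.\<close>

lemma projective_bipartite_bound:
  fixes g :: "'e \<Rightarrow> real \<Rightarrow> real ^ 3 ^ 3"
  assumes d: "arc_drawing P A g" and PLR: "L \<inter> R = {}"
    and LR: "\<And>e. e \<in> A \<Longrightarrow> pathstart (g e) \<in> L \<and> pathfinish (g e) \<in> R"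
    and simple: "\<And>e f. e \<in> A \<Longrightarrow> f \<in> A \<Longrightarrow> pathstart (g e) = pathstart (g f) \<Longrightarrow> pathfinish (g e) = pathfinish (g f) \<Longrightarrow> e = f"
    and T: "\<And>e. e \<in> A \<Longrightarrow> path_image (g e) \<subseteq> outer_square ` sphere 0 1"
  shows "card A \<le> 2 * card P"
proof (cases "A = {}")
  case False
  then obtain e0 where e0: "e0 \<in> A" by blast
  have fin: "finite P" "finite A" using d by (auto simp: arc_drawing_def)
  have "\<exists>h. path h \<and> (\<forall>t\<in>{0..1}. h t \<in> sphere 0 1 \<and> outer_square (h t) = g e t)" if "e \<in> A" for e
    using outer_square_path_lift[OF arc_imp_path[OF arc_drawing_ends(4)[OF d that]] T[OF that]] by metis
  then obtain h where h: "\<And>e. e \<in> A \<Longrightarrow> path (h e)" "\<And>e t. e \<in> A \<Longrightarrow> t \<in> {0..1} \<Longrightarrow> h e t \<in> sphere 0 1"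
    "\<And>e t. e \<in> A \<Longrightarrow> t \<in> {0..1} \<Longrightarrow> outer_square (h e t) = g e t"
    by metis
  define b where "b = h e0 (1/2)"
  have b: "b \<in> sphere 0 1" "outer_square b = g e0 (1/2)" using h(2,3)[OF e0] by (auto simp: b_def)
  have inj: "inj_on (g e) {0..1}" if "e \<in> A" for e
    using arc_drawing_ends(4)[OF d that] by (simp add: arc_def)
  have bP: "g e0 (1/2) \<notin> P"
  proof
    assume "g e0 (1/2) \<in> P"
    then have "g e0 (1/2) \<in> path_image (g e0) \<inter> P" by (auto simp: path_image_def)
    also have "\<dots> = {g e0 0, g e0 1}"
      using d e0 by (simp add: arc_drawing_def pathstart_def pathfinish_def)
    finally show False
      using inj_onD[OF inj[OF e0], of "1/2" 0] inj_onD[OF inj[OF e0], of "1/2" 1] by auto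
  qed
  have "sphere 0 1 - {b} homeomorphic (UNIV :: complex set)"
    using b(1) by (intro homeomorphic_punctured_sphere_affine) auto
  then obtain F G where FG: "homeomorphism (sphere 0 1 - {b}) (UNIV :: complex set) F G"
    unfolding homeomorphic_def by blast
  have GF: "G (F x) = x" if "x \<in> sphere 0 1" "x \<noteq> b" for x using FG that by (auto simp: homeomorphism_def)
  define k where "k i t = (if snd i then h (fst i) t else - h (fst i) t)" for i t
  define A' where "A' = A \<times> UNIV - {(e0, True)}"
  define Q where "Q = {x \<in> sphere 0 1. outer_square x \<in> P}"
  have kS: "k i t \<in> sphere 0 1" "outer_square (k i t) = g (fst i) t" if "fst i \<in> A" "t \<in> {0..1}" for i t
    using h(2,3)[OF that] by (auto simp: k_def)
  have kb: "k i t \<noteq> b" if i: "i \<in> A'" and t: "t \<in> {0..1}" for i t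
  proof
    assume kb: "k i t = b"
    have iA: "fst i \<in> A" using i by (auto simp: A'_def)
    have eq: "g (fst i) t = g e0 (1/2)" using kS(2)[OF iA t] b(2) kb by simp
    have "g (fst i) t \<in> path_image (g (fst i)) \<inter> path_image (g e0)"
      using t by (auto simp: path_image_def eq) (metis atLeastAtMost_iff eq image_eqI)
    then have "fst i = e0" using d iA e0 bP eq unfolding arc_drawing_def by (metis subsetD)
    moreover from this have "t = 1/2" using inj_onD[OF inj[OF e0], of t "1/2"] eq t by auto
    \<comment> \<open>Only the parameter 1/2 of \<open>e0\<close> lies over the line of
      \<open>b\<close>, and of the two lifts of \<open>e0\<close> the one kept in \<open>A'\<close>
      passes through the antipode of \<open>b\<close> there.\<close>
    moreover have "\<not> snd i" using \<open>fst i = e0\<close> i by (cases i) (auto simp: A'_def)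
    ultimately have "k i t = - b" by (simp only: k_def b_def if_False)
    then have "2 *\<^sub>R b = 0" using kb by (metis add.right_inverse scaleR_2)
    then show False using b(1) by simp
  qed
  have fQ: "finite Q" "card Q \<le> 2 * card P"
    unfolding Q_def by (rule finite_outer_square_preimage[OF fin(1)])+
  have bQ: "b \<notin> Q" using bP b by (simp add: Q_def)
  have "card A' \<le> 2 * card (F ` Q)"
  proof (rule lifted_bipartite_bound[where q = fst and p = "outer_square \<circ> G" and h = "\<lambda>i. F \<circ> k i", OF d PLR LR simple])
    show "finite (F ` Q)" using fQ by simp
    show "finite A'" using fin by (simp add: A'_def)
    show "(outer_square \<circ> G) x \<in> P" if "x \<in> F ` Q" for x
    proof -
      from that obtain y where "y \<in> Q" "x = F y" by blast
      moreover from this have "y \<noteq> b" using bQ by blast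
      ultimately show ?thesis using GF[of y] by (simp add: Q_def)
    qed
    fix i assume i: "i \<in> A'"
    show iA: "fst i \<in> A" using i by (auto simp: A'_def)
    have "path (k i)"
      using h(1)[OF iA] unfolding path_def k_def by (cases "snd i") (auto intro!: continuous_intros)
    then show "path (F \<circ> k i)"
    proof (rule path_continuous_image)
      have "path_image (k i) \<subseteq> sphere 0 1 - {b}" using kS(1)[OF iA] kb[OF i] unfolding path_image_def by blast
      then show "continuous_on (path_image (k i)) F" using FG by (meson continuous_on_subset homeomorphism_def)
    qed
    show "(outer_square \<circ> G) ((F \<circ> k i) t) = g (fst i) t" if "t \<in> {0..1}" for t
      using GF[OF kS(1)[OF iA that] kb[OF i that]] kS(2)[OF iA that] by simp
    have "k i 0 \<in> Q" "k i 1 \<in> Q"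
      using kS[OF iA, of 0] kS[OF iA, of 1] arc_drawing_ends(1,2)[OF d iA]
      by (auto simp: Q_def pathstart_def pathfinish_def)
    then show "pathstart (F \<circ> k i) \<in> F ` Q \<and> pathfinish (F \<circ> k i) \<in> F ` Q"
      by (auto simp: pathstart_def pathfinish_def)
    fix j t assume j: "j \<in> A'" and ij: "fst i = fst j" and t: "t \<in> {0..1}" and eq: "(F \<circ> k i) t = (F \<circ> k j) t"
    have jA: "fst j \<in> A" using j by (auto simp: A'_def)
    have "k i t = G (F (k i t))" using GF[OF kS(1)[OF iA t] kb[OF i t]] by (rule sym)
    also have "\<dots> = G (F (k j t))" using eq by (simp only: o_apply)
    also have "\<dots> = k j t" by (rule GF[OF kS(1)[OF jA t] kb[OF j t]])
    finally have keq: "k i t = k j t" .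
    have "h (fst j) t \<noteq> - h (fst j) t"
    proof
      assume "h (fst j) t = - h (fst j) t"
      then have "2 *\<^sub>R h (fst j) t = 0" by (metis add.right_inverse scaleR_2)
      then show False using h(2)[OF jA t] by simp
    qed
    then have "snd i = snd j" using keq unfolding k_def ij by (metis minus_minus)
    then show "i = j" using ij by (simp add: prod_eq_iff)
  qed
  also have "card (F ` Q) \<le> 2 * card P" using fQ card_image_le by (meson le_trans)
  finally have "card A' \<le> 2 * (2 * card P)" by simp
  moreover have "card A' = 2 * card A - 1"
    unfolding A'_def using fin e0 by (simp add: card_Diff_singleton card_cartesian_product)
  \<comment> \<open>The lost edge does no harm: \<open>2 |A| - 1 \<le> 4 |P|\<close> still gives
    \<open>|A| \<le> 2 |P|\<close> for integers.\<close>
  ultimately show ?thesis by simp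
qed simp

section \<open>Embeddings of graphs and subdivided complete bipartite graphs\<close>

text \<open>The type that indexes the edges has to be fixed inside a definition; pairs of natural
  numbers are what complete bipartite graphs call for.\<close>

definition bipartite_bounded :: "'b::topological_space set \<Rightarrow> bool" where
  "bipartite_bounded S \<longleftrightarrow> (\<forall>P A (g :: nat \<times> nat \<Rightarrow> real \<Rightarrow> 'b) L R.
     arc_drawing P A g \<and> L \<inter> R = {} \<and>
     (\<forall>e\<in>A. path_image (g e) \<subseteq> S \<and> pathstart (g e) \<in> L \<and> pathfinish (g e) \<in> R) \<and>
     (\<forall>e\<in>A. \<forall>f\<in>A. pathstart (g e) = pathstart (g f) \<and> pathfinish (g e) = pathfinish (g f) \<longrightarrow> e = f) \<longrightarrow>
     card A \<le> 2 * card P)"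

text \<open>Paths and arcs are functions into a type with a topology, whereas a surface is an
  abstract topology. The injective continuous \<open>f\<close> links the two: the torus already lies
  in \<open>complex \<times> complex\<close>, and the projective plane is mapped to the rank one
  projections.\<close>

definition bipartite_bounded_surface :: "'p topology \<Rightarrow> ('p \<Rightarrow> 'b::topological_space) \<Rightarrow> bool" where
  "bipartite_bounded_surface X f \<longleftrightarrow>
     continuous_map X euclidean f \<and> inj_on f (topspace X) \<and> bipartite_bounded (f ` topspace X)"

lemma bipartite_bounded_torus: "bipartite_bounded_surface torus (\<lambda>x. x)"
proof -
  have eq: "torus = top_of_set (sphere 0 1 \<times> sphere 0 1)"
    by (simp add: torus_def prod_topology_subtopology_eu)
  have "bipartite_bounded (sphere 0 1 \<times> sphere 0 1 :: (complex \<times> complex) set)"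
    unfolding bipartite_bounded_def
    by (intro allI impI; elim conjE; rule torus_bipartite_bound) auto
  then show ?thesis
    unfolding bipartite_bounded_surface_def eq by simp
qed

lemma topspace_projective_plane: "topspace projective_plane = (\<lambda>x. {x, - x}) ` sphere 0 1"
  using quotient_imp_surjective_map[OF quotient_map_projective_plane] by simp

text \<open>On an antipodal pair, the value does not depend on the chosen representative.\<close>

definition projective_coordinates :: "(real ^ 3) set \<Rightarrow> real ^ 3 ^ 3" where
  "projective_coordinates U = outer_square (SOME x. x \<in> U)"

lemma projective_coordinates_pair [simp]: "projective_coordinates {x, - x} = outer_square x"
proof -
  have "(SOME y. y \<in> {x, - x}) \<in> {x, - x}" by (rule someI[of _ x]) simp
  then show ?thesis unfolding projective_coordinates_def by (metis insertE outer_square_uminus singletonD)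
qed

lemma bipartite_bounded_projective_plane:
  "bipartite_bounded_surface projective_plane projective_coordinates"
proof -
  have img: "projective_coordinates ` topspace projective_plane = outer_square ` sphere 0 1"
    unfolding topspace_projective_plane image_image by simp
  have "continuous_map (top_of_set (sphere 0 1)) euclidean (projective_coordinates \<circ> (\<lambda>x. {x, - x}))"
    by (simp add: o_def continuous_on_outer_square)
  then have "continuous_map projective_plane euclidean projective_coordinates"
    using continuous_compose_quotient_map_eq[OF quotient_map_projective_plane] by blast
  moreover have "inj_on projective_coordinates (topspace projective_plane)"
    unfolding topspace_projective_plane inj_on_def
    by (auto simp: outer_square_eq_iff)
  moreover have "bipartite_bounded (outer_square ` sphere 0 1)"
    unfolding bipartite_bounded_def
    by (intro allI impI; elim conjE; rule projective_bipartite_bound) auto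
  ultimately show ?thesis unfolding bipartite_bounded_surface_def img by blast
qed

text \<open>A closed arc consists of its open part and the images of its two ends, so the conditions
  on open parts become conditions on closed arcs: they meet only in the images of common
  vertices.\<close>

lemma embeddable_in_imp_arcs:
  fixes f :: "'p \<Rightarrow> 'b::t2_space"
  assumes emb: "embeddable_in X (V, E)" and f: "continuous_map X euclidean f" "inj_on f (topspace X)"
    and EV: "\<And>e. e \<in> E \<Longrightarrow> e \<subseteq> V"
  obtains \<phi> :: "'v \<Rightarrow> 'b" and \<gamma> :: "'v set \<Rightarrow> real \<Rightarrow> 'b" where
    "inj_on \<phi> V" "\<And>v. v \<in> V \<Longrightarrow> \<phi> v \<in> f ` topspace X"
    "\<And>e. e \<in> E \<Longrightarrow> arc (\<gamma> e) \<and> path_image (\<gamma> e) \<subseteq> f ` topspace X \<and> {pathstart (\<gamma> e), pathfinish (\<gamma> e)} = \<phi> ` e"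
    "\<And>e. e \<in> E \<Longrightarrow> path_image (\<gamma> e) \<inter> \<phi> ` V \<subseteq> \<phi> ` e"
    "\<And>e e'. e \<in> E \<Longrightarrow> e' \<in> E \<Longrightarrow> e \<noteq> e' \<Longrightarrow> path_image (\<gamma> e) \<inter> path_image (\<gamma> e') \<subseteq> \<phi> ` (e \<inter> e')"
proof -
  obtain \<psi> and \<delta> :: "'v set \<Rightarrow> real \<Rightarrow> 'p" where \<psi>: "inj_on \<psi> V" "\<psi> ` V \<subseteq> topspace X"
    and \<delta>: "\<And>e. e \<in> E \<Longrightarrow> embedding_map (top_of_set {0..1}) X (\<delta> e)"
      "\<And>e. e \<in> E \<Longrightarrow> {\<delta> e 0, \<delta> e 1} = \<psi> ` e" "\<And>e. e \<in> E \<Longrightarrow> \<delta> e ` {0<..<1} \<inter> \<psi> ` V = {}"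
      "\<And>e e'. e \<in> E \<Longrightarrow> e' \<in> E \<Longrightarrow> e \<noteq> e' \<Longrightarrow> \<delta> e ` {0<..<1} \<inter> \<delta> e' ` {0<..<1} = {}"
  proof -
    from emb obtain \<psi> and \<delta> :: "'v set \<Rightarrow> real \<Rightarrow> 'p" where "inj_on \<psi> V \<and> \<psi> ` V \<subseteq> topspace X \<and>
       (\<forall>e \<in> E. embedding_map (top_of_set {0..1}) X (\<delta> e) \<and> {\<delta> e 0, \<delta> e 1} = \<psi> ` e \<and>
                \<delta> e ` {0<..<1} \<inter> \<psi> ` V = {}) \<and>
       (\<forall>e \<in> E. \<forall>f \<in> E. e \<noteq> f \<longrightarrow> \<delta> e ` {0<..<1} \<inter> \<delta> f ` {0<..<1} = {})"
      unfolding embeddable_in_def by (auto simp del: ball_simps)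
    then show thesis using that[of \<psi> \<delta>] by metis
  qed
  have cont: "continuous_map (top_of_set {0..1}) X (\<delta> e)" and inj: "inj_on (\<delta> e) {0..1}" if "e \<in> E" for e
    using \<delta>(1)[OF that] by (auto simp: embedding_map_def homeomorphic_eq_everything_map continuous_map_in_subtopology)
  have im: "\<delta> e ` {0..1} \<subseteq> topspace X" if "e \<in> E" for e
    using continuous_map_image_subset_topspace[OF cont[OF that]] by simp
  have cl: "\<delta> e ` {0..1} = \<psi> ` e \<union> \<delta> e ` {0<..<1}" if "e \<in> E" for e
  proof -
    have "{0..1::real} = {0, 1} \<union> {0<..<1}" by auto
    then have "\<delta> e ` {0..1} = {\<delta> e 0, \<delta> e 1} \<union> \<delta> e ` {0<..<1}" by (metis image_Un image_empty image_insert)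
    then show ?thesis using \<delta>(2)[OF that] by simp
  qed
  define \<phi> where "\<phi> = f \<circ> \<psi>"
  define \<gamma> where "\<gamma> e = f \<circ> \<delta> e" for e
  have pi: "path_image (\<gamma> e) = f ` \<delta> e ` {0..1}" for e by (auto simp: \<gamma>_def path_image_def)
  have fI: "f ` S \<inter> f ` T = f ` (S \<inter> T)" if "S \<subseteq> topspace X" "T \<subseteq> topspace X" for S T
    using inj_on_image_Int[OF f(2) that] by simp
  show thesis
  proof
    show "inj_on \<phi> V" unfolding \<phi>_def using \<psi> f(2) by (meson comp_inj_on inj_on_subset)
    show "\<phi> v \<in> f ` topspace X" if "v \<in> V" for v using that \<psi>(2) by (auto simp: \<phi>_def)
    fix e assume e: "e \<in> E"
    have "continuous_map (top_of_set {0..1}) euclidean (f \<circ> \<delta> e)"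
      using cont[OF e] f(1) by (rule continuous_map_compose)
    moreover have "inj_on (f \<circ> \<delta> e) {0..1}" using inj[OF e] im[OF e] f(2) by (meson comp_inj_on inj_on_subset)
    ultimately have "arc (\<gamma> e)" by (simp add: arc_def path_def \<gamma>_def)
    moreover have "{pathstart (\<gamma> e), pathfinish (\<gamma> e)} = \<phi> ` e"
      using arg_cong[OF \<delta>(2)[OF e], of "image f"] by (simp add: \<gamma>_def \<phi>_def pathstart_def pathfinish_def image_comp)
    ultimately show "arc (\<gamma> e) \<and> path_image (\<gamma> e) \<subseteq> f ` topspace X \<and> {pathstart (\<gamma> e), pathfinish (\<gamma> e)} = \<phi> ` e"
      using im[OF e] by (auto simp: pi)
    have "path_image (\<gamma> e) \<inter> \<phi> ` V = f ` (\<delta> e ` {0..1} \<inter> \<psi> ` V)"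
      unfolding pi \<phi>_def image_comp[symmetric] using im[OF e] \<psi>(2) by (rule fI)
    also have "\<delta> e ` {0..1} \<inter> \<psi> ` V \<subseteq> \<psi> ` e" unfolding cl[OF e] using \<delta>(3)[OF e] by blast
    finally show "path_image (\<gamma> e) \<inter> \<phi> ` V \<subseteq> \<phi> ` e" by (auto simp: \<phi>_def)
    fix e' assume e': "e' \<in> E" "e \<noteq> e'"
    have "path_image (\<gamma> e) \<inter> path_image (\<gamma> e') = f ` (\<delta> e ` {0..1} \<inter> \<delta> e' ` {0..1})"
      unfolding pi using im[OF e] im[OF e'(1)] by (rule fI)
    also have "\<delta> e ` {0..1} \<inter> \<delta> e' ` {0..1} \<subseteq> \<psi> ` e \<inter> \<psi> ` e'"
      unfolding cl[OF e] cl[OF e'(1)]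
      using \<delta>(3)[OF e] \<delta>(3)[OF e'(1)] \<delta>(4)[OF e e'] EV[OF e] EV[OF e'(1)] by blast
    also have "\<psi> ` e \<inter> \<psi> ` e' = \<psi> ` (e \<inter> e')"
      using inj_on_image_Int[OF \<psi>(1) EV[OF e] EV[OF e'(1)]] by simp
    finally show "path_image (\<gamma> e) \<inter> path_image (\<gamma> e') \<subseteq> \<phi> ` (e \<inter> e')" by (auto simp: \<phi>_def)
  qed
qed

section \<open>From subdivisions to drawings of complete bipartite graphs\<close>

fun walk_trace :: "('v \<Rightarrow> 'b) \<Rightarrow> ('v set \<Rightarrow> real \<Rightarrow> 'b::topological_space) \<Rightarrow> 'v list \<Rightarrow> 'b set" where
  "walk_trace \<phi> \<gamma> [] = {}"
| "walk_trace \<phi> \<gamma> [x] = {\<phi> x}"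
| "walk_trace \<phi> \<gamma> (x # y # ws) = path_image (\<gamma> {x, y}) \<union> walk_trace \<phi> \<gamma> (y # ws)"

lemma walk_trace_connected:
  assumes "successively (\<lambda>x y. {x, y} \<in> E) ws" "ws \<noteq> []"
    and E: "\<And>e. e \<in> E \<Longrightarrow> path (\<gamma> e) \<and> {pathstart (\<gamma> e), pathfinish (\<gamma> e)} = \<phi> ` e"
  shows "path_connected (walk_trace \<phi> \<gamma> ws) \<and> \<phi> (hd ws) \<in> walk_trace \<phi> \<gamma> ws \<and> \<phi> (last ws) \<in> walk_trace \<phi> \<gamma> ws"
  using assms(1,2)
proof (induction ws rule: induct_list012)
  case (3 x y ws)
  let ?T = "walk_trace \<phi> \<gamma> (y # ws)"
  have xy: "{x, y} \<in> E" "successively (\<lambda>x y. {x, y} \<in> E) (y # ws)" using "3.prems" by auto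
  have IH: "path_connected ?T \<and> \<phi> y \<in> ?T \<and> \<phi> (last (y # ws)) \<in> ?T" using "3.IH"(2)[OF xy(2)] by simp
  have "\<phi> ` {x, y} \<subseteq> path_image (\<gamma> {x, y})"
    using E[OF xy(1)] by (metis insert_subset pathfinish_in_path_image pathstart_in_path_image empty_subsetI)
  moreover have "path_connected (path_image (\<gamma> {x, y}))" using E[OF xy(1)] path_connected_path_image by blast
  ultimately show ?case using IH by (auto intro!: path_connected_Un)
qed auto

lemma walk_trace_cases:
  assumes "z \<in> walk_trace \<phi> \<gamma> ws" "successively (\<lambda>x y. {x, y} \<in> E) ws"
  obtains x where "x \<in> set ws" "z = \<phi> x" | e where "e \<in> E" "e \<subseteq> set ws" "z \<in> path_image (\<gamma> e)"
proof -
  have "(\<exists>x\<in>set ws. z = \<phi> x) \<or> (\<exists>e\<in>E. e \<subseteq> set ws \<and> z \<in> path_image (\<gamma> e))"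
    using assms
  proof (induction ws rule: induct_list012)
    case (3 x y ws)
    show ?case
    proof (cases "z \<in> path_image (\<gamma> {x, y})")
      case True
      then show ?thesis using "3.prems"(2) by (intro disjI2 bexI[of _ "{x, y}"]) auto
    next
      case False
      then have "z \<in> walk_trace \<phi> \<gamma> (y # ws)" "successively (\<lambda>x y. {x, y} \<in> E) (y # ws)" using "3.prems" by auto
      from "3.IH"(2)[OF this] show ?thesis by (auto 0 3)
    qed
  qed auto
  then show thesis using that by blast
qed

text \<open>The trace of a walk is path connected and so contains an arc between the images of its
  two branch vertices. Traces of different walks meet in branch vertices only, so these arcs draw
  the complete bipartite graph itself, with \<open>a * b\<close> edges and \<open>a + b\<close>
  vertices.\<close>

lemma subdivided_complete_bipartite_bound:
  fixes f :: "'p \<Rightarrow> 'b::{complete_space,real_normed_vector}" and a b :: nat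
  assumes X: "bipartite_bounded_surface X f" and emb: "embeddable_in X (V, E)"
    and EV: "\<And>e. e \<in> E \<Longrightarrow> e \<subseteq> V"
    and inj: "inj_on l {..<a}" "inj_on r {..<b}" and disj: "l ` {..<a} \<inter> r ` {..<b} = {}"
    and walk: "\<And>i j. i < a \<Longrightarrow> j < b \<Longrightarrow> w i j \<noteq> [] \<and> hd (w i j) = l i \<and> last (w i j) = r j \<and>
        set (w i j) \<subseteq> V \<and> successively (\<lambda>x y. {x, y} \<in> E) (w i j)"
    and ends: "\<And>i j. i < a \<Longrightarrow> j < b \<Longrightarrow> set (w i j) \<inter> (l ` {..<a} \<union> r ` {..<b}) \<subseteq> {l i, r j}"
    and disjoint: "\<And>i j i' j'. i < a \<Longrightarrow> j < b \<Longrightarrow> i' < a \<Longrightarrow> j' < b \<Longrightarrow> (i, j) \<noteq> (i', j') \<Longrightarrow>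
        set (w i j) \<inter> set (w i' j') \<subseteq> l ` {..<a} \<union> r ` {..<b}"
  shows "a * b \<le> 2 * (a + b)"
proof -
  have f: "continuous_map X euclidean f" "inj_on f (topspace X)" and bd: "bipartite_bounded (f ` topspace X)"
    using X by (auto simp: bipartite_bounded_surface_def)
  obtain \<phi> \<gamma> where \<phi>: "inj_on \<phi> V" "\<And>v. v \<in> V \<Longrightarrow> \<phi> v \<in> f ` topspace X"
    and \<gamma>: "\<And>e. e \<in> E \<Longrightarrow> arc (\<gamma> e) \<and> path_image (\<gamma> e) \<subseteq> f ` topspace X \<and> {pathstart (\<gamma> e), pathfinish (\<gamma> e)} = \<phi> ` e"
      "\<And>e. e \<in> E \<Longrightarrow> path_image (\<gamma> e) \<inter> \<phi> ` V \<subseteq> \<phi> ` e"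
      "\<And>e e'. e \<in> E \<Longrightarrow> e' \<in> E \<Longrightarrow> e \<noteq> e' \<Longrightarrow> path_image (\<gamma> e) \<inter> path_image (\<gamma> e') \<subseteq> \<phi> ` (e \<inter> e')"
    using embeddable_in_imp_arcs[OF emb f EV] by metis
  let ?N = "l ` {..<a} \<union> r ` {..<b}"
  define A where "A = {..<a} \<times> {..<b}"
  define W where "W e = w (fst e) (snd e)" for e
  define T where "T e = walk_trace \<phi> \<gamma> (W e)" for e
  have W: "W e \<noteq> []" "hd (W e) = l (fst e)" "last (W e) = r (snd e)" "set (W e) \<subseteq> V"
    "successively (\<lambda>x y. {x, y} \<in> E) (W e)" "set (W e) \<inter> ?N \<subseteq> {l (fst e), r (snd e)}" if "e \<in> A" for e
  proof -
    have "fst e < a" "snd e < b" using that by (auto simp: A_def)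
    then show "W e \<noteq> []" "hd (W e) = l (fst e)" "last (W e) = r (snd e)" "set (W e) \<subseteq> V"
      "successively (\<lambda>x y. {x, y} \<in> E) (W e)" "set (W e) \<inter> ?N \<subseteq> {l (fst e), r (snd e)}"
      using walk ends unfolding W_def by blast+
  qed
  have WW: "set (W e) \<inter> set (W e') \<subseteq> ?N" if "e \<in> A" "e' \<in> A" "e \<noteq> e'" for e e'
  proof -
    have "fst e < a" "snd e < b" "fst e' < a" "snd e' < b" "(fst e, snd e) \<noteq> (fst e', snd e')"
      using that by (auto simp: A_def)
    then show ?thesis unfolding W_def by (rule disjoint)
  qed
  have NV: "x \<in> V" if "x \<in> set (W e)" "e \<in> A" for x e using W(4)[OF that(2)] that(1) by blast
  have on: "x \<in> set (W e)" if e: "e \<in> A" and z: "\<phi> x \<in> T e" and x: "x \<in> V" for x e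
  proof (cases rule: walk_trace_cases[OF z[unfolded T_def] W(5)[OF e]])
    case (1 y)
    then show ?thesis using inj_onD[OF \<phi>(1), of x y] x NV[OF _ e] by metis
  next
    case (2 d)
    then have "\<phi> x \<in> \<phi> ` d" using \<gamma>(2)[OF 2(1)] x by blast
    then obtain y where y: "y \<in> d" "\<phi> x = \<phi> y" by blast
    then have "x = y" using inj_onD[OF \<phi>(1), of x y] x EV[OF 2(1)] by blast
    then show ?thesis using y 2(2) by blast
  qed
  \<comment> \<open>Different walks have at most one vertex in common, a branch vertex. A common
    edge would thus have a single vertex, and its arc would have coinciding ends.\<close>
  have edge_inter: "d \<noteq> d'" if "e \<in> A" "e' \<in> A" "e \<noteq> e'" "d \<in> E" "d' \<in> E" "d \<subseteq> set (W e)" "d' \<subseteq> set (W e')" for e e' d d'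
  proof
    assume "d = d'"
    have sub: "d \<subseteq> {l (fst e), r (snd e)} \<inter> {l (fst e'), r (snd e')}"
      using WW[OF that(1,2,3)] W(6)[OF that(1)] W(6)[OF that(2)] that(6,7) \<open>d = d'\<close> by blast
    have mem: "fst e < a" "snd e < b" "fst e' < a" "snd e' < b" using that by (auto simp: A_def)
    have "l (fst e) \<noteq> r (snd e')" "l (fst e') \<noteq> r (snd e)" using disj mem by blast+
    moreover have "l (fst e) \<noteq> l (fst e') \<or> r (snd e) \<noteq> r (snd e')"
      using that(3) mem inj_onD[OF inj(1), of "fst e" "fst e'"] inj_onD[OF inj(2), of "snd e" "snd e'"]
      by (auto simp: prod_eq_iff)
    ultimately have "d \<subseteq> {r (snd e)} \<or> d \<subseteq> {l (fst e)}"
    proof (elim disjE)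
      assume "l (fst e) \<noteq> l (fst e')"
      then have "l (fst e) \<notin> d" using sub \<open>l (fst e) \<noteq> r (snd e')\<close> by auto
      then show ?thesis using sub by auto
    next
      assume "r (snd e) \<noteq> r (snd e')"
      then have "r (snd e) \<notin> d" using sub \<open>l (fst e') \<noteq> r (snd e)\<close> by auto
      then show ?thesis using sub by auto
    qed
    then obtain y where "d \<subseteq> {y}" by (elim disjE) (rule that)+
    then have "\<phi> ` d \<subseteq> {\<phi> y}" by blast
    moreover have "{pathstart (\<gamma> d), pathfinish (\<gamma> d)} = \<phi> ` d" using \<gamma>(1)[OF that(4)] by (elim conjE)
    ultimately have "{pathstart (\<gamma> d), pathfinish (\<gamma> d)} \<subseteq> {\<phi> y}" by (simp only:)
    then have "pathstart (\<gamma> d) = pathfinish (\<gamma> d)" by simp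
    moreover have "arc (\<gamma> d)" using \<gamma>(1)[OF that(4)] by (rule conjunct1)
    ultimately show False using arc_distinct_ends by metis
  qed
  have inter: "T e \<inter> T e' \<subseteq> \<phi> ` ?N" if ee: "e \<in> A" "e' \<in> A" "e \<noteq> e'" for e e'
  proof
    fix z assume z: "z \<in> T e \<inter> T e'"
    have vertex: "z \<in> \<phi> ` ?N" if "z = \<phi> x" "x \<in> V" for x
      using on[OF ee(1)] on[OF ee(2)] that z WW[OF ee] by blast
    have zz: "z \<in> walk_trace \<phi> \<gamma> (W e)" "z \<in> walk_trace \<phi> \<gamma> (W e')" using z by (auto simp: T_def)
    show "z \<in> \<phi> ` ?N"
    proof (cases rule: walk_trace_cases[OF zz(1) W(5)[OF ee(1)], case_names vtx edge])
      case (vtx x)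
      then show ?thesis using vertex[OF vtx(2)] NV[OF _ ee(1)] by blast
    next
      case (edge d)
      note d = edge
      show ?thesis
      proof (cases rule: walk_trace_cases[OF zz(2) W(5)[OF ee(2)], case_names vtx edge])
        case (vtx x)
        then show ?thesis using vertex[OF vtx(2)] NV[OF _ ee(2)] by blast
      next
        case (edge d')
        have "d \<noteq> d'" by (rule edge_inter[OF ee d(1) edge(1) d(2) edge(2)])
        then have "z \<in> \<phi> ` (d \<inter> d')" using \<gamma>(3)[OF d(1) edge(1)] d(3) edge(3) by blast
        then show ?thesis using d(2) edge(2) WW[OF ee] by blast
      qed
    qed
  qed
  have "\<exists>g. arc g \<and> path_image g \<subseteq> T e \<and> pathstart g = \<phi> (l (fst e)) \<and> pathfinish g = \<phi> (r (snd e))" if e: "e \<in> A" for e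
  proof -
    have conn: "path_connected (T e) \<and> \<phi> (hd (W e)) \<in> T e \<and> \<phi> (last (W e)) \<in> T e"
      unfolding T_def using W(5,1)[OF e] by (rule walk_trace_connected) (use \<gamma>(1) arc_imp_path in blast)
    have "fst e < a" "snd e < b" using e by (auto simp: A_def)
    then have "l (fst e) \<noteq> r (snd e)" using disj by blast
    then have "\<phi> (hd (W e)) \<noteq> \<phi> (last (W e))"
      using W(1,2,3,4)[OF e] \<phi>(1) by (metis hd_in_set inj_onD last_in_set subsetD)
    then show ?thesis using conn unfolding path_connected_arcwise by (metis W(2,3)[OF e])
  qed
  then obtain g where g: "\<And>e. e \<in> A \<Longrightarrow> arc (g e) \<and> path_image (g e) \<subseteq> T e \<and>
      pathstart (g e) = \<phi> (l (fst e)) \<and> pathfinish (g e) = \<phi> (r (snd e))"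
    by metis
  have V: "l i \<in> V" "r j \<in> V" if "i < a" "j < b" for i j
    using walk[OF that] by (metis hd_in_set subsetD, metis last_in_set subsetD)
  show ?thesis
  \<comment> \<open>If one side is empty, there are no walks to place the branch vertices in
    \<open>V\<close>, and the bound is trivial.\<close>
  proof (cases "a = 0 \<or> b = 0")
    case False
    then have NsubV: "?N \<subseteq> V" using V by auto
    let ?P = "\<phi> ` ?N"
    have draw: "arc_drawing ?P A g"
      unfolding arc_drawing_def
    proof (intro conjI ballI impI)
      fix e assume e: "e \<in> A"
      show "arc (g e)" using g[OF e] by blast
      have mem: "fst e < a" "snd e < b" using e by (auto simp: A_def)
      show "path_image (g e) \<inter> ?P = {pathstart (g e), pathfinish (g e)}"
      proof (intro equalityI subsetI)
        fix z assume z: "z \<in> path_image (g e) \<inter> ?P"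
        then obtain x where x: "x \<in> ?N" "z = \<phi> x" by blast
        then have "x \<in> set (W e)" using on[OF e] z g[OF e] NsubV by blast
        then have "x = l (fst e) \<or> x = r (snd e)" using W(6)[OF e] x(1) by blast
        then show "z \<in> {pathstart (g e), pathfinish (g e)}" using g[OF e] x(2) by auto
      next
        fix z assume "z \<in> {pathstart (g e), pathfinish (g e)}"
        moreover have "pathstart (g e) \<in> ?P" "pathfinish (g e) \<in> ?P" using g[OF e] mem by auto
        ultimately show "z \<in> path_image (g e) \<inter> ?P" by auto
      qed
      fix e' assume "e' \<in> A" "e \<noteq> e'"
      then show "path_image (g e) \<inter> path_image (g e') \<subseteq> ?P" using inter[OF e, of e'] g e by blast
    qed (auto simp: A_def)
    have "card A \<le> 2 * card ?P"
    proof (rule bd[unfolded bipartite_bounded_def, rule_format, of ?P A g "\<phi> ` l ` {..<a}" "\<phi> ` r ` {..<b}"], intro conjI ballI impI)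
      show "arc_drawing ?P A g" by (rule draw)
      show "\<phi> ` l ` {..<a} \<inter> \<phi> ` r ` {..<b} = {}"
        using disj NsubV inj_on_image_Int[OF \<phi>(1), of "l ` {..<a}" "r ` {..<b}"] by auto
      fix e assume e: "e \<in> A"
      have mem: "fst e < a" "snd e < b" using e by (auto simp: A_def)
      show "pathstart (g e) \<in> \<phi> ` l ` {..<a}" "pathfinish (g e) \<in> \<phi> ` r ` {..<b}" using g[OF e] mem by auto
      have "T e \<subseteq> f ` topspace X"
      proof
        fix z assume "z \<in> T e"
        then have z: "z \<in> walk_trace \<phi> \<gamma> (W e)" by (simp add: T_def)
        show "z \<in> f ` topspace X"
          by (cases rule: walk_trace_cases[OF z W(5)[OF e]]) (use \<phi>(2) NV[OF _ e] \<gamma>(1) in blast)+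
      qed
      then show "path_image (g e) \<subseteq> f ` topspace X" using g[OF e] by blast
      fix e' assume e': "e' \<in> A" and eq: "pathstart (g e) = pathstart (g e') \<and> pathfinish (g e) = pathfinish (g e')"
      have mem': "fst e' < a" "snd e' < b" using e' by (auto simp: A_def)
      have "\<phi> (l (fst e)) = \<phi> (l (fst e'))" "\<phi> (r (snd e)) = \<phi> (r (snd e'))" using eq g[OF e] g[OF e'] by auto
      then have "l (fst e) = l (fst e')" "r (snd e) = r (snd e')"
        using inj_onD[OF \<phi>(1)] NsubV mem mem' by blast+
      then show "e = e'"
        using inj_onD[OF inj(1), of "fst e" "fst e'"] inj_onD[OF inj(2), of "snd e" "snd e'"] mem mem'
        by (simp add: prod_eq_iff)
    qed
    also have "card ?P \<le> card ?N" by (rule card_image_le) auto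
    also have "card ?N \<le> card (l ` {..<a}) + card (r ` {..<b})" by (rule card_Un_le)
    also have "\<dots> \<le> a + b" using card_image_le[of "{..<a}" l] card_image_le[of "{..<b}" r] by simp
    finally show ?thesis by (simp add: A_def card_cartesian_product)
  qed auto
qed

section \<open>Subgroups of dihedral groups\<close>

text \<open>Here \<open>rot i\<close> is a^i and \<open>ref i\<close> is a^i b, with
  \<open>i\<close> ranging over all integers. Products then involve no reduction, and
  \<open>n\<close> enters only through the two congruences.\<close>

locale dihedral_coordinates = group G for G (structure) +
  fixes n :: nat and rot ref :: "int \<Rightarrow> 'a"
  assumes n_pos: "n \<ge> 1"
    and carrier_eq: "carrier G = range rot \<union> range ref"
    and rot_eq_iff: "rot i = rot j \<longleftrightarrow> int n dvd i - j"
    and ref_eq_iff: "ref i = ref j \<longleftrightarrow> int n dvd i - j"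
    and rot_neq_ref [simp]: "rot i \<noteq> ref j"
    and rot_rot [simp]: "rot i \<otimes> rot j = rot (i + j)"
    and rot_ref [simp]: "rot i \<otimes> ref j = ref (i + j)"
    and ref_rot [simp]: "ref i \<otimes> rot j = ref (i - j)"
    and ref_ref [simp]: "ref i \<otimes> ref j = rot (i - j)"

lemma dihedral_group_coordinates:
  fixes G :: "('a, 'b) monoid_scheme"
  assumes "dihedral_group G n" "n \<ge> 1"
  obtains rot ref :: "int \<Rightarrow> 'a" where "dihedral_coordinates G n rot ref"
proof -
  from assms(1) interpret group G by (simp add: dihedral_group_def)
  from assms(1) obtain a b where ab: "a \<in> carrier G" "b \<in> carrier G" "generate G {a, b} = carrier G"
    "a [^]\<^bsub>G\<^esub> n = \<one>\<^bsub>G\<^esub>" "b [^]\<^bsub>G\<^esub> (2::nat) = \<one>\<^bsub>G\<^esub>" "b \<otimes>\<^bsub>G\<^esub> a \<otimes>\<^bsub>G\<^esub> inv\<^bsub>G\<^esub> b = inv\<^bsub>G\<^esub> a"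
    and ord: "order G = 2 * n"
    unfolding dihedral_group_def by blast
  define rot where "rot i = a [^]\<^bsub>G\<^esub> (i::int)" for i
  define ref where "ref i = rot i \<otimes>\<^bsub>G\<^esub> b" for i
  have rc [simp]: "rot i \<in> carrier G" "ref i \<in> carrier G" for i using ab by (auto simp: rot_def ref_def)
  note [simp] = ab(1,2)
  have bb [simp]: "b \<otimes>\<^bsub>G\<^esub> b = \<one>\<^bsub>G\<^esub>" using ab(5) by (simp add: numeral_2_eq_2)
  have rr: "rot i \<otimes>\<^bsub>G\<^esub> rot j = rot (i + j)" for i j by (simp add: rot_def int_pow_mult)
  have r0: "rot 0 = \<one>\<^bsub>G\<^esub>" by (simp add: rot_def)
  have inv_rot: "inv\<^bsub>G\<^esub> (rot i) = rot (- i)" for i by (simp add: rot_def int_pow_neg)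
  have inv_b: "inv\<^bsub>G\<^esub> b = b" using inv_equality[OF bb] by simp
  have br: "b \<otimes>\<^bsub>G\<^esub> rot i = rot (- i) \<otimes>\<^bsub>G\<^esub> b" for i
  proof -
    \<comment> \<open>Conjugation by \<open>b\<close> is an endomorphism, so the relation for
      \<open>a\<close> extends to all powers of \<open>a\<close>.\<close>
    have hom: "(\<lambda>x. b \<otimes>\<^bsub>G\<^esub> x \<otimes>\<^bsub>G\<^esub> b) \<in> hom G G"
    proof (rule homI)
      fix x y assume xy: "x \<in> carrier G" "y \<in> carrier G"
      have "b \<otimes>\<^bsub>G\<^esub> x \<otimes>\<^bsub>G\<^esub> b \<otimes>\<^bsub>G\<^esub> (b \<otimes>\<^bsub>G\<^esub> y \<otimes>\<^bsub>G\<^esub> b) = b \<otimes>\<^bsub>G\<^esub> x \<otimes>\<^bsub>G\<^esub> (b \<otimes>\<^bsub>G\<^esub> b) \<otimes>\<^bsub>G\<^esub> y \<otimes>\<^bsub>G\<^esub> b"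
        using xy by (simp only: m_assoc m_closed \<open>b \<in> carrier G\<close>)
      then show "b \<otimes>\<^bsub>G\<^esub> (x \<otimes>\<^bsub>G\<^esub> y) \<otimes>\<^bsub>G\<^esub> b = b \<otimes>\<^bsub>G\<^esub> x \<otimes>\<^bsub>G\<^esub> b \<otimes>\<^bsub>G\<^esub> (b \<otimes>\<^bsub>G\<^esub> y \<otimes>\<^bsub>G\<^esub> b)"
        using xy by (simp add: m_assoc)
    qed auto
    have "b \<otimes>\<^bsub>G\<^esub> rot i \<otimes>\<^bsub>G\<^esub> b = (b \<otimes>\<^bsub>G\<^esub> a \<otimes>\<^bsub>G\<^esub> b) [^]\<^bsub>G\<^esub> i"
      unfolding rot_def using hom_int_pow[OF hom, of a i] is_group by simp
    also have "\<dots> = rot (- i)" using ab(6) by (simp add: inv_b rot_def int_pow_inv int_pow_neg)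
    finally have "b \<otimes>\<^bsub>G\<^esub> rot i \<otimes>\<^bsub>G\<^esub> b \<otimes>\<^bsub>G\<^esub> b = rot (- i) \<otimes>\<^bsub>G\<^esub> b" by simp
    then show ?thesis by (simp add: m_assoc)
  qed
  have rf: "rot i \<otimes>\<^bsub>G\<^esub> ref j = ref (i + j)" for i j by (simp add: ref_def m_assoc[symmetric] rr)
  have fr: "ref i \<otimes>\<^bsub>G\<^esub> rot j = ref (i - j)" for i j
    by (simp add: ref_def m_assoc br) (simp add: m_assoc[symmetric] rr)
  have ff: "ref i \<otimes>\<^bsub>G\<^esub> ref j = rot (i - j)" for i j
  proof -
    have "ref i \<otimes>\<^bsub>G\<^esub> ref j = (ref i \<otimes>\<^bsub>G\<^esub> rot j) \<otimes>\<^bsub>G\<^esub> b" by (simp add: ref_def[of j] m_assoc)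
    also have "\<dots> = rot (i - j)" unfolding fr by (simp add: ref_def m_assoc)
    finally show ?thesis .
  qed
  have car: "carrier G = range rot \<union> range ref"
  proof (intro equalityI subsetI)
    fix x assume "x \<in> carrier G"
    then have "x \<in> generate G {a, b}" by (simp add: ab(3))
    then show "x \<in> range rot \<union> range ref"
    proof (induction rule: generate.induct)
      case one then show ?case using r0 by (metis UnI1 rangeI)
    next
      case (incl h)
      have "a = rot 1" "b = ref 0" by (simp_all add: rot_def ref_def)
      then show ?case using incl by auto
    next
      case (inv h)
      have "inv\<^bsub>G\<^esub> a = rot (- 1)" "b = ref 0" by (simp_all add: rot_def ref_def int_pow_neg)
      then show ?case using inv inv_b by auto
    next
      case (eng h1 h2)
      then show ?case by (auto simp: rr rf fr ff)
    qed
  qed auto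
  have rn: "rot (int n * k) = \<one>\<^bsub>G\<^esub>" for k
    using ab(4) by (simp add: rot_def int_pow_pow[symmetric] int_pow_int)
  have rmod: "rot i = rot (i mod int n)" "ref i = ref (i mod int n)" for i
  proof -
    have "rot i = rot (int n * (i div int n)) \<otimes>\<^bsub>G\<^esub> rot (i mod int n)" unfolding rr by simp
    then show "rot i = rot (i mod int n)" by (simp add: rn)
    then show "ref i = ref (i mod int n)" by (simp add: ref_def)
  qed
  let ?I = "{0..<int n}"
  have rI: "range rot = rot ` ?I" "range ref = ref ` ?I"
  proof -
    have "i mod int n \<in> ?I" for i using assms(2) by simp
    then show "range rot = rot ` ?I" "range ref = ref ` ?I" using rmod by (blast intro: image_eqI)+
  qed
  \<comment> \<open>Two images of at most \<open>n\<close> elements each cover a group of order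
    \<open>2 * n\<close>, so they are disjoint and both maps are injective on a period.\<close>
  have card: "card (rot ` ?I \<union> ref ` ?I) = 2 * n" using ord car rI by (simp add: order_def)
  have le: "card (rot ` ?I) \<le> n" "card (ref ` ?I) \<le> n"
    using card_image_le[of ?I rot] card_image_le[of ?I ref] by simp_all
  have un: "card (rot ` ?I \<union> ref ` ?I) + card (rot ` ?I \<inter> ref ` ?I) = card (rot ` ?I) + card (ref ` ?I)"
    by (rule card_Un_Int[symmetric]) auto
  have eqs: "card (rot ` ?I) = card ?I" "card (ref ` ?I) = card ?I" "card (rot ` ?I \<inter> ref ` ?I) = 0"
  proof -
    have "card ?I = n" by simp
    then show "card (rot ` ?I) = card ?I" "card (ref ` ?I) = card ?I" "card (rot ` ?I \<inter> ref ` ?I) = 0"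
      using card le un by linarith+
  qed
  then have inj: "inj_on rot ?I" "inj_on ref ?I" by (auto intro: eq_card_imp_inj_on)
  have disj: "rot ` ?I \<inter> ref ` ?I = {}" using eqs(3) by simp
  have modeq: "i mod int n = j mod int n \<longleftrightarrow> int n dvd i - j" for i j by (rule mod_eq_dvd_iff)
  have "rot i = rot j \<longleftrightarrow> int n dvd i - j" for i j
    using inj_onD[OF inj(1), of "i mod int n" "j mod int n"] rmod(1) assms(2) modeq[of i j]
    by (metis atLeastLessThan_iff pos_mod_bound pos_mod_sign zero_less_one of_nat_0_less_iff less_le_trans)
  moreover have "ref i = ref j \<longleftrightarrow> int n dvd i - j" for i j
    using inj_onD[OF inj(2), of "i mod int n" "j mod int n"] rmod(2) assms(2) modeq[of i j]
    by (metis atLeastLessThan_iff pos_mod_bound pos_mod_sign zero_less_one of_nat_0_less_iff less_le_trans)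
  moreover have "rot i \<noteq> ref j" for i j using disj rI by blast
  ultimately have "dihedral_coordinates G n rot ref"
    using assms(2) car rr rf fr ff by unfold_locales auto
  then show thesis by (rule that)
qed

section \<open>Normal forms of subgroups\<close>

context dihedral_coordinates
begin

definition rotations :: "int \<Rightarrow> 'a set" where
  "rotations d = rot ` {k. d dvd k}"

definition dihedrals :: "int \<Rightarrow> int \<Rightarrow> 'a set" where
  "dihedrals d i = rot ` {k. d dvd k} \<union> ref ` {k. d dvd k - i}"

lemma rot_closed [simp]: "rot i \<in> carrier G" and ref_closed [simp]: "ref i \<in> carrier G"
  by (auto simp: carrier_eq)

lemma ref_neq_rot [simp]: "ref i \<noteq> rot j"
  using rot_neq_ref by metis

lemma rot_0: "rot 0 = \<one>"
  using rot_rot[of 0 0] by (metis add_0 r_cancel_one rot_closed)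

lemma dvd_congruent_mod_n:
  assumes "d dvd int n" "int n dvd k - l"
  shows "d dvd k - i \<longleftrightarrow> d dvd l - i"
proof -
  have "k - i = (k - l) + (l - i)" by simp
  then show ?thesis using dvd_trans[OF assms] by (metis dvd_add_right_iff)
qed

lemma rot_mem_rotations [simp]: "d dvd int n \<Longrightarrow> rot k \<in> rotations d \<longleftrightarrow> d dvd k"
  using dvd_congruent_mod_n[of d k _ 0] by (auto simp: rotations_def rot_eq_iff)

lemma ref_mem_rotations [simp]: "ref k \<notin> rotations d"
  by (auto simp: rotations_def dest: sym[of "ref _"])

lemma rot_mem_dihedrals [simp]: "d dvd int n \<Longrightarrow> rot k \<in> dihedrals d i \<longleftrightarrow> d dvd k"
  using dvd_congruent_mod_n[of d k _ 0] by (auto simp: dihedrals_def rot_eq_iff)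

lemma ref_mem_dihedrals [simp]: "d dvd int n \<Longrightarrow> ref k \<in> dihedrals d i \<longleftrightarrow> d dvd k - i"
  using dvd_congruent_mod_n[of d k _ i] by (auto simp: dihedrals_def ref_eq_iff dest: sym[of "ref _"])

lemma subset_carrier_eqI:
  assumes "H \<subseteq> carrier G" "K \<subseteq> carrier G" "\<And>k. rot k \<in> H \<longleftrightarrow> rot k \<in> K" "\<And>k. ref k \<in> H \<longleftrightarrow> ref k \<in> K"
  shows "H = K"
  using assms unfolding carrier_eq by blast

lemma rotations_subset: "rotations d \<subseteq> carrier G" and dihedrals_subset: "dihedrals d i \<subseteq> carrier G"
  by (auto simp: rotations_def dihedrals_def)

lemma inv_rot: "inv (rot k) = rot (- k)" and inv_ref: "inv (ref k) = ref k"
  by (auto intro!: inv_equality simp: rot_0)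

lemma subgroup_rotations: "d dvd int n \<Longrightarrow> subgroup (rotations d) G"
  by (intro subgroupI) (auto simp: rotations_def inv_rot)

lemma subgroup_dihedrals: "d dvd int n \<Longrightarrow> subgroup (dihedrals d i) G"
proof (intro subgroupI)
  assume d: "d dvd int n"
  show "inv x \<in> dihedrals d i" if "x \<in> dihedrals d i" for x
    using that by (auto simp: dihedrals_def inv_rot inv_ref)
  show "x \<otimes> y \<in> dihedrals d i" if "x \<in> dihedrals d i" "y \<in> dihedrals d i" for x y
  proof -
    have "x \<in> range rot \<union> range ref" "y \<in> range rot \<union> range ref"
      using that dihedrals_subset by (auto simp: dihedrals_def)
    then show ?thesis using that d dvd_add[of d] dvd_diff[of d]
      by (auto simp: algebra_simps) (smt (verit) dvd_add dvd_diff)+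
  qed
qed (auto simp: dihedrals_def)

text \<open>The exponents of the rotations in \<open>H\<close> form a subgroup of the integers that
  contains \<open>n\<close>, hence the multiples of a divisor \<open>d\<close> of \<open>n\<close>.
  If \<open>H\<close> contains a reflection \<open>ref i\<close>, multiplication by it carries the
  rotations of \<open>H\<close> to its reflections.\<close>

lemma subgroup_cases:
  assumes H: "subgroup H G"
  obtains d where "d > 0" "d dvd int n" "H = rotations d"
    | d i where "d > 0" "d dvd int n" "H = dihedrals d i"
proof -
  have sub: "H \<subseteq> carrier G" using H by (rule subgroup.subset)
  define D where "D = {k. rot k \<in> H}"
  have n: "int n \<in> D"
  proof -
    have "rot (int n) = rot 0" by (simp add: rot_eq_iff)
    then show ?thesis using subgroup.one_closed[OF H] by (simp add: D_def rot_0)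
  qed
  have diff: "x - y \<in> D" if "x \<in> D" "y \<in> D" for x y
    using subgroup.m_closed[OF H, of "rot x" "inv (rot y)"] subgroup.m_inv_closed[OF H, of "rot y"] that
    by (simp add: D_def inv_rot)
  have zero: "0 \<in> D" using diff[OF n n] by simp
  have neg: "- x \<in> D" if "x \<in> D" for x using diff[OF zero that] by simp
  have add: "x + y \<in> D" if "x \<in> D" "y \<in> D" for x y using diff[OF that(1) neg[OF that(2)]] by simp
  have nmult: "int m * x \<in> D" if "x \<in> D" for m x
    by (induction m) (use zero add that in \<open>auto simp: algebra_simps\<close>)
  have mult: "m * x \<in> D" if "x \<in> D" for m x
    using nmult[OF that, of "nat m"] nmult[OF neg[OF that], of "nat (- m)"] by (cases "m \<ge> 0") auto
  define d where "d = int (LEAST m. m > 0 \<and> int m \<in> D)"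
  have "n > 0 \<and> int n \<in> D" using n n_pos by simp
  then have d: "d > 0" "d \<in> D" and least: "\<And>m. m > 0 \<Longrightarrow> int m \<in> D \<Longrightarrow> d \<le> int m"
    unfolding d_def using LeastI[of "\<lambda>m. m > 0 \<and> int m \<in> D" n] Least_le[of "\<lambda>m. m > 0 \<and> int m \<in> D"] by auto
  have D: "x \<in> D \<longleftrightarrow> d dvd x" for x
  proof
    assume "x \<in> D"
    then have "x mod d \<in> D" using diff[OF _ mult[OF d(2), of "x div d"], of x] by (simp add: minus_div_mult_eq_mod)
    then have "\<not> x mod d > 0" using least[of "nat (x mod d)"] pos_mod_bound[OF d(1), of x] by force
    then have "x mod d = 0" using pos_mod_sign[OF d(1), of x] by linarith
    then show "d dvd x" by auto
  next
    assume "d dvd x" then show "x \<in> D" using mult[OF d(2)] by (auto simp: dvd_def mult.commute)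
  qed
  have dn: "d dvd int n" using n D by simp
  show thesis
  proof (cases "\<exists>i. ref i \<in> H")
    case False
    then have "H = rotations d"
      using sub rotations_subset D dn by (intro subset_carrier_eqI) (auto simp: D_def)
    then show thesis using that(1) d(1) dn by blast
  next
    case True
    then obtain i where i: "ref i \<in> H" by blast
    have "ref k \<in> H \<longleftrightarrow> d dvd k - i" for k
    proof
      assume "ref k \<in> H"
      then have "rot (k - i) \<in> H" using subgroup.m_closed[OF H _ i] by fastforce
      then show "d dvd k - i" using D by (simp add: D_def)
    next
      assume "d dvd k - i"
      then have "rot (k - i) \<in> H" using D by (simp add: D_def)
      then show "ref k \<in> H" using subgroup.m_closed[OF H _ i] by fastforce
    qed
    then have "H = dihedrals d i"
      using sub dihedrals_subset D dn by (intro subset_carrier_eqI) (auto simp: D_def)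
    then show thesis using that(2) d(1) dn by blast
  qed
qed

section \<open>Products of two subgroups\<close>

lemma rot_mem_set_mult:
  assumes "H \<subseteq> carrier G" "K \<subseteq> carrier G"
  shows "rot k \<in> H <#> K \<longleftrightarrow>
    (\<exists>x. rot x \<in> H \<and> rot (k - x) \<in> K) \<or> (\<exists>x. ref x \<in> H \<and> ref (x - k) \<in> K)"
proof
  assume "rot k \<in> H <#> K"
  then obtain h g where hg: "h \<in> H" "g \<in> K" "rot k = h \<otimes> g" by (auto simp: set_mult_def)
  then have hg': "h \<in> range rot \<union> range ref" "g \<in> range rot \<union> range ref" using assms carrier_eq by blast+
  have "(\<exists>x y. h = rot x \<and> g = rot y \<and> int n dvd k - (x + y)) \<or> (\<exists>x y. h = ref x \<and> g = ref y \<and> int n dvd k - (x - y))"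
    using hg' hg(3) unfolding rot_eq_iff[symmetric] by (elim UnE rangeE; simp; blast)
  then consider x y where "h = rot x" "g = rot y" "int n dvd k - (x + y)"
    | x y where "h = ref x" "g = ref y" "int n dvd k - (x - y)"
    by blast
  then show "(\<exists>x. rot x \<in> H \<and> rot (k - x) \<in> K) \<or> (\<exists>x. ref x \<in> H \<and> ref (x - k) \<in> K)"
  proof cases
    case 1
    then have "rot (k - x) = rot y" by (simp add: rot_eq_iff algebra_simps)
    then show ?thesis using 1 hg by metis
  next
    case 2
    have "int n dvd - (k - (x - y))" using 2(3) by (simp only: dvd_minus_iff)
    then have "ref (x - k) = ref y" by (simp add: ref_eq_iff algebra_simps)
    then show ?thesis using 2 hg by metis
  qed
next
  have "rot k = rot x \<otimes> rot (k - x)" "rot k = ref x \<otimes> ref (x - k)" for x by simp_all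
  then show "(\<exists>x. rot x \<in> H \<and> rot (k - x) \<in> K) \<or> (\<exists>x. ref x \<in> H \<and> ref (x - k) \<in> K) \<Longrightarrow> rot k \<in> H <#> K"
    unfolding set_mult_def by blast
qed

lemma ref_mem_set_mult:
  assumes "H \<subseteq> carrier G" "K \<subseteq> carrier G"
  shows "ref k \<in> H <#> K \<longleftrightarrow>
    (\<exists>x. rot x \<in> H \<and> ref (k - x) \<in> K) \<or> (\<exists>x. ref x \<in> H \<and> rot (x - k) \<in> K)"
proof
  assume "ref k \<in> H <#> K"
  then obtain h g where hg: "h \<in> H" "g \<in> K" "ref k = h \<otimes> g" by (auto simp: set_mult_def)
  then have hg': "h \<in> range rot \<union> range ref" "g \<in> range rot \<union> range ref" using assms carrier_eq by blast+
  have "(\<exists>x y. h = rot x \<and> g = ref y \<and> int n dvd k - (x + y)) \<or> (\<exists>x y. h = ref x \<and> g = rot y \<and> int n dvd k - (x - y))"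
    using hg' hg(3) unfolding ref_eq_iff[symmetric] by (elim UnE rangeE; simp; blast)
  then consider x y where "h = rot x" "g = ref y" "int n dvd k - (x + y)"
    | x y where "h = ref x" "g = rot y" "int n dvd k - (x - y)"
    by blast
  then show "(\<exists>x. rot x \<in> H \<and> ref (k - x) \<in> K) \<or> (\<exists>x. ref x \<in> H \<and> rot (x - k) \<in> K)"
  proof cases
    case 1
    then have "ref (k - x) = ref y" by (simp add: ref_eq_iff algebra_simps)
    then show ?thesis using 1 hg by metis
  next
    case 2
    have "int n dvd - (k - (x - y))" using 2(3) by (simp only: dvd_minus_iff)
    then have "rot (x - k) = rot y" by (simp add: rot_eq_iff algebra_simps)
    then show ?thesis using 2 hg by metis
  qed
next
  have "ref k = rot x \<otimes> ref (k - x)" "ref k = ref x \<otimes> rot (x - k)" for x by simp_all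
  then show "(\<exists>x. rot x \<in> H \<and> ref (k - x) \<in> K) \<or> (\<exists>x. ref x \<in> H \<and> rot (x - k) \<in> K) \<Longrightarrow> ref k \<in> H <#> K"
    unfolding set_mult_def by blast
qed

lemma set_mult_eq_carrier_iff:
  assumes "H \<subseteq> carrier G" "K \<subseteq> carrier G"
  shows "H <#> K = carrier G \<longleftrightarrow> (\<forall>k. rot k \<in> H <#> K) \<and> (\<forall>k. ref k \<in> H <#> K)"
  using set_mult_closed[OF assms] unfolding carrier_eq by blast

text \<open>Bezout's identity: the multiples of \<open>d\<close> and of \<open>e\<close> add up to
  the multiples of \<open>gcd d e\<close>, so shifting the class of \<open>i\<close> modulo
  \<open>d\<close> by multiples of \<open>e\<close> gives the class of \<open>i\<close> modulo the
  gcd.\<close>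

lemma ex_shift_dvd_iff:
  fixes d e i k :: int
  shows "(\<exists>x. d dvd x - i \<and> e dvd k - x) \<longleftrightarrow> gcd d e dvd k - i"
proof
  assume "\<exists>x. d dvd x - i \<and> e dvd k - x"
  then obtain x where "d dvd x - i" "e dvd k - x" by blast
  then have "gcd d e dvd (x - i) + (k - x)" by (meson dvd_add dvd_trans gcd_dvd1 gcd_dvd2)
  then show "gcd d e dvd k - i" by simp
next
  assume "gcd d e dvd k - i"
  then obtain m where m: "k - i = gcd d e * m" by (auto simp: dvd_def)
  obtain u v where "u * d + v * e = gcd d e" using bezout_int by blast
  then have "k - i = (u * d + v * e) * m" using m by simp
  then have "k - (i + u * d * m) = e * (v * m)" by (simp add: algebra_simps)
  then show "\<exists>x. d dvd x - i \<and> e dvd k - x"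
    by (intro exI[of _ "i + u * d * m"]) (auto simp: dvd_def)
qed

lemma comaximal_rotations_rotations: "rotations d <#> rotations e \<noteq> carrier G"
  using set_mult_eq_carrier_iff[OF rotations_subset rotations_subset]
    ref_mem_set_mult[OF rotations_subset rotations_subset] by auto

lemma all_dvd_diff_iff: "(\<forall>k. (g::int) dvd k - i) \<longleftrightarrow> g dvd 1"
proof
  assume "\<forall>k. g dvd k - i"
  then have "g dvd (i + 1) - i" by blast
  then show "g dvd 1" by simp
qed (meson dvd_trans one_dvd)

lemma comaximal_rotations_dihedrals:
  assumes "d dvd int n" "e dvd int n"
  shows "rotations d <#> dihedrals e i = carrier G \<longleftrightarrow> coprime d e"
    and "dihedrals e i <#> rotations d = carrier G \<longleftrightarrow> coprime d e"
proof -
  note sub = rotations_subset dihedrals_subset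
  have "(\<exists>x. d dvd x \<and> e dvd k - x) \<longleftrightarrow> gcd d e dvd k" "(\<exists>x. d dvd x \<and> e dvd k - x - i) \<longleftrightarrow> gcd d e dvd k - i" for k
    using ex_shift_dvd_iff[of d 0 e k] ex_shift_dvd_iff[of d 0 e "k - i"] by (simp_all add: algebra_simps)
  then show "rotations d <#> dihedrals e i = carrier G \<longleftrightarrow> coprime d e"
    using all_dvd_diff_iff[of "gcd d e" 0] all_dvd_diff_iff[of "gcd d e" i] assms
    by (simp add: set_mult_eq_carrier_iff sub rot_mem_set_mult ref_mem_set_mult coprime_iff_gcd_eq_1)
  have "(\<exists>x. e dvd x \<and> d dvd k - x) \<longleftrightarrow> gcd d e dvd k" "(\<exists>x. e dvd x - i \<and> d dvd x - k) \<longleftrightarrow> gcd d e dvd k - i" for k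
    using ex_shift_dvd_iff[of e 0 d k] ex_shift_dvd_iff[of e i d k] by (simp_all add: gcd.commute dvd_diff_commute)
  then show "dihedrals e i <#> rotations d = carrier G \<longleftrightarrow> coprime d e"
    using all_dvd_diff_iff[of "gcd d e" 0] all_dvd_diff_iff[of "gcd d e" i] assms
    by (simp add: set_mult_eq_carrier_iff sub rot_mem_set_mult ref_mem_set_mult coprime_iff_gcd_eq_1)
qed

text \<open>If \<open>g\<close> is no unit, \<open>i + 1\<close> is not in the class of
  \<open>i\<close>, hence in that of \<open>j\<close>; then \<open>i + 2\<close> is not in the class
  of \<open>j\<close>, hence in that of \<open>i\<close>, and \<open>g\<close> divides 2.\<close>

lemma all_dvd_diff_disj_iff:
  fixes g i j :: int
  shows "(\<forall>k. g dvd k - i \<or> g dvd k - j) \<longleftrightarrow> g dvd 1 \<or> (\<bar>g\<bar> = 2 \<and> odd (i - j))"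
proof
  assume all: "\<forall>k. g dvd k - i \<or> g dvd k - j"
  show "g dvd 1 \<or> (\<bar>g\<bar> = 2 \<and> odd (i - j))"
  proof (rule ccontr)
    assume no: "\<not> ?thesis"
    then have n1: "\<not> g dvd 1" by blast
    have "g dvd (i + 1) - j" using all[rule_format, of "i + 1"] n1 by simp
    moreover have "\<not> g dvd (i + 2) - j"
    proof
      assume "g dvd (i + 2) - j"
      then have "g dvd ((i + 2) - j) - ((i + 1) - j)" using \<open>g dvd (i + 1) - j\<close> by (rule dvd_diff)
      then show False using n1 by simp
    qed
    ultimately have "g dvd 2" using all[rule_format, of "i + 2"] by simp
    then have "\<bar>g\<bar> dvd 2" by simp
    then have "\<bar>g\<bar> \<le> 2" by (rule zdvd_imp_le) simp
    moreover have "\<bar>g\<bar> \<noteq> 0" using \<open>g dvd 2\<close> by auto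
    moreover have "\<bar>g\<bar> \<noteq> 1" using n1 by auto
    ultimately have "\<bar>g\<bar> = 2" by linarith
    moreover have "\<bar>g\<bar> dvd (i + 1) - j" using \<open>g dvd (i + 1) - j\<close> by simp
    ultimately have "even ((i + 1) - j)" by (simp only:)
    then show False using no \<open>\<bar>g\<bar> = 2\<close> by simp
  qed
next
  assume "g dvd 1 \<or> (\<bar>g\<bar> = 2 \<and> odd (i - j))"
  then show "\<forall>k. g dvd k - i \<or> g dvd k - j"
  proof
    assume "\<bar>g\<bar> = 2 \<and> odd (i - j)"
    then have "g = 2 \<or> g = -2" "odd (i - j)" by auto
    then show ?thesis by auto
  qed (meson dvd_trans one_dvd)
qed

text \<open>The rotations in the product fill the classes of 0 and \<open>i - j\<close> modulo the
  gcd, the reflections those of \<open>i\<close> and \<open>j\<close>. Two classes also cover all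
  integers for modulus 2, and this is what sets even \<open>n\<close> apart.\<close>

lemma comaximal_dihedrals_dihedrals:
  assumes "d dvd int n" "e dvd int n"
  shows "dihedrals d i <#> dihedrals e j = carrier G \<longleftrightarrow> coprime d e \<or> gcd d e = 2 \<and> odd (i - j)"
proof -
  let ?g = "gcd d e"
  have "(\<exists>x. d dvd x \<and> e dvd k - x) \<longleftrightarrow> ?g dvd k - 0" "(\<exists>x. d dvd x - i \<and> e dvd x - k - j) \<longleftrightarrow> ?g dvd k - (i - j)"
    "(\<exists>x. d dvd x \<and> e dvd k - x - j) \<longleftrightarrow> ?g dvd k - j" "(\<exists>x. d dvd x - i \<and> e dvd x - k) \<longleftrightarrow> ?g dvd k - i" for k
  proof -
    have "(\<exists>x. d dvd x - i \<and> e dvd x - k - j) \<longleftrightarrow> (\<exists>x. d dvd x - i \<and> e dvd (k + j) - x)"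
      by (metis diff_diff_eq dvd_diff_commute)
    also have "\<dots> \<longleftrightarrow> ?g dvd k - (i - j)" using ex_shift_dvd_iff[of d i e "k + j"] by (simp add: algebra_simps)
    finally show "(\<exists>x. d dvd x - i \<and> e dvd x - k - j) \<longleftrightarrow> ?g dvd k - (i - j)" .
  qed (use ex_shift_dvd_iff[of d 0 e k] ex_shift_dvd_iff[of d 0 e "k - j"] ex_shift_dvd_iff[of d i e k] in
      \<open>simp_all add: dvd_diff_commute algebra_simps\<close>)
  then have "dihedrals d i <#> dihedrals e j = carrier G \<longleftrightarrow>
      (\<forall>k. ?g dvd k - 0 \<or> ?g dvd k - (i - j)) \<and> (\<forall>k. ?g dvd k - j \<or> ?g dvd k - i)"
    using assms by (simp add: set_mult_eq_carrier_iff dihedrals_subset rot_mem_set_mult ref_mem_set_mult)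
  also have "\<dots> \<longleftrightarrow> coprime d e \<or> ?g = 2 \<and> odd (i - j)"
    unfolding all_dvd_diff_disj_iff by (auto simp: coprime_iff_gcd_eq_1)
  finally show ?thesis .
qed

lemma rotations_eq_iff:
  assumes "d dvd int n" "e dvd int n" "d > 0" "e > 0"
  shows "rotations d = rotations e \<longleftrightarrow> d = e"
  using assms rot_mem_rotations by (metis dvd_refl zdvd_antisym_nonneg less_imp_le)

lemma dihedrals_eq_iff:
  assumes "d dvd int n" "e dvd int n" "d > 0" "e > 0"
  shows "dihedrals d i = dihedrals e j \<longleftrightarrow> d = e \<and> d dvd i - j"
proof
  assume eq: "dihedrals d i = dihedrals e j"
  then have "d = e" using assms rot_mem_dihedrals by (metis dvd_refl zdvd_antisym_nonneg less_imp_le)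
  moreover have "ref i \<in> dihedrals e j" using eq assms(1) by (metis diff_self dvd_0_right ref_mem_dihedrals)
  ultimately show "d = e \<and> d dvd i - j" using assms(2) by simp
next
  assume de: "d = e \<and> d dvd i - j"
  have "d dvd k - i \<longleftrightarrow> d dvd k - j" for k
  proof -
    have "k - j = (k - i) + (i - j)" by simp
    then show ?thesis using de by (metis dvd_add_left_iff)
  qed
  then show "dihedrals d i = dihedrals e j" using de assms by (intro subset_carrier_eqI dihedrals_subset) auto
qed

lemma rotations_neq_dihedrals [simp]: "rotations d \<noteq> dihedrals e i" "dihedrals e i \<noteq> rotations d"
proof -
  have "ref i \<in> dihedrals e i" by (auto simp: dihedrals_def)
  then show "rotations d \<noteq> dihedrals e i" "dihedrals e i \<noteq> rotations d" by (metis ref_mem_rotations)+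
qed

lemma rotations_nontrivial:
  assumes "d dvd int n" "d > 0" "d < int n"
  shows "rotations d \<in> nontrivial_proper_subgroups G"
proof -
  have "rot d \<in> rotations d" using assms by simp
  moreover have "rot d \<noteq> \<one>" using assms zdvd_not_zless by (simp flip: rot_0 add: rot_eq_iff)
  moreover have "rotations d \<noteq> carrier G" using ref_mem_rotations ref_closed by metis
  ultimately show ?thesis using subgroup_rotations[OF assms(1)] by (auto simp: nontrivial_proper_subgroups_def)
qed

lemma dihedrals_nontrivial:
  assumes "d dvd int n" "d > 1"
  shows "dihedrals d i \<in> nontrivial_proper_subgroups G"
proof -
  have "ref i \<in> dihedrals d i" by (auto simp: dihedrals_def)
  moreover have "ref i \<noteq> \<one>" by (metis rot_0 rot_neq_ref)
  moreover have "rot 1 \<notin> dihedrals d i" using assms zdvd_not_zless[of 1 d] by auto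
  ultimately show ?thesis using subgroup_dihedrals[OF assms(1)] rot_closed[of 1]
    unfolding nontrivial_proper_subgroups_def by blast
qed

lemma nontrivial_proper_subgroup_cases:
  assumes "H \<in> nontrivial_proper_subgroups G"
  obtains d where "d > 0" "d < int n" "d dvd int n" "H = rotations d"
    | d i where "d > 1" "d dvd int n" "H = dihedrals d i"
proof -
  have H: "subgroup H G" "H \<noteq> {\<one>}" "H \<noteq> carrier G" using assms by (auto simp: nontrivial_proper_subgroups_def)
  from H(1) show thesis
  proof (cases rule: subgroup_cases)
    case (1 d)
    have "d \<noteq> int n"
    proof
      assume "d = int n"
      then have "H = {\<one>}"
        using 1 rotations_subset[of d] by (intro subset_carrier_eqI) (auto simp flip: rot_0 simp: rot_eq_iff)
      then show False using H by blast
    qed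
    moreover have "d \<le> int n" using 1 n_pos zdvd_imp_le by simp
    ultimately show thesis using that(1) 1 by force
  next
    case (2 d i)
    have "d \<noteq> 1"
    proof
      assume "d = 1"
      then have "H = carrier G"
        using 2 dihedrals_subset[of d i] by (intro subset_carrier_eqI) auto
      then show False using H by blast
    qed
    then show thesis using that(2) 2 by force
  qed
qed

end

section \<open>Non-embeddable incidence graphs\<close>

lemma pairwise_comaximal_hyperedgeD:
  assumes "E \<in> comaximal_hyperedges G" "H \<in> E" "K \<in> E" "H \<noteq> K"
  shows "H <#>\<^bsub>G\<^esub> K = carrier G"
  using assms by (auto simp: comaximal_hyperedges_def pairwise_comaximal_def)

lemma comaximal_hyperedge_subset: "E \<in> comaximal_hyperedges G \<Longrightarrow> E \<subseteq> comaximal_vertices G"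
  by (simp add: comaximal_hyperedges_def)

lemma comaximal_hyperedge_maximal:
  assumes "E \<in> comaximal_hyperedges G" "E \<subseteq> C" "C \<subseteq> comaximal_vertices G" "pairwise_comaximal G C"
  shows "E = C"
  using assms by (auto simp: comaximal_hyperedges_def)

lemma finite_comaximal_vertices:
  assumes "finite (carrier G)"
  shows "finite (comaximal_vertices G)"
proof -
  have "comaximal_vertices G \<subseteq> Pow (carrier G)"
    by (auto simp: comaximal_vertices_def nontrivial_proper_subgroups_def dest: subgroup.subset)
  then show ?thesis using assms by (meson finite_Pow_iff finite_subset)
qed

text \<open>Excluding \<open>Q = {H}\<close> gives every member a second one in \<open>Q\<close>,
  and this is the comaximal partner that makes it a vertex.\<close>

lemma clique_subset_comaximal_vertices:
  assumes "Q \<subseteq> nontrivial_proper_subgroups G" "pairwise_comaximal G Q" "\<And>H. H \<in> Q \<Longrightarrow> Q \<noteq> {H}"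
  shows "Q \<subseteq> comaximal_vertices G"
proof
  fix H assume H: "H \<in> Q"
  then obtain K where "K \<in> Q" "K \<noteq> H" using assms(3) by blast
  then show "H \<in> comaximal_vertices G"
    using assms(1,2) H unfolding comaximal_vertices_def pairwise_comaximal_def by blast
qed

lemma clique_extends_to_hyperedge:
  assumes fin: "finite (carrier G)"
    and Q: "Q \<subseteq> nontrivial_proper_subgroups G" "pairwise_comaximal G Q" "\<And>H. H \<in> Q \<Longrightarrow> Q \<noteq> {H}"
  shows "\<exists>E\<in>comaximal_hyperedges G. Q \<subseteq> E"
proof -
  let ?V = "comaximal_vertices G"
  define S where "S = {E. Q \<subseteq> E \<and> E \<subseteq> ?V \<and> pairwise_comaximal G E}"
  have "S \<subseteq> Pow ?V" by (auto simp: S_def)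
  then have "finite S" using finite_comaximal_vertices[OF fin] by (meson finite_Pow_iff finite_subset)
  moreover have "Q \<in> S" using clique_subset_comaximal_vertices[OF Q] Q by (simp add: S_def)
  ultimately obtain E where E: "E \<in> S" "\<And>E'. E' \<in> S \<Longrightarrow> E \<subseteq> E' \<Longrightarrow> E = E'"
    using finite_has_maximal2[of S Q] by metis
  have "E \<in> comaximal_hyperedges G"
    unfolding comaximal_hyperedges_def
  proof (intro CollectI conjI notI)
    assume "\<exists>E'\<subseteq>?V. E \<subset> E' \<and> pairwise_comaximal G E'"
    then obtain E' where E': "E' \<subseteq> ?V" "E \<subset> E'" "pairwise_comaximal G E'" by blast
    then have "E' \<in> S" using E(1) by (auto simp: S_def)
    then show False using E(2) E'(2) by blast
  qed (use E(1) in \<open>auto simp: S_def\<close>)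
  then show ?thesis using E(1) by (auto simp: S_def)
qed

definition incidence_edges :: "'v hypergraph \<Rightarrow> ('v + 'v set) set set" where
  "incidence_edges H = {{Inl v, Inr e} | v e. v \<in> fst H \<and> e \<in> snd H \<and> v \<in> e}"

lemma incidence_graph_eq: "incidence_graph H = (fst H <+> snd H, incidence_edges H)"
  by (cases H) (simp add: incidence_graph_def incidence_edges_def)

lemma incidence_edges_subset: "e \<in> incidence_edges H \<Longrightarrow> e \<subseteq> fst H <+> snd H"
  by (auto simp: incidence_edges_def)

lemma comaximal_incidence:
  assumes "E \<in> comaximal_hyperedges G" "H \<in> E"
  shows "{Inl H, Inr E} \<in> incidence_edges (comaximal_hypergraph G)"
    and "{Inr E, Inl H} \<in> incidence_edges (comaximal_hypergraph G)"
    and "Inl H \<in> fst (comaximal_hypergraph G) <+> snd (comaximal_hypergraph G)"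
    and "Inr E \<in> fst (comaximal_hypergraph G) <+> snd (comaximal_hypergraph G)"
  using assms comaximal_hyperedge_subset[OF assms(1)]
  by (auto simp: incidence_edges_def comaximal_hypergraph_def insert_commute)

text \<open>\<open>L i\<close> and \<open>R j\<close> are joined through a hyperedge that contains
  the clique \<open>Q i j\<close>. The cliques of two different pairs never fit into a common
  clique, so these hyperedges differ and can subdivide the edges. \<open>Q i j\<close> may exceed
  \<open>{L i, R j}\<close> in order to achieve this.\<close>

lemma comaximal_complete_bipartite_bound:
  fixes f :: "'p \<Rightarrow> 'b::{complete_space,real_normed_vector}" and L R :: "nat \<Rightarrow> 'a set"
    and G :: "('a, 'c) monoid_scheme"
  assumes X: "bipartite_bounded_surface X f" and emb: "embeddable_in X (incidence_graph (comaximal_hypergraph G))"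
    and fin: "finite (carrier G)"
    and inj: "inj_on L {..<a}" "inj_on R {..<b}" and LR: "\<And>i j. i < a \<Longrightarrow> j < b \<Longrightarrow> L i \<noteq> R j"
    and Q: "\<And>i j. i < a \<Longrightarrow> j < b \<Longrightarrow> Q i j \<subseteq> nontrivial_proper_subgroups G \<and> pairwise_comaximal G (Q i j) \<and> {L i, R j} \<subseteq> Q i j"
    and incompatible: "\<And>i j i' j'. i < a \<Longrightarrow> j < b \<Longrightarrow> i' < a \<Longrightarrow> j' < b \<Longrightarrow> (i, j) \<noteq> (i', j') \<Longrightarrow>
        \<exists>H\<in>Q i j. \<exists>K\<in>Q i' j'. H \<noteq> K \<and> H <#>\<^bsub>G\<^esub> K \<noteq> carrier G"
  shows "a * b \<le> 2 * (a + b)"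
proof -
  have "\<exists>E\<in>comaximal_hyperedges G. Q i j \<subseteq> E" if "i < a" "j < b" for i j
    using Q[OF that] LR[OF that] by (intro clique_extends_to_hyperedge fin) auto
  then obtain h where h: "\<And>i j. i < a \<Longrightarrow> j < b \<Longrightarrow> h i j \<in> comaximal_hyperedges G \<and> Q i j \<subseteq> h i j"
    by metis
  have h_inj: "h i j \<noteq> h i' j'" if ij: "i < a" "j < b" "i' < a" "j' < b" "(i, j) \<noteq> (i', j')" for i j i' j'
  proof -
    obtain H K where "H \<in> Q i j" "K \<in> Q i' j'" "H \<noteq> K" "H <#>\<^bsub>G\<^esub> K \<noteq> carrier G"
      using incompatible[OF ij] by blast
    then show ?thesis
      using h[OF ij(1,2)] h[OF ij(3,4)] pairwise_comaximal_hyperedgeD[of "h i j" G H K] by auto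
  qed
  let ?w = "\<lambda>i j. [Inl (L i), Inr (h i j), Inl (R j)]"
  show ?thesis
  proof (rule subdivided_complete_bipartite_bound[OF X emb[unfolded incidence_graph_eq] incidence_edges_subset,
        where l = "\<lambda>i. Inl (L i)" and r = "\<lambda>j. Inl (R j)" and w = ?w])
    show "inj_on (\<lambda>i. Inl (L i)) {..<a}" "inj_on (\<lambda>j. Inl (R j)) {..<b}"
      using inj by (auto simp: inj_on_def)
    show "(\<lambda>i. Inl (L i)) ` {..<a} \<inter> (\<lambda>j. Inl (R j)) ` {..<b} = {}" using LR by auto
    fix i j assume ij: "i < a" "j < b"
    have mem: "h i j \<in> comaximal_hyperedges G" "L i \<in> h i j" "R j \<in> h i j" using h[OF ij] Q[OF ij] by auto
    show "?w i j \<noteq> [] \<and> hd (?w i j) = Inl (L i) \<and> last (?w i j) = Inl (R j) \<and>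
        set (?w i j) \<subseteq> fst (comaximal_hypergraph G) <+> snd (comaximal_hypergraph G) \<and>
        successively (\<lambda>x y. {x, y} \<in> incidence_edges (comaximal_hypergraph G)) (?w i j)"
      using comaximal_incidence[OF mem(1,2)] comaximal_incidence[OF mem(1,3)] by simp
    show "set (?w i j) \<inter> ((\<lambda>i. Inl (L i)) ` {..<a} \<union> (\<lambda>j. Inl (R j)) ` {..<b}) \<subseteq> {Inl (L i), Inl (R j)}"
      by auto
    fix i' j' assume "i' < a" "j' < b" "(i, j) \<noteq> (i', j')"
    then have "h i j \<noteq> h i' j'" using h_inj ij by blast
    then show "set (?w i j) \<inter> set (?w i' j') \<subseteq> (\<lambda>i. Inl (L i)) ` {..<a} \<union> (\<lambda>j. Inl (R j)) ` {..<b}"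
      using ij by auto
  qed
qed

lemma bex_pairI: "x \<in> A \<Longrightarrow> y \<in> B \<Longrightarrow> x \<noteq> y \<Longrightarrow> P x y \<Longrightarrow> \<exists>x\<in>A. \<exists>y\<in>B. x \<noteq> y \<and> P x y"
  by blast

lemma pairwise_insert_ball:
  "pairwise P (insert a Q) \<longleftrightarrow> pairwise P Q \<and> (\<forall>b\<in>Q. a \<noteq> b \<longrightarrow> P a b \<and> P b a)"
  unfolding pairwise_insert by auto

context dihedral_coordinates
begin

lemma finite_carrier: "finite (carrier G)"
proof -
  have "k mod int n \<in> {0..<int n}" "rot k = rot (k mod int n)" "ref k = ref (k mod int n)" for k
    using n_pos by (simp_all add: rot_eq_iff ref_eq_iff minus_mod_eq_mult_div)
  then have "carrier G \<subseteq> rot ` {0..<int n} \<union> ref ` {0..<int n}"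
    unfolding carrier_eq by blast
  then show ?thesis by (rule finite_subset) auto
qed

lemma pairwise_comaximal_insert:
  "pairwise_comaximal G (insert H Q) \<longleftrightarrow>
     pairwise_comaximal G Q \<and> (\<forall>K\<in>Q. H \<noteq> K \<longrightarrow> H <#> K = carrier G \<and> K <#> H = carrier G)"
proof -
  have "pairwise_comaximal G Q \<longleftrightarrow> pairwise (\<lambda>H K. H <#> K = carrier G) Q" for Q
    by (simp add: pairwise_comaximal_def pairwise_def)
  then show ?thesis by (simp only: pairwise_insert_ball)
qed

lemma pairwise_comaximal_empty: "pairwise_comaximal G {}"
  by (simp add: pairwise_comaximal_def)

lemmas comaximal_simps = comaximal_rotations_rotations comaximal_rotations_dihedrals
  comaximal_dihedrals_dihedrals pairwise_comaximal_insert pairwise_comaximal_empty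

lemma not_comaximal_same_dihedrals:
  assumes "d dvd int n" "d > 2"
  shows "dihedrals d i <#> dihedrals d j \<noteq> carrier G"
  using assms by (auto simp: comaximal_dihedrals_dihedrals)

lemma dihedrals_inject_less:
  assumes "int m dvd int n" "i < m" "j < m"
  shows "dihedrals (int m) (int i) = dihedrals (int m) (int j) \<longleftrightarrow> i = j"
proof -
  have "int m dvd int i - int j \<longleftrightarrow> i = j"
    using assms(2,3) by (metis mod_eq_dvd_iff mod_pos_pos_trivial of_nat_0_le_iff of_nat_eq_iff of_nat_less_iff)
  then show ?thesis using assms by (simp add: dihedrals_eq_iff)
qed

text \<open>Parts of sizes 4 and 5. The parameters \<open>q\<close> and \<open>m\<close> are
  coprime, so the two sides are completely comaximal to each other, while within a side the gcd
  exceeds 2 and nothing is comaximal. For \<open>q = 3\<close> there are only three subgroups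
  \<open>dihedrals q i\<close>, so \<open>rotations q\<close> serves as the fourth.\<close>

lemma not_embeddable_coprime_factors:
  fixes f :: "'p \<Rightarrow> 'e::{complete_space,real_normed_vector}"
  assumes X: "bipartite_bounded_surface X f" and nqm: "n = q * m" "coprime q m" "q \<ge> 3" "m \<ge> 5"
  shows "\<not> embeddable_in X (incidence_graph (comaximal_hypergraph G))"
proof
  assume emb: "embeddable_in X (incidence_graph (comaximal_hypergraph G))"
  define L where "L i = (if i < 3 then dihedrals (int q) (int i) else rotations (int q))" for i :: nat
  define R where "R j = dihedrals (int m) (int j)" for j :: nat
  have dvd: "int q dvd int n" "int m dvd int n" using nqm by auto
  have cop: "coprime (int q) (int m)" "coprime (int m) (int q)" using nqm(2) by (auto simp: coprime_commute)
  have "q \<noteq> m" using nqm by auto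
  have "int q < int n" using nqm by simp
  have noL: "L i <#> L i' \<noteq> carrier G" for i i'
    using dvd nqm(3) not_comaximal_same_dihedrals[OF dvd(1)]
    by (auto simp: L_def comaximal_simps)
  have injL: "i = i'" if "L i = L i'" "i < 4" "i' < 4" for i i'
    using that dihedrals_inject_less[OF dvd(1), of i i'] nqm(3) by (auto simp: L_def split: if_splits)
  have injR: "j = j'" if "R j = R j'" "j < 5" "j' < 5" for j j'
    using that dihedrals_inject_less[OF dvd(2), of j j'] nqm(4) by (auto simp: R_def)
  have LR: "L i \<noteq> R j" "L i <#> R j = carrier G" "R j <#> L i = carrier G" for i j
    using dvd cop nqm \<open>q \<noteq> m\<close> by (auto simp: L_def R_def comaximal_simps dihedrals_eq_iff)
  have nt: "L i \<in> nontrivial_proper_subgroups G" "R j \<in> nontrivial_proper_subgroups G" for i j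
    using dvd nqm \<open>int q < int n\<close> by (auto simp: L_def R_def intro!: dihedrals_nontrivial rotations_nontrivial)
  have "(4::nat) * 5 \<le> 2 * (4 + 5)"
  proof (rule comaximal_complete_bipartite_bound[OF X emb finite_carrier, where L = L and R = R and Q = "\<lambda>i j. {L i, R j}"])
    show "inj_on L {..<4}" "inj_on R {..<5}" using injL injR by (auto simp: inj_on_def)
    fix i j :: nat assume ij: "i < 4" "j < 5"
    show "L i \<noteq> R j" by (rule LR)
    show "{L i, R j} \<subseteq> nontrivial_proper_subgroups G \<and> pairwise_comaximal G {L i, R j} \<and> {L i, R j} \<subseteq> {L i, R j}"
      using nt LR by (simp add: comaximal_simps)
    fix i' j' :: nat assume ij': "i' < 4" "j' < 5" "(i, j) \<noteq> (i', j')"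
    show "\<exists>H\<in>{L i, R j}. \<exists>K\<in>{L i', R j'}. H \<noteq> K \<and> H <#> K \<noteq> carrier G"
    proof (cases "j = j'")
      case True
      then have "L i \<noteq> L i'" using ij ij' injL by blast
      then show ?thesis by (rule bex_pairI[rotated 2]) (simp_all add: noL)
    next
      case False
      then have "R j \<noteq> R j'" using ij ij' injR by blast
      moreover have "R j <#> R j' \<noteq> carrier G"
        using not_comaximal_same_dihedrals[OF dvd(2)] nqm(4) by (simp add: R_def)
      ultimately show ?thesis by (rule bex_pairI[rotated 2]) simp_all
    qed
  qed
  then show False by simp
qed

text \<open>If 2 divides \<open>n\<close> only once, the parameter 2 is left for the smaller side,
  and the two subgroups \<open>dihedrals 2 i\<close> are comaximal to each other. Instead the clique
  \<open>A\<close> of three subgroups is extended by five pairwise incompatible \<open>M j\<close>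
  to five hyperedges \<open>h j\<close>, which form one side. \<open>A\<close> gives three vertices
  of the other side, and \<open>rotations 2\<close> is the fourth, reaching \<open>h j\<close> by
  way of \<open>p j\<close> and \<open>M j\<close>.\<close>

lemma not_embeddable_even:
  fixes f :: "'p \<Rightarrow> 'e::{complete_space,real_normed_vector}"
  assumes X: "bipartite_bounded_surface X f" and nm: "even n" "m dvd n" "odd m" "m \<ge> 5"
  shows "\<not> embeddable_in X (incidence_graph (comaximal_hypergraph G))"
proof
  assume emb: "embeddable_in X (incidence_graph (comaximal_hypergraph G))"
  have dvd: "2 dvd int n" "int m dvd int n" "1 dvd int n" using nm by auto
  have "m \<le> n" using nm(2) n_pos by (simp add: dvd_imp_le)
  then have n_gt: "int n > 2" using nm(4) by simp
  have cop: "coprime 2 (int m)" "coprime (int m) 2" using nm(3) by (auto simp: coprime_commute)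
  define M where "M j = dihedrals (int m) (int j)" for j :: nat
  define A where "A = {rotations 1, dihedrals 2 0, dihedrals 2 1}"
  have M: "M j \<in> nontrivial_proper_subgroups G" for j
    using dvd nm by (auto simp: M_def intro!: dihedrals_nontrivial)
  have A: "A \<subseteq> nontrivial_proper_subgroups G" and R2: "rotations 2 \<in> nontrivial_proper_subgroups G"
    using dvd n_gt by (auto simp: A_def intro!: dihedrals_nontrivial rotations_nontrivial)
  have neq: "M j \<noteq> rotations d" "M j \<notin> A" "rotations 2 \<notin> A" "rotations 1 \<noteq> rotations 2" for j d
    using dvd nm by (auto simp: M_def A_def dihedrals_eq_iff rotations_eq_iff)
  have "\<exists>E\<in>comaximal_hyperedges G. insert (M j) A \<subseteq> E" for j
  proof (rule clique_extends_to_hyperedge[OF finite_carrier])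
    show "pairwise_comaximal G (insert (M j) A)"
      using dvd cop by (simp add: A_def M_def comaximal_simps)
    show "insert (M j) A \<noteq> {H}" for H using neq(2)[of j] by (auto simp: A_def)
  qed (use M A in auto)
  then obtain h where h: "\<And>j. h j \<in> comaximal_hyperedges G" "\<And>j. insert (M j) A \<subseteq> h j" by metis
  have "\<exists>E\<in>comaximal_hyperedges G. {rotations 2, M j} \<subseteq> E" for j
  proof (rule clique_extends_to_hyperedge[OF finite_carrier])
    show "pairwise_comaximal G {rotations 2, M j}"
      using dvd cop by (simp add: M_def comaximal_simps)
    show "{rotations 2, M j} \<noteq> {H}" for H using neq(1)[of j 2] by auto
  qed (use M R2 in auto)
  then obtain p where p: "\<And>j. p j \<in> comaximal_hyperedges G" "\<And>j. {rotations 2, M j} \<subseteq> p j" by metis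
  have Mneq: "M i \<noteq> M j" if "i \<noteq> j" "i < 5" "j < 5" for i j
    using that dihedrals_inject_less[OF dvd(2), of i j] nm by (auto simp: M_def)
  have Mno: "M i <#> M j \<noteq> carrier G" for i j
    using not_comaximal_same_dihedrals[OF dvd(2)] nm by (simp add: M_def)
  have hneq: "h i \<noteq> h j" and pneq: "p i \<noteq> p j" if "i \<noteq> j" "i < 5" "j < 5" for i j
    using Mneq[OF that] Mno[of i j] h(2)[of i] h(2)[of j] p(2)[of i] p(2)[of j]
      pairwise_comaximal_hyperedgeD[OF h(1)[of i], of "M i" "M j"] pairwise_comaximal_hyperedgeD[OF p(1)[of i], of "M i" "M j"]
    by auto
  have hp: "h i \<noteq> p j" for i j
  proof
    assume "h i = p j"
    then have "rotations 1 \<in> h i" "rotations 2 \<in> h i" using h(2)[of i] p(2)[of j] by (auto simp: A_def)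
    then show False
      using pairwise_comaximal_hyperedgeD[OF h(1)[of i] _ _ neq(4)] comaximal_rotations_rotations by metis
  qed
  define L where "L i = [rotations 1, dihedrals 2 0, dihedrals 2 1, rotations 2] ! i" for i :: nat
  have LA: "L i \<in> A" if "i < 3" for i
    using that by (auto simp: L_def A_def numeral_3_eq_3 less_Suc_eq)
  have L3: "L 3 = rotations 2" by (simp add: L_def numeral_3_eq_3)
  have distL: "distinct [rotations 1, dihedrals 2 0, dihedrals 2 1, rotations 2]"
    using dvd by (simp add: dihedrals_eq_iff rotations_eq_iff)
  have injL: "inj_on L {..<4}"
  proof -
    have "L = (!) [rotations 1, dihedrals 2 0, dihedrals 2 1, rotations 2]" by (simp add: L_def fun_eq_iff)
    then show ?thesis using inj_on_nth[OF distL, of "{..<4}"] by simp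
  qed
  have LM: "L i \<noteq> M j" if "i < 4" for i j
    using LA[of i] L3 neq(1,2)[of j] that by (cases "i < 3") (auto simp: less_Suc_eq numeral_eq_Suc)
  define w where "w i j = (if i < 3 then [Inl (L i), Inr (h j)] else [Inl (L 3), Inr (p j), Inl (M j), Inr (h j)])" for i j :: nat
  have "(4::nat) * 5 \<le> 2 * (4 + 5)"
  proof (rule subdivided_complete_bipartite_bound[OF X emb[unfolded incidence_graph_eq] incidence_edges_subset,
        where l = "\<lambda>i. Inl (L i)" and r = "\<lambda>j. Inr (h j)" and w = w])
    show "inj_on (\<lambda>i. Inl (L i)) {..<4}" "inj_on (\<lambda>j. Inr (h j)) {..<5}"
      using injL hneq by (auto simp: inj_on_def)
    show "(\<lambda>i. Inl (L i)) ` {..<4} \<inter> (\<lambda>j. Inr (h j)) ` {..<5} = {}" by auto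
    fix i j :: nat assume ij: "i < 4" "j < 5"
    have hM: "M j \<in> h j" "rotations 2 \<in> p j" "M j \<in> p j" and hL: "i < 3 \<Longrightarrow> L i \<in> h j"
      using h(2)[of j] p(2)[of j] LA by auto
    have i3: "\<not> i < 3 \<Longrightarrow> i = 3" using ij by simp
    show "w i j \<noteq> [] \<and> hd (w i j) = Inl (L i) \<and> last (w i j) = Inr (h j) \<and>
        set (w i j) \<subseteq> fst (comaximal_hypergraph G) <+> snd (comaximal_hypergraph G) \<and>
        successively (\<lambda>x y. {x, y} \<in> incidence_edges (comaximal_hypergraph G)) (w i j)"
      using comaximal_incidence[OF h(1) hL] comaximal_incidence[OF h(1) hM(1)] comaximal_incidence[OF p(1) hM(2)]
        comaximal_incidence[OF p(1) hM(3)] i3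
      by (cases "i < 3") (simp_all add: w_def L3)
    show "set (w i j) \<inter> ((\<lambda>i. Inl (L i)) ` {..<4} \<union> (\<lambda>j. Inr (h j)) ` {..<5}) \<subseteq> {Inl (L i), Inr (h j)}"
    proof (cases "i < 3")
      case False
      have "Inl (M j) \<notin> (\<lambda>i. Inl (L i)) ` {..<4}" using LM by (auto dest: sym)
      moreover have "Inr (p j) \<notin> (\<lambda>j. Inr (h j)) ` {..<5}" using hp by (auto dest: sym)
      ultimately show ?thesis using i3[OF False] by (auto simp: w_def)
    qed (auto simp: w_def)
    fix i' j' :: nat assume ij': "i' < 4" "j' < 5" "(i, j) \<noteq> (i', j')"
    have i3': "\<not> i' < 3 \<Longrightarrow> i' = 3" using ij' by simp
    have Mp: "p j \<noteq> p j'" "M j \<noteq> M j'" if "\<not> i < 3" "\<not> i' < 3"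
      using that i3 i3' ij ij' pneq[of j j'] Mneq[of j j'] by auto
    have "set (w i j) \<subseteq> {Inl (L i), Inr (h j)} \<union> (if i < 3 then {} else {Inr (p j), Inl (M j)})"
      "set (w i' j') \<subseteq> {Inl (L i'), Inr (h j')} \<union> (if i' < 3 then {} else {Inr (p j'), Inl (M j')})"
      using i3 i3' by (auto simp: w_def)
    moreover have "Inl (L i) \<notin> {Inr (p j'), Inl (M j')}" "Inr (h j) \<notin> {Inr (p j'), Inl (M j')}"
      using LM[OF ij(1), of j'] hp by auto
    moreover have "Inl (L i') \<notin> {Inr (p j), Inl (M j)}" "Inr (h j') \<notin> {Inr (p j), Inl (M j)}"
      using LM[OF ij'(1), of j] hp by auto
    moreover have "{Inr (p j), Inl (M j)} \<inter> {Inr (p j'), Inl (M j')} = {}" if "\<not> i < 3" "\<not> i' < 3"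
      using Mp[OF that] by auto
    ultimately have "set (w i j) \<inter> set (w i' j') \<subseteq> {Inl (L i), Inr (h j)}"
      by (cases "i < 3"; cases "i' < 3"; simp) blast+
    then show "set (w i j) \<inter> set (w i' j') \<subseteq> (\<lambda>i. Inl (L i)) ` {..<4} \<union> (\<lambda>j. Inr (h j)) ` {..<5}"
      using ij by auto
  qed
  then show False by simp
qed

text \<open>Parts of sizes 7 and 3: the three \<open>dihedrals 3 j\<close> against
  \<open>rotations\<close> with parameters 1, 2, 4 and the four \<open>dihedrals 4 k\<close>. The
  only comaximal pairs among the seven consist of \<open>rotations 1\<close> and a
  \<open>dihedrals 4 k\<close>, and larger cliques repair this.\<close>

lemma not_embeddable_twelve:
  fixes f :: "'p \<Rightarrow> 'e::{complete_space,real_normed_vector}"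
  assumes X: "bipartite_bounded_surface X f" and n12: "12 dvd n"
  shows "\<not> embeddable_in X (incidence_graph (comaximal_hypergraph G))"
proof
  assume emb: "embeddable_in X (incidence_graph (comaximal_hypergraph G))"
  have "12 dvd int n" using n12 by presburger
  then have dvd: "2 dvd int n" "3 dvd int n" "4 dvd int n" by presburger+
  have n_gt: "int n > 4" using n12 n_pos by (auto dest!: dvd_imp_le)
  define L where "L i = (if i < 3 then rotations (2 ^ i) else dihedrals 4 (int i - 3))" for i :: nat
  define R where "R j = dihedrals 3 (int j)" for j :: nat
  \<comment> \<open>\<open>rotations 1\<close>, \<open>dihedrals 4 k\<close> and \<open>R j\<close>
    form a clique, so a hyperedge through the first and the last could contain all three. Of the
    added \<open>dihedrals 2 0\<close> and \<open>dihedrals 2 1\<close>, the one with the parity of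
    \<open>k\<close> is not comaximal to \<open>dihedrals 4 k\<close> and keeps it out.\<close>
  define Q where "Q i j = (if i = 0 then {L 0, R j, dihedrals 2 0, dihedrals 2 1} else {L i, R j})" for i j :: nat
  have pow: "(2::int) ^ i dvd int n" "(2::int) ^ i < int n" if "i < 3" for i :: nat
  proof -
    have "i \<le> 2" using that by simp
    then have "(2::int) ^ i dvd 2 ^ 2" "(2::int) ^ i \<le> 2 ^ 2" by (rule le_imp_power_dvd, rule power_increasing) simp
    then have "(2::int) ^ i dvd 4" "(2::int) ^ i \<le> 4" by simp_all
    then show "(2::int) ^ i dvd int n" "(2::int) ^ i < int n"
      using dvd_trans[OF _ dvd(3)] le_less_trans[OF _ n_gt] by blast+
  qed
  have cop: "coprime ((2::int) ^ i) 3" "coprime 3 ((2::int) ^ i)" "coprime (4::int) 3" "coprime (3::int) 4"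
      "coprime (2::int) 3" "coprime (3::int) 2" for i :: nat
  proof -
    have "coprime (2::int) 3" "coprime (2 ^ 2 :: int) 3" by (simp_all add: coprime_iff_gcd_eq_1 gcd_non_0_int)
    then show "coprime ((2::int) ^ i) 3" "coprime 3 ((2::int) ^ i)" "coprime (4::int) 3" "coprime (3::int) 4"
      "coprime (2::int) 3" "coprime (3::int) 2" by (simp_all add: coprime_commute)
  qed
  have nt: "L i \<in> nontrivial_proper_subgroups G" for i
    using dvd pow[of i] by (auto simp: L_def intro!: dihedrals_nontrivial rotations_nontrivial)
  have ntR: "R j \<in> nontrivial_proper_subgroups G" "dihedrals 2 k \<in> nontrivial_proper_subgroups G" for j k
    using dvd by (auto simp: R_def intro!: dihedrals_nontrivial)
  have LR: "L i \<noteq> R j" "L i <#> R j = carrier G" "R j <#> L i = carrier G" for i j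
    using dvd pow[of i] cop
    by (simp_all add: L_def R_def comaximal_rotations_dihedrals comaximal_dihedrals_dihedrals dihedrals_eq_iff)
  have injR: "j = j'" if "R j = R j'" "j < 3" "j' < 3" for j j'
    using that dihedrals_inject_less[of 3 j j'] dvd(2) by (simp add: R_def)
  have ncop: "\<not> coprime ((2::int) ^ i) 4" if "0 < i" for i :: nat
    using that by (intro not_coprimeI[of 2]) (auto intro: dvd_power)
  have LL1: "L i \<noteq> L i'" if "i < 7" "i' < 7" "i \<noteq> i'" for i i'
  proof -
    have "\<not> 4 dvd int i - int i'" if "3 \<le> i" "3 \<le> i'" using \<open>i < 7\<close> \<open>i' < 7\<close> \<open>i \<noteq> i'\<close> that by presburger
    then show ?thesis
      using that dvd pow[of i] pow[of i'] by (auto simp: L_def rotations_eq_iff dihedrals_eq_iff)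
  qed
  have LL2: "L i <#> L i' \<noteq> carrier G" if "0 < i" "0 < i'" for i i'
    using that dvd pow[of i] pow[of i'] ncop
    by (simp add: L_def comaximal_rotations_rotations comaximal_rotations_dihedrals not_comaximal_same_dihedrals)
  have zero: "\<exists>H\<in>Q 0 j. H \<noteq> L i \<and> H <#> L i \<noteq> carrier G \<and> L i <#> H \<noteq> carrier G" if "i < 7" "i \<noteq> 0" for i j
  proof (cases "i < 3")
    case True
    then show ?thesis
      using LL1[of 0 i] that by (intro bexI[of _ "L 0"]) (simp_all add: L_def Q_def comaximal_rotations_rotations)
  next
    case False
    define e where "e = (if even (int i - 3) then 0 else 1 :: int)"
    have "gcd (2::int) 4 = 2" "gcd (4::int) 2 = 2" by (simp_all add: gcd_non_0_int)
    moreover have "\<not> coprime (2::int) 4" "\<not> coprime (4::int) 2" by (simp_all add: coprime_iff_gcd_eq_1 gcd_non_0_int)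
    moreover have "even (e - (int i - 3))" "even ((int i - 3) - e)" by (auto simp: e_def)
    ultimately have "dihedrals 2 e \<noteq> L i \<and> dihedrals 2 e <#> L i \<noteq> carrier G \<and> L i <#> dihedrals 2 e \<noteq> carrier G"
      using dvd False by (simp add: L_def comaximal_dihedrals_dihedrals dihedrals_eq_iff)
    then show ?thesis by (intro bexI[of _ "dihedrals 2 e"]) (simp_all add: Q_def e_def)
  qed
  have "(7::nat) * 3 \<le> 2 * (7 + 3)"
  proof (rule comaximal_complete_bipartite_bound[OF X emb finite_carrier, where L = L and R = R and Q = Q])
    show "inj_on L {..<7}" "inj_on R {..<3}" using LL1 injR unfolding inj_on_def by blast+
    fix i j :: nat assume ij: "i < 7" "j < 3"
    show "L i \<noteq> R j" by (rule LR)
    show "Q i j \<subseteq> nontrivial_proper_subgroups G \<and> pairwise_comaximal G (Q i j) \<and> {L i, R j} \<subseteq> Q i j"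
    proof (cases "i = 0")
      case True
      have "pairwise_comaximal G {rotations 1, dihedrals 3 (int j), dihedrals 2 0, dihedrals 2 1}"
        using dvd cop by (simp add: comaximal_simps)
      moreover have "rotations 1 \<in> nontrivial_proper_subgroups G" using nt[of 0] by (simp add: L_def)
      ultimately show ?thesis using True ntR by (simp add: Q_def L_def R_def)
    next
      case False
      then show ?thesis using nt ntR LR by (simp add: Q_def comaximal_simps)
    qed
    fix i' j' :: nat assume ij': "i' < 7" "j' < 3" "(i, j) \<noteq> (i', j')"
    have mem: "L i \<in> Q i j" "R j \<in> Q i j" "L i' \<in> Q i' j'" "R j' \<in> Q i' j'" by (auto simp: Q_def)
    show "\<exists>H\<in>Q i j. \<exists>K\<in>Q i' j'. H \<noteq> K \<and> H <#> K \<noteq> carrier G"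
    proof (cases "j = j'")
      case False
      then have "R j \<noteq> R j'" using ij ij' injR by blast
      moreover have "R j <#> R j' \<noteq> carrier G"
        using not_comaximal_same_dihedrals[OF dvd(2)] by (simp add: R_def)
      ultimately show ?thesis by (rule bex_pairI[OF mem(2,4)])
    next
      case True
      then have "i \<noteq> i'" using ij' by simp
      then consider "0 < i" "0 < i'" | "i = 0" "i' \<noteq> 0" | "i' = 0" "i \<noteq> 0" by linarith
      then show ?thesis
      proof cases
        case 1
        then show ?thesis
          by (intro bex_pairI[OF mem(1,3)] LL1[OF ij(1) ij'(1) \<open>i \<noteq> i'\<close>] LL2)
      next
        case 2
        then obtain H where "H \<in> Q 0 j" "H \<noteq> L i'" "H <#> L i' \<noteq> carrier G" using zero[OF ij'(1), of j] by metis
        then show ?thesis using 2(1) by (intro bex_pairI[OF _ mem(3)]) simp_all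
      next
        case 3
        then obtain H where "H \<in> Q 0 j'" "L i \<noteq> H" "L i <#> H \<noteq> carrier G" using zero[OF ij(1), of j'] by metis
        then show ?thesis using 3(1) by (intro bex_pairI[OF mem(1)]) simp_all
      qed
    qed
  qed
  then show False by simp
qed

end

text \<open>An odd \<open>n\<close> splits into two coprime odd factors that are at least 3 and not
  both 3. For even \<open>n\<close> the odd part is at least 5, or it is 3 and then excluding 6
  forces a factor 4.\<close>

lemma not_primepow_cases:
  fixes n :: nat
  assumes "n \<ge> 2" "\<not> primepow n" "n \<noteq> 6"
  obtains q m where "n = q * m" "coprime q m" "q \<ge> 3" "m \<ge> 5"
    | m where "even n" "m dvd n" "odd m" "m \<ge> 5"
    | "12 dvd n"
proof -
  obtain p where p: "prime p" "p dvd n" using assms(1) prime_factor_nat[of n] by auto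
  have split: "\<exists>k m. n = p ^ k * m \<and> k > 0 \<and> coprime p m \<and> m > 1" if p: "prime p" "p dvd n" for p
  proof -
    have "n \<noteq> 0" "\<not> is_unit p" using assms(1) p by auto
    then obtain m where m: "n = p ^ multiplicity p n * m" "\<not> p dvd m"
      using multiplicity_decompose'[of n p] by metis
    have k: "multiplicity p n > 0" using p \<open>n \<noteq> 0\<close> by (simp add: prime_multiplicity_gt_zero_iff)
    have "m \<noteq> 0" using m \<open>n \<noteq> 0\<close> by (metis mult_0_right)
    moreover have "m \<noteq> 1" using m k assms(2) p by (metis mult.right_neutral primepow_prime_power)
    moreover have "coprime p m" using m(2) p(1) by (simp add: prime_imp_coprime)
    ultimately show ?thesis using m(1) k by (intro exI[of _ "multiplicity p n"] exI[of _ m]) auto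
  qed
  show thesis
  proof (cases "even n")
    case True
    then obtain k m where km: "n = 2 ^ k * m" "k > 0" "coprime 2 m" "m > 1" using split[of 2] by auto
    then have "odd m" by simp
    show thesis
    proof (cases "m = 3")
      case True
      then have "k \<ge> 2" using km assms(3) by (cases k; cases "k - 1") auto
      then have "(2::nat) ^ 2 dvd 2 ^ k" by (rule le_imp_power_dvd)
      then have "2 ^ 2 * 3 dvd 2 ^ k * (3::nat)" by (rule mult_dvd_mono) simp
      then show thesis using that(3) km True by simp
    next
      case False
      then have "m \<ge> 5" using km(4) \<open>odd m\<close> by presburger
      then show thesis using that(2)[of m] True km \<open>odd m\<close> by simp
    qed
  next
    case False
    obtain k m where km: "n = p ^ k * m" "k > 0" "coprime p m" "m > 1" using split[OF p] by auto
    let ?q = "p ^ k"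
    have odd: "odd ?q" "odd m" using False km(1) by auto
    have cop: "coprime ?q m" using km(3) by simp
    have "?q > 1" using p(1) km(2) by (intro one_less_power prime_gt_1_nat)
    then have ge: "?q \<ge> 3" "m \<ge> 3" using odd km(4) by presburger+
    show thesis
    proof (cases "m = 3")
      case True
      have "\<not> coprime (3::nat) 3" by simp
      then have "?q \<noteq> 3" using cop True by metis
      then have "?q \<ge> 5" using ge odd by presburger
      then show thesis using that(1)[of m ?q] km(1) cop ge by (simp add: mult.commute coprime_commute)
    next
      case False
      then have "m \<ge> 5" using ge odd by presburger
      then show thesis using that(1)[of ?q m] km(1) cop ge by simp
    qed
  qed
qed

lemma (in dihedral_coordinates) not_embeddable:
  fixes f :: "'p \<Rightarrow> 'e::{complete_space,real_normed_vector}"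
  assumes "bipartite_bounded_surface X f" and "n \<ge> 2" "\<not> primepow n" "n \<noteq> 6"
  shows "\<not> embeddable_in X (incidence_graph (comaximal_hypergraph G))"
  using assms(2-4)
proof (cases rule: not_primepow_cases)
  case (1 q m) then show ?thesis using not_embeddable_coprime_factors[OF assms(1)] by blast
next
  case (2 m) then show ?thesis using not_embeddable_even[OF assms(1)] by blast
next
  case 3 then show ?thesis using not_embeddable_twelve[OF assms(1)] by blast
qed

section \<open>Straight-line drawings\<close>

lemma embeddable_in_mono:
  fixes X :: "'p topology" and W :: "'w set"
  assumes emb: "embeddable_in X (W, F)" and f: "inj_on f V" "f ` V \<subseteq> W"
    and E: "\<And>e. e \<in> E \<Longrightarrow> e \<subseteq> V \<and> f ` e \<in> F"
  shows "embeddable_in X (V, E)"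
proof -
  from emb obtain \<phi> and \<gamma> :: "'w set \<Rightarrow> real \<Rightarrow> 'p" where \<phi>: "inj_on \<phi> W" "\<phi> ` W \<subseteq> topspace X"
    and 1: "\<And>e. e \<in> F \<Longrightarrow> embedding_map (top_of_set {0..1}) X (\<gamma> e) \<and> {\<gamma> e 0, \<gamma> e 1} = \<phi> ` e \<and>
                \<gamma> e ` {0<..<1} \<inter> \<phi> ` W = {}"
    and 2: "\<And>e e'. e \<in> F \<Longrightarrow> e' \<in> F \<Longrightarrow> e \<noteq> e' \<Longrightarrow> \<gamma> e ` {0<..<1} \<inter> \<gamma> e' ` {0<..<1} = {}"
    unfolding embeddable_in_def prod.case by metis
  have "inj_on (\<phi> \<circ> f) V" using f \<phi>(1) by (meson comp_inj_on inj_on_subset)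
  moreover have "(\<phi> \<circ> f) ` V \<subseteq> topspace X" using f(2) \<phi>(2) by auto
  moreover have "embedding_map (top_of_set {0..1}) X (\<gamma> (f ` e)) \<and> {\<gamma> (f ` e) 0, \<gamma> (f ` e) 1} = (\<phi> \<circ> f) ` e \<and>
      \<gamma> (f ` e) ` {0<..<1} \<inter> (\<phi> \<circ> f) ` V = {}" if "e \<in> E" for e
  proof -
    have "(\<phi> \<circ> f) ` V \<subseteq> \<phi> ` W" "(\<phi> \<circ> f) ` e = \<phi> ` f ` e" using f(2) by auto
    moreover have "f ` e \<in> F" using E[OF that] by blast
    ultimately show ?thesis using 1[of "f ` e"] by (metis (no_types, lifting) disjoint_iff subsetD)
  qed
  moreover have "\<gamma> (f ` e) ` {0<..<1} \<inter> \<gamma> (f ` e') ` {0<..<1} = {}" if "e \<in> E" "e' \<in> E" "e \<noteq> e'" for e e'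
  proof -
    have "f ` e \<noteq> f ` e'" using inj_on_image_eq_iff[OF f(1)] E that by metis
    then show ?thesis using 2 E that by metis
  qed
  ultimately show ?thesis
    unfolding embeddable_in_def prod.case by (intro exI[of _ "\<phi> \<circ> f"] exI[of _ "\<lambda>e. \<gamma> (f ` e)"]) blast
qed

abbreviation segment_point :: "'c::real_vector \<times> 'c \<Rightarrow> real \<Rightarrow> 'c" where
  "segment_point s u \<equiv> (1 - u) *\<^sub>R fst s + u *\<^sub>R snd s"

text \<open>Edges are images of straight segments under a map \<open>\<Phi>\<close> into the
  surface. The positions \<open>pos\<close> are given apart from the ends of the segments because
  these may be any preimages of a vertex, such as lattice translates or antipodes. Compactness of
  the interval and the Hausdorff property turn the injective paths into embeddings.\<close>

lemma embeddable_in_segments: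
  fixes \<Phi> :: "'c::real_normed_vector \<Rightarrow> 'p" and s :: "'i \<Rightarrow> 'c \<times> 'c"
  assumes X: "Hausdorff_space X" and pos: "inj_on pos V" "pos ` V \<subseteq> topspace X"
    and edge: "inj_on edge I" "\<And>i. i \<in> I \<Longrightarrow> edge i \<subseteq> V \<and> card (edge i) = 2"
    and ends: "\<And>i. i \<in> I \<Longrightarrow> {\<Phi> (fst (s i)), \<Phi> (snd (s i))} = pos ` edge i"
    and cont: "\<And>i. i \<in> I \<Longrightarrow> continuous_map (top_of_set (closed_segment (fst (s i)) (snd (s i)))) X \<Phi>"
    and disjoint: "\<And>i j u w. i \<in> I \<Longrightarrow> j \<in> I \<Longrightarrow> u \<in> {0<..<1} \<Longrightarrow> w \<in> {0<..<1} \<Longrightarrow>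
        \<Phi> (segment_point (s i) u) = \<Phi> (segment_point (s j) w) \<Longrightarrow> i = j \<and> u = w"
    and avoid: "\<And>i v u. i \<in> I \<Longrightarrow> v \<in> V \<Longrightarrow> u \<in> {0<..<1} \<Longrightarrow> \<Phi> (segment_point (s i) u) \<noteq> pos v"
  shows "embeddable_in X (V, edge ` I)"
proof -
  define ix where "ix = inv_into I edge"
  have ix [simp]: "ix (edge i) = i" if "i \<in> I" for i
    using edge(1) that by (simp add: ix_def)
  define \<gamma> where "\<gamma> e u = \<Phi> (segment_point (s (ix e)) u)" for e u
  have emb: "embedding_map (top_of_set {0..1}) X (\<gamma> (edge i)) \<and> {\<gamma> (edge i) 0, \<gamma> (edge i) 1} = pos ` edge i \<and>
      \<gamma> (edge i) ` {0<..<1} \<inter> pos ` V = {}" if i: "i \<in> I" for i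
  proof (intro conjI)
    have g: "\<gamma> (edge i) = \<Phi> \<circ> segment_point (s i)" by (simp add: fun_eq_iff \<gamma>_def i)
    show e: "{\<gamma> (edge i) 0, \<gamma> (edge i) 1} = pos ` edge i" using ends[OF i] by (simp add: \<gamma>_def i)
    show "\<gamma> (edge i) ` {0<..<1} \<inter> pos ` V = {}" using avoid[OF i] by (auto simp: \<gamma>_def i)
    have "continuous_map (top_of_set {0..1}) (top_of_set (closed_segment (fst (s i)) (snd (s i)))) (segment_point (s i))"
      by (auto simp: continuous_map_in_subtopology closed_segment_def intro!: continuous_intros)
    then have "continuous_map (top_of_set {0..1}) X (\<gamma> (edge i))"
      unfolding g using cont[OF i] by (rule continuous_map_compose)
    moreover have "inj_on (\<gamma> (edge i)) {0..1}"
    proof (rule inj_onI)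
      have "card (pos ` edge i) = 2"
        using edge(2)[OF i] pos(1) by (metis card_image inj_on_subset)
      then have "\<gamma> (edge i) 0 \<noteq> \<gamma> (edge i) 1" unfolding e[symmetric] by auto
      moreover have "\<gamma> (edge i) a \<noteq> \<gamma> (edge i) u" if "a = 0 \<or> a = 1" "u \<in> {0<..<1}" for a u
      proof -
        have "\<gamma> (edge i) a \<in> pos ` V" using e edge(2)[OF i] that(1) by blast
        then show ?thesis using avoid[OF i _ that(2)] by (auto simp: \<gamma>_def i)
      qed
      moreover have "u = w" if "u \<in> {0<..<1}" "w \<in> {0<..<1}" "\<gamma> (edge i) u = \<gamma> (edge i) w" for u w
        using disjoint[OF i i that(1,2)] that(3) by (simp add: \<gamma>_def i)
      moreover have "u = 0 \<or> u = 1 \<or> u \<in> {0<..<1}" if "u \<in> {0..1}" for u :: real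
        using that by auto
      ultimately show "u = w" if "u \<in> {0..1}" "w \<in> {0..1}" "\<gamma> (edge i) u = \<gamma> (edge i) w" for u w
        using that by metis
    qed
    ultimately show "embedding_map (top_of_set {0..1}) X (\<gamma> (edge i))"
      using X by (intro continuous_imp_embedding_map) (auto simp: compact_space_subtopology)
  qed
  have "\<gamma> e ` {0<..<1} \<inter> \<gamma> e' ` {0<..<1} = {}" if ee: "e \<in> edge ` I" "e' \<in> edge ` I" "e \<noteq> e'" for e e'
  proof -
    obtain i j where ij: "i \<in> I" "j \<in> I" "e = edge i" "e' = edge j" using ee by blast
    then have "i \<noteq> j" using ee(3) by blast
    have "\<gamma> e u \<noteq> \<gamma> e' w" if "u \<in> {0<..<1}" "w \<in> {0<..<1}" for u w
      using disjoint[OF ij(1,2) that] \<open>i \<noteq> j\<close> ij unfolding \<gamma>_def by auto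
    then show ?thesis by blast
  qed
  then have dis: "\<forall>e\<in>edge ` I. \<forall>e'\<in>edge ` I. e \<noteq> e' \<longrightarrow> \<gamma> e ` {0<..<1} \<inter> \<gamma> e' ` {0<..<1} = {}"
    by (intro ballI impI)
  have emb': "\<forall>e\<in>edge ` I. embedding_map (top_of_set {0..1}) X (\<gamma> e) \<and> {\<gamma> e 0, \<gamma> e 1} = pos ` e \<and>
      \<gamma> e ` {0<..<1} \<inter> pos ` V = {}"
    using emb by (intro ballI; elim imageE; simp only:)
  show ?thesis
    unfolding embeddable_in_def prod.case
    by (intro exI[of _ pos] exI[of _ \<gamma>] conjI pos emb' dis)
qed

text \<open>Integer points of space; the plane is the affine plane at height one.\<close>

type_synonym ipoint = "int \<times> int \<times> int"

section \<open>Exact separation tests for segments with integer ends\<close>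

fun icross :: "ipoint \<Rightarrow> ipoint \<Rightarrow> ipoint" where
  "icross (a, b, c) (x, y, z) = (b * z - c * y, c * x - a * z, a * y - b * x)"

fun idot :: "ipoint \<Rightarrow> ipoint \<Rightarrow> int" where
  "idot (a, b, c) (x, y, z) = a * x + b * y + c * z"

fun ineg :: "ipoint \<Rightarrow> ipoint" where
  "ineg (a, b, c) = (- a, - b, - c)"

definition ivec :: "ipoint \<Rightarrow> real ^ 3" where
  "ivec p = vector [of_int (fst p), of_int (fst (snd p)), of_int (snd (snd p))]"

text \<open>Two segments are apart, even up to nonzero scalars, if one of them lies on one side of the
  plane through the origin spanned by the other.\<close>

definition one_sided :: "ipoint \<times> ipoint \<Rightarrow> ipoint \<times> ipoint \<Rightarrow> bool" where
  "one_sided s t = (let n = icross (fst s) (snd s); a = idot n (fst t); b = idot n (snd t)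
     in 0 \<le> a * b \<and> \<not> (a = 0 \<and> b = 0))"

definition segments_apart :: "ipoint \<times> ipoint \<Rightarrow> ipoint \<times> ipoint \<Rightarrow> bool" where
  "segments_apart s t = (if one_sided s t then True else one_sided t s)"

text \<open>If \<open>r\<close> is a nonzero multiple of an inner point of the segment, its cross
  products with the two ends are opposite in direction. A nonnegative inner product of them
  therefore excludes this within the plane of \<open>s\<close>.\<close>

definition point_apart :: "ipoint \<times> ipoint \<Rightarrow> ipoint \<Rightarrow> bool" where
  "point_apart s r = (if idot (icross (fst s) (snd s)) r \<noteq> 0 then True
     else 0 \<le> idot (icross r (fst s)) (icross r (snd s)))"

lemma ivec_cross: "ivec (icross p q) = cross3 (ivec p) (ivec q)"
  by (cases p; cases q) (simp add: ivec_def cross3_def)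

lemma ivec_dot: "ivec p \<bullet> ivec q = of_int (idot p q)"
  by (cases p; cases q) (simp add: ivec_def inner_vec_def sum_3)

lemma ivec_neg: "ivec (ineg p) = - ivec p"
  by (cases p) (simp add: ivec_def vec_eq_iff forall_3)

lemma ivec_eq_0_iff: "ivec p = 0 \<longleftrightarrow> p = (0, 0, 0)"
  by (cases p) (simp add: ivec_def vec_eq_iff forall_3)

abbreviation ivecs :: "ipoint \<times> ipoint \<Rightarrow> (real ^ 3) \<times> (real ^ 3)" where
  "ivecs s \<equiv> (ivec (fst s), ivec (snd s))"

text \<open>The normal of the plane of \<open>s\<close> vanishes on \<open>s\<close>. On an inner
  point of \<open>t\<close> it takes the value \<open>(1 - w) * a + w * b\<close>, up to the factor
  \<open>c\<close>, and this is nonzero because \<open>a\<close> and \<open>b\<close> are not of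
  opposite signs and not both zero.\<close>

lemma one_sided_imp_apart:
  assumes "one_sided s t" "w \<in> {0<..<1}" "c \<noteq> 0"
  shows "segment_point (ivecs s) u \<noteq> c *\<^sub>R segment_point (ivecs t) w"
proof
  assume eq: "segment_point (ivecs s) u = c *\<^sub>R segment_point (ivecs t) w"
  let ?n = "cross3 (ivec (fst s)) (ivec (snd s))"
  define a where "a = ?n \<bullet> ivec (fst t)"
  define b where "b = ?n \<bullet> ivec (snd t)"
  have ab: "0 \<le> a * b" "a \<noteq> 0 \<or> b \<noteq> 0"
    using assms(1) by (auto simp: a_def b_def one_sided_def Let_def ivec_dot simp flip: ivec_cross of_int_mult)
  have "?n \<bullet> segment_point (ivecs s) u = 0"
    by (simp add: inner_add_right dot_cross_self)
  then have "c * ((1 - w) * a + w * b) = 0"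
    unfolding eq by (simp add: inner_add_right a_def b_def)
  then have z: "(1 - w) * a + w * b = 0" using assms(3) by simp
  have w: "0 < w" "0 < 1 - w" using assms(2) by auto
  have "(1 - w) * (a * a) + w * (a * b) = 0" "(1 - w) * (a * b) + w * (b * b) = 0"
    using arg_cong[OF z, of "\<lambda>x. x * a"] arg_cong[OF z, of "\<lambda>x. x * b"] by (simp_all add: algebra_simps)
  moreover have "0 \<le> w * (a * b)" "0 \<le> (1 - w) * (a * b)" "0 \<le> (1 - w) * (a * a)" "0 \<le> w * (b * b)"
    using w ab(1) by simp_all
  ultimately have "(1 - w) * (a * a) = 0" "w * (b * b) = 0" by linarith+
  then show False using w ab(2) by simp
qed

lemma segments_apart_imp_apart:
  assumes "segments_apart s t" "u \<in> {0<..<1}" "w \<in> {0<..<1}" "c \<noteq> 0"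
  shows "segment_point (ivecs s) u \<noteq> c *\<^sub>R segment_point (ivecs t) w"
proof (cases "one_sided s t")
  case True
  then show ?thesis using one_sided_imp_apart assms by blast
next
  case False
  then have "one_sided t s" using assms(1) by (simp add: segments_apart_def)
  then have "segment_point (ivecs t) w \<noteq> inverse c *\<^sub>R segment_point (ivecs s) u"
    using one_sided_imp_apart assms by (metis inverse_nonzero_iff_nonzero)
  then show ?thesis using assms(4) by auto
qed

lemma cross_smult_combination:
  "cross3 (c *\<^sub>R ((1 - u) *\<^sub>R p + u *\<^sub>R q)) p = - (c * u) *\<^sub>R cross3 p q"
  "cross3 (c *\<^sub>R ((1 - u) *\<^sub>R p + u *\<^sub>R q)) q = (c * (1 - u)) *\<^sub>R cross3 p q"
  by (simp_all add: cross3_def vec_eq_iff forall_3 algebra_simps)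

lemma point_apart_imp_apart:
  assumes "point_apart s r" "u \<in> {0<..<1}" "c \<noteq> 0" "icross (fst s) (snd s) \<noteq> (0, 0, 0)"
  shows "ivec r \<noteq> c *\<^sub>R segment_point (ivecs s) u"
proof
  assume eq: "ivec r = c *\<^sub>R segment_point (ivecs s) u"
  let ?n = "cross3 (ivec (fst s)) (ivec (snd s))"
  have n: "?n \<noteq> 0"
    using assms(4) by (simp add: ivec_eq_0_iff flip: ivec_cross)
  have "of_int (idot (icross (fst s) (snd s)) r) = ?n \<bullet> ivec r" by (simp add: ivec_cross flip: ivec_dot)
  also have "\<dots> = 0" unfolding eq by (simp add: inner_add_right dot_cross_self)
  finally have "0 \<le> idot (icross r (fst s)) (icross r (snd s))"
    using assms(1) by (simp add: point_apart_def)
  then have "0 \<le> cross3 (ivec r) (ivec (fst s)) \<bullet> cross3 (ivec r) (ivec (snd s))"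
    by (simp add: ivec_dot flip: ivec_cross)
  also have "\<dots> = - (c * u) * (c * (1 - u)) * (?n \<bullet> ?n)"
    unfolding eq fst_conv snd_conv cross_smult_combination by simp
  also have "\<dots> = - (c * c * (u * (1 - u)) * (?n \<bullet> ?n))" by (simp add: algebra_simps)
  also have "\<dots> < 0"
    using assms(2,3) n by (auto intro!: mult_pos_pos simp: zero_less_mult_iff)
  finally show False by simp
qed

text \<open>Cross products with the two ends give \<open>u = c * w\<close> and
  \<open>1 - u = c * (1 - w)\<close>, whose sum is \<open>c = 1\<close>.\<close>

lemma segment_point_inject:
  assumes "segment_point (ivecs s) u = c *\<^sub>R segment_point (ivecs s) w" "icross (fst s) (snd s) \<noteq> (0, 0, 0)"
  shows "u = w"
proof -
  let ?p = "ivec (fst s)" and ?q = "ivec (snd s)"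
  have n: "cross3 ?p ?q \<noteq> 0"
    using assms(2) by (simp add: ivec_eq_0_iff flip: ivec_cross)
  have eq: "(1 - u) *\<^sub>R ?p + u *\<^sub>R ?q = c *\<^sub>R ((1 - w) *\<^sub>R ?p + w *\<^sub>R ?q)" using assms(1) by simp
  have "(- u) *\<^sub>R cross3 ?p ?q = cross3 ((1 - u) *\<^sub>R ?p + u *\<^sub>R ?q) ?p"
    "(1 - u) *\<^sub>R cross3 ?p ?q = cross3 ((1 - u) *\<^sub>R ?p + u *\<^sub>R ?q) ?q"
    using cross_smult_combination[of 1 u ?p ?q] by simp_all
  then have "(- u) *\<^sub>R cross3 ?p ?q = (- (c * w)) *\<^sub>R cross3 ?p ?q"
    "(1 - u) *\<^sub>R cross3 ?p ?q = (c * (1 - w)) *\<^sub>R cross3 ?p ?q"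
    unfolding eq cross_smult_combination .
  then have "u = c * w" "1 - u = c * (1 - w)"
    unfolding scaleR_cancel_right using n by simp_all
  then have "c = 1" by (simp add: algebra_simps)
  then show ?thesis using \<open>u = c * w\<close> by simp
qed

text \<open>The incidence graph for \<open>n = 6\<close>: vertices below \<open>14\<close> stand for subgroups, the others for hyperedges.
  The drawing on the torus uses the square of side \<open>18\<close>, the one on the projective plane homogeneous coordinates.
  Segments are listed in the order of the edges.\<close>

definition hex_edges :: "(nat \<times> nat) list" where
  "hex_edges = [
    (0, 14), (1, 14), (2, 14), (5, 14), (0, 15), (1, 15), (2, 15), (6, 15), (0, 16), (1, 16),
    (2, 16), (7, 16), (3, 17), (5, 17), (3, 18), (6, 18), (3, 19), (7, 19), (4, 20), (1, 20),
    (2, 20), (0, 21), (2, 21), (8, 21), (0, 22), (1, 22), (9, 22), (0, 23), (2, 23), (10, 23),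
    (0, 24), (1, 24), (11, 24), (0, 25), (2, 25), (12, 25), (0, 26), (1, 26), (13, 26)]"

definition projective_points :: "ipoint list" where
  "projective_points = [
    (6, 4, 5), (4, 5, -6), (4, -5, 6), (-6, 4, 5), (0, 5, -4), (6, -1, -1), (-2, 5, 1),
    (-2, 2, 6), (4, 1, 3), (5, 2, 1), (4, 0, 3), (6, 5, 0), (3, -1, 6), (2, 4, -1), (5, 1, 0),
    (1, 5, 0), (0, 1, 6), (5, -4, -3), (-3, 5, 2), (-4, 4, 5), (0, 4, -6), (4, 0, 4),
    (5, 3, 0), (6, 1, 4), (6, 4, 1), (3, -1, 4), (3, 4, 0)]"

text \<open>Two points of the projective plane bound two complementary segments of their line; the
  signs of the representatives select one of them.\<close>

definition projective_segments :: "(ipoint \<times> ipoint) list" where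
  "projective_segments = [
    ((6, 4, 5), (5, 1, 0)), ((4, 5, -6), (5, 1, 0)), ((4, -5, 6), (5, 1, 0)),
    ((6, -1, -1), (5, 1, 0)), ((6, 4, 5), (1, 5, 0)), ((4, 5, -6), (1, 5, 0)),
    ((4, -5, 6), (-1, -5, 0)), ((-2, 5, 1), (1, 5, 0)), ((6, 4, 5), (0, 1, 6)),
    ((4, 5, -6), (0, -1, -6)), ((4, -5, 6), (0, 1, 6)), ((-2, 2, 6), (0, 1, 6)),
    ((-6, 4, 5), (-5, 4, 3)), ((6, -1, -1), (5, -4, -3)), ((-6, 4, 5), (-3, 5, 2)),
    ((-2, 5, 1), (-3, 5, 2)), ((-6, 4, 5), (-4, 4, 5)), ((-2, 2, 6), (-4, 4, 5)),
    ((0, 5, -4), (0, 4, -6)), ((4, 5, -6), (0, 4, -6)), ((4, -5, 6), (0, -4, 6)),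
    ((6, 4, 5), (4, 0, 4)), ((4, -5, 6), (4, 0, 4)), ((4, 1, 3), (4, 0, 4)),
    ((6, 4, 5), (5, 3, 0)), ((4, 5, -6), (5, 3, 0)), ((5, 2, 1), (5, 3, 0)),
    ((6, 4, 5), (6, 1, 4)), ((4, -5, 6), (6, 1, 4)), ((4, 0, 3), (6, 1, 4)),
    ((6, 4, 5), (6, 4, 1)), ((4, 5, -6), (6, 4, 1)), ((6, 5, 0), (6, 4, 1)),
    ((6, 4, 5), (3, -1, 4)), ((4, -5, 6), (3, -1, 4)), ((3, -1, 6), (3, -1, 4)),
    ((6, 4, 5), (3, 4, 0)), ((4, 5, -6), (3, 4, 0)), ((2, 4, -1), (3, 4, 0))]"

definition torus_points :: "(int \<times> int) list" where
  "torus_points = [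
    (13, 0), (0, 6), (7, 12), (0, 0), (5, 8), (4, -1), (-4, 4), (0, -4), (9, 7), (5, 2),
    (9, 6), (5, 5), (6, 6), (7, 5), (5, 0), (13, 5), (1, 12), (2, 0), (-1, 2), (-1, -3),
    (3, 9), (11, 6), (6, 2), (8, 6), (6, 3), (7, 7), (6, 5)]"

text \<open>An end may be a translate of the listed point by multiples of 18; the translates chosen
  decide how an edge winds around the torus.\<close>

definition torus_segments :: "((int \<times> int) \<times> (int \<times> int)) list" where
  "torus_segments = [
    ((13, 0), (5, 0)), ((0, 6), (5, 0)), ((7, -6), (5, 0)), ((4, -1), (5, 0)),
    ((-5, 0), (-5, 5)), ((0, 6), (-5, 5)), ((7, 12), (13, 5)), ((-4, 4), (-5, 5)),
    ((-5, 0), (1, -6)), ((0, 6), (1, 12)), ((7, -6), (1, -6)), ((0, -4), (1, -6)),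
    ((0, 0), (2, 0)), ((4, -1), (2, 0)), ((0, 0), (-1, 2)), ((-4, 4), (-1, 2)),
    ((0, 0), (-1, -3)), ((0, -4), (-1, -3)), ((5, 8), (3, 9)), ((0, 6), (3, 9)),
    ((7, 12), (3, 9)), ((13, 0), (11, 6)), ((7, 12), (11, 6)), ((9, 7), (11, 6)),
    ((13, 0), (6, 2)), ((0, 6), (6, 2)), ((5, 2), (6, 2)), ((13, 0), (8, 6)),
    ((7, 12), (8, 6)), ((9, 6), (8, 6)), ((13, 0), (6, 3)), ((0, 6), (6, 3)), ((5, 5), (6, 3)),
    ((13, 0), (7, 7)), ((7, 12), (7, 7)), ((6, 6), (7, 7)), ((13, 0), (6, 5)),
    ((0, 6), (6, 5)), ((7, 5), (6, 5))]"

definition projective_drawing_ok :: bool where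
  "projective_drawing_ok \<longleftrightarrow>
     list_all2 (\<lambda>(a, b) (p, q). (p = projective_points ! a \<or> p = ineg (projective_points ! a)) \<and>
       (q = projective_points ! b \<or> q = ineg (projective_points ! b))) hex_edges projective_segments \<and>
     sorted_wrt segments_apart projective_segments \<and>
     list_all (\<lambda>s. icross (fst s) (snd s) \<noteq> (0, 0, 0) \<and> list_all (point_apart s) projective_points) projective_segments \<and>
     sorted_wrt (\<lambda>p q. icross p q \<noteq> (0, 0, 0)) projective_points"

lemma projective_drawing_ok: projective_drawing_ok
  by code_simp

section \<open>The drawing on the projective plane for n = 6\<close>

definition projective_point :: "real ^ 3 \<Rightarrow> (real ^ 3) set" where
  "projective_point x = {sgn x, - sgn x}"

lemma projective_point_minus [simp]: "projective_point (- x) = projective_point x"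
  by (auto simp: projective_point_def sgn_minus)

lemma projective_point_eqD:
  assumes "projective_point x = projective_point y" "x \<noteq> 0" "y \<noteq> 0"
  obtains c where "c \<noteq> 0" "x = c *\<^sub>R y"
proof -
  have x: "x = norm x *\<^sub>R sgn x" and y: "sgn y = inverse (norm y) *\<^sub>R y"
    using assms(2) by (simp_all add: sgn_div_norm)
  have "sgn x = sgn y \<or> sgn x = - sgn y" using assms(1) by (auto simp: projective_point_def doubleton_eq_iff)
  then show thesis
  proof
    assume eq: "sgn x = sgn y"
    have "x = (norm x * inverse (norm y)) *\<^sub>R y" using x[unfolded eq y] by simp
    then show thesis using that[of "norm x * inverse (norm y)"] assms by simp
  next
    assume eq: "sgn x = - sgn y"
    have "x = (- (norm x * inverse (norm y))) *\<^sub>R y" using x[unfolded eq y] by simp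
    then show thesis using that[of "- (norm x * inverse (norm y))"] assms by simp
  qed
qed

lemma continuous_map_projective_point:
  assumes "0 \<notin> S"
  shows "continuous_map (top_of_set S) projective_plane projective_point"
proof -
  have "continuous_on S sgn"
    unfolding sgn_div_norm[abs_def] using assms by (intro continuous_intros) auto
  then have "continuous_map (top_of_set S) (top_of_set (sphere 0 1)) (sgn :: real ^ 3 \<Rightarrow> _)"
    using assms by (auto simp: continuous_map_in_subtopology norm_sgn)
  then have "continuous_map (top_of_set S) projective_plane ((\<lambda>x. {x, - x}) \<circ> sgn)"
    using quotient_imp_continuous_map[OF quotient_map_projective_plane] by (rule continuous_map_compose)
  moreover have "(\<lambda>x. {x, - x}) \<circ> sgn = projective_point" by (simp add: fun_eq_iff projective_point_def)
  ultimately show ?thesis by simp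
qed

lemma projective_point_in_topspace: "x \<noteq> 0 \<Longrightarrow> projective_point x \<in> topspace projective_plane"
  by (auto simp: topspace_projective_plane projective_point_def norm_sgn)

text \<open>Inherited from the space of matrices through the injective continuous
  \<open>projective_coordinates\<close>.\<close>

lemma Hausdorff_projective_plane: "Hausdorff_space projective_plane"
proof -
  have "continuous_map projective_plane euclidean projective_coordinates"
    "inj_on projective_coordinates (topspace projective_plane)"
    using bipartite_bounded_projective_plane by (auto simp: bipartite_bounded_surface_def)
  then show ?thesis
    using Hausdorff_space_injective_preimage Hausdorff_space_euclidean by blast
qed

lemma Hausdorff_torus: "Hausdorff_space torus"
  by (simp add: torus_def Hausdorff_space_prod_topology Hausdorff_space_subtopology)

lemma torus_eq: "torus = top_of_set (sphere 0 1 \<times> sphere 0 1)"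
  by (simp add: torus_def prod_topology_subtopology_eu)

lemma continuous_map_torus_map:
  assumes "continuous_on S h"
  shows "continuous_map (top_of_set S) torus (\<lambda>x. torus_map (h x))"
  unfolding torus_eq continuous_map_in_subtopology torus_map_def
  using assms by (auto simp: cis_conv_exp intro!: continuous_intros)

lemma torus_map_in_topspace: "torus_map z \<in> topspace torus"
  by (simp add: torus_eq torus_map_def)

definition template_edge :: "nat \<Rightarrow> nat set" where
  "template_edge k = {fst (hex_edges ! k), snd (hex_edges ! k)}"

lemma length_hex_edges: "length hex_edges = 39"
  by (simp add: hex_edges_def)

lemma hex_edges_bounds: "list_all (\<lambda>(a, b). a < 14 \<and> 14 \<le> b \<and> b < 27) hex_edges" and distinct_hex_edges: "distinct hex_edges"
  by (simp_all add: hex_edges_def)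

lemma template_edge_bounds:
  assumes "k < 39"
  shows "fst (hex_edges ! k) < 14" "14 \<le> snd (hex_edges ! k)" "snd (hex_edges ! k) < 27"
  using hex_edges_bounds assms by (auto simp: list_all_length length_hex_edges split_beta)

lemma inj_on_template_edge: "inj_on template_edge {..<39}"
proof (rule inj_onI)
  fix i j assume ij: "i \<in> {..<39::nat}" "j \<in> {..<39}" "template_edge i = template_edge j"
  then have "hex_edges ! i = hex_edges ! j"
    using template_edge_bounds[of i] template_edge_bounds[of j]
    by (auto simp: template_edge_def doubleton_eq_iff prod_eq_iff)
  then show "i = j" using ij distinct_hex_edges nth_eq_iff_index_eq[of hex_edges i j] by (simp add: length_hex_edges)
qed

lemma template_edge_subset: "k < 39 \<Longrightarrow> template_edge k \<subseteq> {..<27} \<and> card (template_edge k) = 2"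
  using template_edge_bounds[of k] by (auto simp: template_edge_def card_insert_if)

lemma segment_point_nonzero:
  assumes "icross (fst s) (snd s) \<noteq> (0, 0, 0)"
  shows "segment_point (ivecs s) u \<noteq> 0"
proof
  let ?n = "cross3 (ivec (fst s)) (ivec (snd s))"
  assume "segment_point (ivecs s) u = 0"
  then have "1 *\<^sub>R ((1 - u) *\<^sub>R ivec (fst s) + u *\<^sub>R ivec (snd s)) = 0" by simp
  then have "(- (1 * u)) *\<^sub>R ?n = 0" "(1 * (1 - u)) *\<^sub>R ?n = 0"
    unfolding cross_smult_combination[symmetric] by (simp_all only: cross_zero_left)
  moreover have "?n \<noteq> 0" using assms by (simp add: ivec_eq_0_iff flip: ivec_cross)
  ultimately show False by simp
qed

lemma zero_notin_closed_segment:
  assumes "icross (fst s) (snd s) \<noteq> (0, 0, 0)"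
  shows "0 \<notin> closed_segment (ivec (fst s)) (ivec (snd s))"
  using segment_point_nonzero[OF assms] by (auto simp: closed_segment_def)

lemma projective_template_embeddable:
  "embeddable_in projective_plane ({..<27}, template_edge ` {..<39})"
proof -
  have len: "length projective_segments = 39" "length projective_points = 27"
    by (simp_all add: projective_segments_def projective_points_def)
  let ?P = "\<lambda>v. projective_points ! v" and ?S = "\<lambda>k. projective_segments ! k"
  note ok = projective_drawing_ok[unfolded projective_drawing_ok_def list_all2_conv_all_nth list_all_length
      length_hex_edges len split_beta]
  have e: "fst (?S k) = ?P (fst (hex_edges ! k)) \<or> fst (?S k) = ineg (?P (fst (hex_edges ! k)))"
    "snd (?S k) = ?P (snd (hex_edges ! k)) \<or> snd (?S k) = ineg (?P (snd (hex_edges ! k)))" if "k < 39" for k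
    using ok that by blast+
  have apart: "segments_apart (?S i) (?S j)" if "i < j" "j < 39" for i j
  proof -
    have "sorted_wrt segments_apart projective_segments" using ok by (elim conjE)
    then show ?thesis using sorted_wrt_nth_less that len by metis
  qed
  have nz: "icross (fst (?S k)) (snd (?S k)) \<noteq> (0, 0, 0)" and pt: "v < 27 \<Longrightarrow> point_apart (?S k) (?P v)" if "k < 39" for k v
    using ok that by blast+
  have pp: "icross (?P v) (?P w) \<noteq> (0, 0, 0)" if "v < w" "w < 27" for v w
  proof -
    have "sorted_wrt (\<lambda>p q. icross p q \<noteq> (0, 0, 0)) projective_points" using ok by (elim conjE)
    from sorted_wrt_nth_less[OF this that(1)] show ?thesis using that(2) len by simp
  qed
  have Pnz: "ivec (?P v) \<noteq> 0" if v: "v < 27" for v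
  proof
    assume z: "ivec (?P v) = 0"
    obtain w where w: "w < 27" "w \<noteq> v" by (rule that[of "if v = 0 then 1 else 0"]) auto
    have "ivec (icross (?P v) (?P w)) = 0" "ivec (icross (?P w) (?P v)) = 0" unfolding ivec_cross z by simp_all
    then have "icross (?P v) (?P w) = (0, 0, 0)" "icross (?P w) (?P v) = (0, 0, 0)" unfolding ivec_eq_0_iff .
    then show False using pp[of v w] pp[of w v] w v by (metis linorder_neqE_nat)
  qed
  show ?thesis
  proof (rule embeddable_in_segments[where \<Phi> = projective_point and s = "\<lambda>k. ivecs (?S k)" and pos = "\<lambda>v. projective_point (ivec (?P v))"])
    show "Hausdorff_space projective_plane" by (rule Hausdorff_projective_plane)
    show "inj_on template_edge {..<39}" by (rule inj_on_template_edge)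
    show "(\<lambda>v. projective_point (ivec (?P v))) ` {..<27} \<subseteq> topspace projective_plane"
      using Pnz projective_point_in_topspace by auto
    have lt: "projective_point (ivec (?P v)) \<noteq> projective_point (ivec (?P w))" if vw: "v < w" "w < 27" for v w
    proof
      assume "projective_point (ivec (?P v)) = projective_point (ivec (?P w))"
      then obtain c where "ivec (?P v) = c *\<^sub>R ivec (?P w)"
        using projective_point_eqD Pnz[of v] Pnz[OF vw(2)] vw by (metis less_trans)
      then have "ivec (icross (?P v) (?P w)) = 0" by (simp add: ivec_cross cross_mult_left)
      then show False using pp[OF vw] by (simp add: ivec_eq_0_iff)
    qed
    show "inj_on (\<lambda>v. projective_point (ivec (?P v))) {..<27}"
      by (rule inj_onI) (metis lt lessThan_iff linorder_neqE_nat)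
    fix k assume "k \<in> {..<39::nat}"
    then have k: "k < 39" by simp
    show "template_edge k \<subseteq> {..<27} \<and> card (template_edge k) = 2" using k by (rule template_edge_subset)
    have "projective_point (ivec (fst (?S k))) = projective_point (ivec (?P (fst (hex_edges ! k))))"
      "projective_point (ivec (snd (?S k))) = projective_point (ivec (?P (snd (hex_edges ! k))))"
      using e[OF k] by (metis ivec_neg projective_point_minus)+
    then show "{projective_point (fst (ivecs (?S k))), projective_point (snd (ivecs (?S k)))} =
        (\<lambda>v. projective_point (ivec (?P v))) ` template_edge k"
      by (simp add: template_edge_def)
    show "continuous_map (top_of_set (closed_segment (fst (ivecs (?S k))) (snd (ivecs (?S k))))) projective_plane projective_point"
      using zero_notin_closed_segment[OF nz[OF k]] by (intro continuous_map_projective_point) simp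
    fix u :: real assume u: "u \<in> {0<..<1}"
    show "projective_point (segment_point (ivecs (?S k)) u) \<noteq> projective_point (ivec (?P v))" if "v \<in> {..<27}" for v
    proof
      assume eq: "projective_point (segment_point (ivecs (?S k)) u) = projective_point (ivec (?P v))"
      have v: "v < 27" using that by simp
      obtain c where c: "c \<noteq> 0" "ivec (?P v) = c *\<^sub>R segment_point (ivecs (?S k)) u"
        using projective_point_eqD[OF eq[symmetric] Pnz[OF v] segment_point_nonzero[OF nz[OF k]]] .
      then show False using point_apart_imp_apart[OF pt[OF k v] u c(1) nz[OF k]] by (elim notE)
    qed
    fix j w assume "j \<in> {..<39::nat}" and w: "w \<in> {0<..<1::real}"
      and eq: "projective_point (segment_point (ivecs (?S k)) u) = projective_point (segment_point (ivecs (?S j)) w)"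
    then have j: "j < 39" by simp
    obtain c where c: "c \<noteq> 0" "segment_point (ivecs (?S k)) u = c *\<^sub>R segment_point (ivecs (?S j)) w"
      using projective_point_eqD[OF eq segment_point_nonzero[OF nz[OF k]] segment_point_nonzero[OF nz[OF j]]] .
    \<comment> \<open>The test is known for pairs in list order only, so the proportionality is kept
      in both directions.\<close>
    obtain c' where c': "c' \<noteq> 0" "segment_point (ivecs (?S j)) w = c' *\<^sub>R segment_point (ivecs (?S k)) u"
      using projective_point_eqD[OF eq[symmetric] segment_point_nonzero[OF nz[OF j]] segment_point_nonzero[OF nz[OF k]]] .
    have "k = j"
      using segments_apart_imp_apart[OF apart[of k j] u w c(1)] segments_apart_imp_apart[OF apart[of j k] w u c'(1)]
        c(2) c'(2) j k by (metis linorder_neqE_nat)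
    then show "k = j \<and> u = w" using segment_point_inject[OF c(2)[folded \<open>k = j\<close>] nz[OF k]] by simp
  qed
qed

section \<open>The drawing on the torus for n = 6\<close>

fun ihom :: "int \<times> int \<Rightarrow> ipoint" where
  "ihom (a, b) = (a, b, 1)"

fun ishift :: "int \<times> int \<Rightarrow> int \<times> int \<Rightarrow> int \<times> int" where
  "ishift (k, l) (a, b) = (a + k, b + l)"

text \<open>Nested conditionals keep the evaluation by rewriting from unfolding the remaining tests.\<close>

definition interval_apart :: "int \<Rightarrow> int \<Rightarrow> int \<Rightarrow> int \<Rightarrow> bool" where
  "interval_apart a b c d = (if a < c then if a < d then if b < c then b < d else False else False
     else if c < a then if d < a then if c < b then d < b else False else False else False)"

text \<open>Besides saving determinants, bounding boxes settle collinear segments, such as a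
  horizontal edge and its horizontal translates, on which both \<open>one_sided\<close> tests
  fail.\<close>

definition boxes_apart :: "(int \<times> int) \<times> (int \<times> int) \<Rightarrow> (int \<times> int) \<times> (int \<times> int) \<Rightarrow> bool" where
  "boxes_apart s t = (if interval_apart (fst (fst s)) (fst (snd s)) (fst (fst t)) (fst (snd t)) then True
     else interval_apart (snd (fst s)) (snd (snd s)) (snd (fst t)) (snd (snd t)))"

definition shifted_segments_apart :: "int \<times> int \<Rightarrow> (int \<times> int) \<times> (int \<times> int) \<Rightarrow> (int \<times> int) \<times> (int \<times> int) \<Rightarrow> bool" where
  "shifted_segments_apart k s t = (let t' = map_prod (ishift k) (ishift k) t in
     if boxes_apart s t' then True else segments_apart (map_prod ihom ihom s) (map_prod ihom ihom t'))"

definition shifted_point_apart :: "int \<times> int \<Rightarrow> (int \<times> int) \<times> (int \<times> int) \<Rightarrow> int \<times> int \<Rightarrow> bool" where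
  "shifted_point_apart k s r = (let r' = ishift k r in
     if boxes_apart s (r', r') then True else point_apart (map_prod ihom ihom s) (ihom r'))"

text \<open>Coordinates between -6 and 13 differ by at most 19, less than two periods, so these are
  the only nonzero translations by which two points of the drawing can agree on the torus.\<close>

definition nonzero_shifts :: "(int \<times> int) list" where
  "nonzero_shifts = [(-18, -18), (-18, 0), (-18, 18), (0, -18), (0, 18), (18, -18), (18, 0), (18, 18)]"

text \<open>\<open>sorted_wrt\<close> visits a pair of segments in one order only; this suffices
  because the set of shifts is closed under negation. A segment also has to avoid its own nonzero
  translates, since it must not meet itself on the torus.\<close>

definition torus_drawing_ok :: bool where
  "torus_drawing_ok \<longleftrightarrow>
     list_all2 (\<lambda>(a, b) (p, q). list_all (\<lambda>(r, s). (fst r - fst s) mod 18 = 0 \<and> (snd r - snd s) mod 18 = 0)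
       [(p, torus_points ! a), (q, torus_points ! b)]) hex_edges torus_segments \<and>
     list_all (\<lambda>k. sorted_wrt (shifted_segments_apart k) torus_segments) ((0, 0) # nonzero_shifts) \<and>
     list_all (\<lambda>k. list_all (\<lambda>s. shifted_segments_apart k s s) torus_segments) nonzero_shifts \<and>
     list_all (\<lambda>k. list_all (\<lambda>s. list_all (shifted_point_apart k s) torus_points) torus_segments) ((0, 0) # nonzero_shifts) \<and>
     list_all (\<lambda>s. fst s \<noteq> snd s \<and> list_all (\<lambda>(a, b). -6 \<le> a \<and> a \<le> 13 \<and> -6 \<le> b \<and> b \<le> 13) [fst s, snd s]) torus_segments \<and>
     list_all (\<lambda>(a, b). -6 \<le> a \<and> a \<le> 13 \<and> -6 \<le> b \<and> b \<le> 13) torus_points \<and>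
     sorted_wrt (\<lambda>r s. (fst r - fst s) mod 18 \<noteq> 0 \<or> (snd r - snd s) mod 18 \<noteq> 0) torus_points"

lemma torus_drawing_ok: torus_drawing_ok
  by code_simp

definition ipoint_complex :: "int \<times> int \<Rightarrow> complex" where
  "ipoint_complex r = Complex (of_int (fst r)) (of_int (snd r))"

definition homogeneous :: "complex \<Rightarrow> real ^ 3" where
  "homogeneous z = vector [Re z, Im z, 1]"

lemma homogeneous_segment_point:
  "homogeneous (segment_point (ipoint_complex (fst s), ipoint_complex (snd s)) u) = segment_point (ivecs (map_prod ihom ihom s)) u"
  by (cases s) (auto simp: homogeneous_def ipoint_complex_def ivec_def vec_eq_iff forall_3)

lemma homogeneous_ipoint: "homogeneous (ipoint_complex r) = ivec (ihom r)"
  by (cases r) (simp add: homogeneous_def ipoint_complex_def ivec_def vec_eq_iff forall_3)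

lemma ipoint_complex_shift: "ipoint_complex (ishift k r) = ipoint_complex r + ipoint_complex k"
  by (cases k; cases r) (simp add: ipoint_complex_def complex_eq_iff)

abbreviation ipoints_complex :: "(int \<times> int) \<times> (int \<times> int) \<Rightarrow> complex \<times> complex" where
  "ipoints_complex s \<equiv> (ipoint_complex (fst s), ipoint_complex (snd s))"

lemma segment_point_shift:
  "segment_point (ipoints_complex (map_prod (ishift k) (ishift k) s)) u = segment_point (ipoints_complex s) u + ipoint_complex k"
proof -
  have "(1 - u) *\<^sub>R (a + c) + u *\<^sub>R (b + c) = ((1 - u) *\<^sub>R a + u *\<^sub>R b) + c" for a b c :: complex
    by (simp add: algebra_simps)
  then show ?thesis by (simp add: ipoint_complex_shift)
qed

lemma convex_combination_bounds:
  fixes a b u :: real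
  assumes "u \<in> {0..1}" "m \<le> a" "a \<le> M" "m \<le> b" "b \<le> M"
  shows "m \<le> (1 - u) * a + u * b" "(1 - u) * a + u * b \<le> M"
proof -
  have "(1 - u) * m + u * m \<le> (1 - u) * a + u * b" "(1 - u) * a + u * b \<le> (1 - u) * M + u * M"
    using assms by (intro add_mono mult_left_mono; simp)+
  then show "m \<le> (1 - u) * a + u * b" "(1 - u) * a + u * b \<le> M" by (simp_all add: algebra_simps)
qed

lemma interval_apart_imp:
  assumes "interval_apart a b c d" "u \<in> {0..1}" "w \<in> {0..1}"
  shows "(1 - u) * of_int a + u * of_int b \<noteq> (1 - w) * of_int c + w * (of_int d :: real)"
proof -
  have "max a b < min c d \<or> max c d < min a b"
    using assms(1) by (auto simp: interval_apart_def split: if_splits)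
  moreover have "of_int (min a b) \<le> (1 - u) * of_int a + u * (of_int b :: real)"
    "(1 - u) * of_int a + u * of_int b \<le> (of_int (max a b) :: real)"
    "of_int (min c d) \<le> (1 - w) * of_int c + w * (of_int d :: real)"
    "(1 - w) * of_int c + w * of_int d \<le> (of_int (max c d) :: real)"
    using convex_combination_bounds[of u "of_int (min a b)" "of_int a" "of_int (max a b)" "of_int b"]
      convex_combination_bounds[of w "of_int (min c d)" "of_int c" "of_int (max c d)" "of_int d"] assms(2,3)
    unfolding of_int_le_iff by simp_all
  moreover have "(of_int (max a b) :: real) < of_int (min c d) \<longleftrightarrow> max a b < min c d"
    "(of_int (max c d) :: real) < of_int (min a b) \<longleftrightarrow> max c d < min a b" by (rule of_int_less_iff)+
  ultimately show ?thesis by linarith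
qed

lemma boxes_apart_imp:
  assumes "boxes_apart s t" "u \<in> {0..1}" "w \<in> {0..1}"
  shows "segment_point (ipoints_complex s) u \<noteq> segment_point (ipoints_complex t) w"
  using assms(1) interval_apart_imp[OF _ assms(2,3)]
  by (auto simp: boxes_apart_def ipoint_complex_def complex_eq_iff split: if_splits)

lemma shifted_segments_apart_imp:
  assumes "shifted_segments_apart k s t" "u \<in> {0<..<1}" "w \<in> {0<..<1}"
  shows "segment_point (ipoints_complex s) u \<noteq> segment_point (ipoints_complex t) w + ipoint_complex k"
proof -
  let ?t = "map_prod (ishift k) (ishift k) t"
  have "boxes_apart s ?t \<or> segments_apart (map_prod ihom ihom s) (map_prod ihom ihom ?t)"
    using assms(1) by (auto simp: shifted_segments_apart_def Let_def split: if_splits)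
  then have "segment_point (ipoints_complex s) u \<noteq> segment_point (ipoints_complex ?t) w"
  proof
    assume "boxes_apart s ?t"
    then show ?thesis using assms(2,3) by (intro boxes_apart_imp) auto
  next
    assume "segments_apart (map_prod ihom ihom s) (map_prod ihom ihom ?t)"
    from segments_apart_imp_apart[OF this assms(2,3), of 1]
    have "homogeneous (segment_point (ipoints_complex s) u) \<noteq> homogeneous (segment_point (ipoints_complex ?t) w)"
      unfolding homogeneous_segment_point by simp
    then show ?thesis by metis
  qed
  then show ?thesis unfolding segment_point_shift .
qed

lemma shifted_point_apart_imp:
  assumes "shifted_point_apart k s r" "u \<in> {0<..<1}" "fst s \<noteq> snd s"
  shows "segment_point (ipoints_complex s) u \<noteq> ipoint_complex r + ipoint_complex k"
proof -
  let ?r = "ishift k r"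
  have "boxes_apart s (?r, ?r) \<or> point_apart (map_prod ihom ihom s) (ihom ?r)"
    using assms(1) by (auto simp: shifted_point_apart_def Let_def split: if_splits)
  then have "segment_point (ipoints_complex s) u \<noteq> ipoint_complex ?r"
  proof
    assume "boxes_apart s (?r, ?r)"
    then have "segment_point (ipoints_complex s) u \<noteq> segment_point (ipoints_complex (?r, ?r)) 0"
      using assms(2) by (intro boxes_apart_imp) auto
    then show ?thesis by simp
  next
    assume p: "point_apart (map_prod ihom ihom s) (ihom ?r)"
    have "icross (fst (map_prod ihom ihom s)) (snd (map_prod ihom ihom s)) \<noteq> (0, 0, 0)"
      using assms(3) by (cases s; cases "fst s"; cases "snd s") auto
    from point_apart_imp_apart[OF p assms(2) _ this, of 1]
    have "homogeneous (segment_point (ipoints_complex s) u) \<noteq> homogeneous (ipoint_complex ?r)"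
      unfolding homogeneous_segment_point homogeneous_ipoint by auto
    then show ?thesis by metis
  qed
  then show ?thesis unfolding ipoint_complex_shift .
qed

lemma torus_map_period_eqD:
  assumes "torus_map (x / 18) = torus_map (y / 18)"
    and "-6 \<le> Re x" "Re x \<le> 13" "-6 \<le> Im x" "Im x \<le> 13" "-6 \<le> Re y" "Re y \<le> 13" "-6 \<le> Im y" "Im y \<le> 13"
  obtains k where "k \<in> set ((0, 0) # nonzero_shifts)" "x = y + ipoint_complex k"
proof -
  obtain k where k: "x / 18 = y / 18 + lattice_point k" using assms(1) by (auto simp: torus_map_eq_iff)
  then have x: "x = y + 18 * lattice_point k" by (simp add: field_simps)
  then have "Re x - Re y = of_int (18 * fst k)" "Im x - Im y = of_int (18 * snd k)"
    by (simp_all add: lattice_point_def)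
  then have "\<bar>of_int (18 * fst k)\<bar> < (36::real)" "\<bar>of_int (18 * snd k)\<bar> < (36::real)"
    using assms(2-9) by linarith+
  then have "\<bar>18 * fst k\<bar> < 36" "\<bar>18 * snd k\<bar> < 36" by linarith+
  then have "fst k \<in> {-1, 0, 1}" "snd k \<in> {-1, 0, 1}" by auto
  then have "(18 * fst k, 18 * snd k) \<in> set ((0, 0) # nonzero_shifts)"
    by (auto simp: nonzero_shifts_def)
  moreover have "x = y + ipoint_complex (18 * fst k, 18 * snd k)"
    using x by (simp add: ipoint_complex_def lattice_point_def complex_eq_iff)
  ultimately show thesis by (rule that)
qed

lemma torus_template_embeddable: "embeddable_in torus ({..<27}, template_edge ` {..<39})"
proof -
  have len: "length torus_segments = 39" "length torus_points = 27"
    by (simp_all add: torus_segments_def torus_points_def)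
  let ?P = "\<lambda>v. torus_points ! v" and ?S = "\<lambda>k. torus_segments ! k"
  let ?K = "set ((0, 0) # nonzero_shifts)"
  note ok = torus_drawing_ok[unfolded torus_drawing_ok_def]
  have e: "list_all (\<lambda>(r, s). (fst r - fst s) mod 18 = 0 \<and> (snd r - snd s) mod 18 = 0)
      [(fst (?S k), ?P (fst (hex_edges ! k))), (snd (?S k), ?P (snd (hex_edges ! k)))]" if "k < 39" for k
    using ok that unfolding list_all2_conv_all_nth length_hex_edges split_beta by blast
  have mod: "torus_map (ipoint_complex r / 18) = torus_map (ipoint_complex s / 18)"
    if "(fst r - fst s) mod 18 = 0 \<and> (snd r - snd s) mod 18 = 0" for r s
  proof -
    from that obtain a b where "fst r - fst s = 18 * a" "snd r - snd s = 18 * b" by (auto simp: mod_eq_0_iff_dvd dvd_def)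
    then have "fst r = fst s + 18 * a" "snd r = snd s + 18 * b" by auto
    then have "ipoint_complex r / 18 = ipoint_complex s / 18 + lattice_point (a, b)"
      by (simp add: ipoint_complex_def lattice_point_def complex_eq_iff)
    then show ?thesis by (simp only: torus_map_add_lattice)
  qed
  have ends: "torus_map (ipoint_complex (fst (?S k)) / 18) = torus_map (ipoint_complex (?P (fst (hex_edges ! k))) / 18)"
    "torus_map (ipoint_complex (snd (?S k)) / 18) = torus_map (ipoint_complex (?P (snd (hex_edges ! k))) / 18)" if "k < 39" for k
    using e[OF that] by (auto intro!: mod)
  note ok' = ok[unfolded list_all_iff]
  note sw = ok'[THEN conjunct2, THEN conjunct1]
    and self = ok'[THEN conjunct2, THEN conjunct2, THEN conjunct1]
    and pts = ok'[THEN conjunct2, THEN conjunct2, THEN conjunct2, THEN conjunct1]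
    and nd = ok'[THEN conjunct2, THEN conjunct2, THEN conjunct2, THEN conjunct2, THEN conjunct1]
    and range = ok'[THEN conjunct2, THEN conjunct2, THEN conjunct2, THEN conjunct2, THEN conjunct2, THEN conjunct1]
    and inc = ok'[THEN conjunct2, THEN conjunct2, THEN conjunct2, THEN conjunct2, THEN conjunct2, THEN conjunct2]
  have S_in: "?S k \<in> set torus_segments" if "k < 39" for k using that len by simp
  have P_in: "?P v \<in> set torus_points" if "v < 27" for v using that len by simp
  have apart: "shifted_segments_apart k (?S i) (?S j)" if "i < j" "j < 39" "k \<in> ?K" for i j k
    using sorted_wrt_nth_less[OF bspec[OF sw that(3)] that(1)] that(2) len by simp
  have Sb: "-6 \<le> Re (segment_point (ipoints_complex (?S k)) u) \<and> Re (segment_point (ipoints_complex (?S k)) u) \<le> 13 \<and>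
      -6 \<le> Im (segment_point (ipoints_complex (?S k)) u) \<and> Im (segment_point (ipoints_complex (?S k)) u) \<le> 13"
    if "k < 39" "u \<in> {0<..<1}" for k u
  proof -
    have *: "-6 \<le> (1 - u) * real_of_int a + u * real_of_int b \<and> (1 - u) * real_of_int a + u * real_of_int b \<le> 13"
      if "-6 \<le> a" "a \<le> 13" "-6 \<le> b" "b \<le> 13" for a b
      using convex_combination_bounds[of u "-6" "of_int a" 13 "of_int b"] that \<open>u \<in> {0<..<1}\<close> by simp
    have "-6 \<le> fst (fst (?S k)) \<and> fst (fst (?S k)) \<le> 13 \<and> -6 \<le> snd (fst (?S k)) \<and> snd (fst (?S k)) \<le> 13 \<and>
        -6 \<le> fst (snd (?S k)) \<and> fst (snd (?S k)) \<le> 13 \<and> -6 \<le> snd (snd (?S k)) \<and> snd (snd (?S k)) \<le> 13"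
      using bspec[OF nd S_in[OF that(1)]] by (simp add: split_beta)
    then show ?thesis using *[of "fst (fst (?S k))" "fst (snd (?S k))"] *[of "snd (fst (?S k))" "snd (snd (?S k))"]
      by (simp add: ipoint_complex_def)
  qed
  have Pb: "-6 \<le> Re (ipoint_complex (?P v)) \<and> Re (ipoint_complex (?P v)) \<le> 13 \<and>
      -6 \<le> Im (ipoint_complex (?P v)) \<and> Im (ipoint_complex (?P v)) \<le> 13" if "v < 27" for v
    using bspec[OF range P_in[OF that]] by (simp add: split_beta ipoint_complex_def)
  \<comment> \<open>Segments that meet after the shift \<open>k\<close> meet in the opposite order
    after the shift \<open>- k\<close>, which reduces every pair to list order.\<close>
  have neg: "ipoint_complex k + ipoint_complex (- fst k, - snd k) = 0" "(- fst k, - snd k) \<in> ?K" if "k \<in> ?K" for k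
  proof -
    show "ipoint_complex k + ipoint_complex (- fst k, - snd k) = 0" by (simp add: ipoint_complex_def complex_eq_iff)
    have "\<forall>k\<in>?K. (- fst k, - snd k) \<in> ?K" by (simp add: nonzero_shifts_def)
    then show "(- fst k, - snd k) \<in> ?K" using that by (rule bspec)
  qed
  show ?thesis
  proof (rule embeddable_in_segments[where \<Phi> = "\<lambda>z. torus_map (z / 18)" and s = "\<lambda>k. ipoints_complex (?S k)"
        and pos = "\<lambda>v. torus_map (ipoint_complex (?P v) / 18)"])
    show "Hausdorff_space torus" by (rule Hausdorff_torus)
    show "inj_on template_edge {..<39}" by (rule inj_on_template_edge)
    show "(\<lambda>v. torus_map (ipoint_complex (?P v) / 18)) ` {..<27} \<subseteq> topspace torus"
      using torus_map_in_topspace by auto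
    have lt: "torus_map (ipoint_complex (?P v) / 18) \<noteq> torus_map (ipoint_complex (?P w) / 18)" if vw: "v < w" "w < 27" for v w
    proof
      assume "torus_map (ipoint_complex (?P v) / 18) = torus_map (ipoint_complex (?P w) / 18)"
      then obtain k where "ipoint_complex (?P v) / 18 = ipoint_complex (?P w) / 18 + lattice_point k"
        by (auto simp: torus_map_eq_iff)
      then have "ipoint_complex (?P v) = ipoint_complex (?P w) + 18 * lattice_point k" by (simp add: field_simps)
      then have "real_of_int (fst (?P v)) = real_of_int (fst (?P w) + 18 * fst k)" "real_of_int (snd (?P v)) = real_of_int (snd (?P w) + 18 * snd k)"
        by (simp_all add: ipoint_complex_def lattice_point_def complex_eq_iff)
      then have "fst (?P v) - fst (?P w) = 18 * fst k" "snd (?P v) - snd (?P w) = 18 * snd k"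
        unfolding of_int_eq_iff by simp_all
      then show False using sorted_wrt_nth_less[OF inc vw(1)] vw(2) len by simp
    qed
    show "inj_on (\<lambda>v. torus_map (ipoint_complex (?P v) / 18)) {..<27}"
      by (rule inj_onI) (metis lt lessThan_iff linorder_neqE_nat)
    fix k assume "k \<in> {..<39::nat}"
    then have k: "k < 39" by simp
    show "template_edge k \<subseteq> {..<27} \<and> card (template_edge k) = 2" using k by (rule template_edge_subset)
    show "{torus_map (fst (ipoints_complex (?S k)) / 18), torus_map (snd (ipoints_complex (?S k)) / 18)} =
        (\<lambda>v. torus_map (ipoint_complex (?P v) / 18)) ` template_edge k"
      using ends[OF k] by (simp add: template_edge_def)
    show "continuous_map (top_of_set (closed_segment (fst (ipoints_complex (?S k))) (snd (ipoints_complex (?S k))))) torus (\<lambda>z. torus_map (z / 18))"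
      by (intro continuous_map_torus_map continuous_intros) auto
    fix u :: real assume u: "u \<in> {0<..<1}"
    show "torus_map (segment_point (ipoints_complex (?S k)) u / 18) \<noteq> torus_map (ipoint_complex (?P v) / 18)" if "v \<in> {..<27}" for v
    proof
      assume eq: "torus_map (segment_point (ipoints_complex (?S k)) u / 18) = torus_map (ipoint_complex (?P v) / 18)"
      have v: "v < 27" using that by simp
      obtain l where l: "l \<in> ?K" "segment_point (ipoints_complex (?S k)) u = ipoint_complex (?P v) + ipoint_complex l"
        using torus_map_period_eqD[OF eq] Sb[OF k u] Pb[OF v] by metis
      have "shifted_point_apart l (?S k) (?P v)" using pts l(1) S_in[OF k] P_in[OF v] by blast
      then show False using shifted_point_apart_imp[OF _ u] nd S_in[OF k] l(2) by blast
    qed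
    fix j w assume "j \<in> {..<39::nat}" and w: "w \<in> {0<..<1::real}"
      and eq: "torus_map (segment_point (ipoints_complex (?S k)) u / 18) = torus_map (segment_point (ipoints_complex (?S j)) w / 18)"
    then have j: "j < 39" by simp
    obtain l where l: "l \<in> ?K" "segment_point (ipoints_complex (?S k)) u = segment_point (ipoints_complex (?S j)) w + ipoint_complex l"
      using torus_map_period_eqD[OF eq] Sb[OF k u] Sb[OF j w] by metis
    have "\<not> k < j" using shifted_segments_apart_imp[OF apart[OF _ j l(1)] u w] l(2) by blast
    moreover have "\<not> j < k"
    proof
      assume "j < k"
      have "segment_point (ipoints_complex (?S j)) w = segment_point (ipoints_complex (?S k)) u + ipoint_complex (- fst l, - snd l)"
        using l(2) neg(1)[OF l(1)] by (simp add: add.assoc)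
      then show False using shifted_segments_apart_imp[OF apart[OF \<open>j < k\<close> k neg(2)[OF l(1)]] w u] by blast
    qed
    ultimately have "k = j" by simp
    \<comment> \<open>A segment meets none of its own proper translates, so equal images on the
      torus come from equal points of the straight segment, where the parameter is unique.\<close>
    have "l \<notin> set nonzero_shifts"
    proof
      assume "l \<in> set nonzero_shifts"
      then have "shifted_segments_apart l (?S k) (?S k)" using self S_in[OF k] by blast
      from shifted_segments_apart_imp[OF this u w] show False using l(2) \<open>k = j\<close> by simp
    qed
    then have "l = (0, 0)" using l(1) by simp
    then have "homogeneous (segment_point (ipoints_complex (?S k)) u) = homogeneous (segment_point (ipoints_complex (?S k)) w)"
    proof -
      have "ipoint_complex (0, 0) = 0" by (simp add: ipoint_complex_def complex_eq_iff)
      then show ?thesis using l(2) \<open>k = j\<close> \<open>l = (0, 0)\<close> by simp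
    qed
    then have "segment_point (ivecs (map_prod ihom ihom (?S k))) u = 1 *\<^sub>R segment_point (ivecs (map_prod ihom ihom (?S k))) w"
      unfolding homogeneous_segment_point by simp
    moreover have "icross (fst (map_prod ihom ihom (?S k))) (snd (map_prod ihom ihom (?S k))) \<noteq> (0, 0, 0)"
      using bspec[OF nd S_in[OF k]] by (cases "?S k"; cases "fst (?S k)"; cases "snd (?S k)") auto
    ultimately have "u = w" by (rule segment_point_inject)
    then show "k = j \<and> u = w" using \<open>k = j\<close> by simp
  qed
qed

section \<open>The prime power case\<close>

text \<open>One infinite plane graph receives the incidence graphs of all prime powers, whose
  numbers of hyperedges are unbounded. So a single drawing has to be checked.\<close>

datatype template_vertex = Apex | Left_base | Right_base | Hub int | Leaf int

datatype template_arc = Apex_arc int | Left_arc int | Right_arc int | Leaf_arc int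

fun planar_position :: "template_vertex \<Rightarrow> complex" where
  "planar_position Apex = Complex 0 1"
| "planar_position Left_base = Complex (-1) (-1)"
| "planar_position Right_base = Complex 1 (-1)"
| "planar_position (Hub z) = Complex (of_int z) 0"
| "planar_position (Leaf z) = Complex (of_int z + 1/3) 0"

fun planar_ends :: "template_arc \<Rightarrow> template_vertex \<times> template_vertex" where
  "planar_ends (Apex_arc z) = (Apex, Hub z)"
| "planar_ends (Left_arc z) = (Left_base, Hub z)"
| "planar_ends (Right_arc z) = (Right_base, Hub z)"
| "planar_ends (Leaf_arc z) = (Hub z, Leaf z)"

definition planar_edge :: "template_arc \<Rightarrow> template_vertex set" where
  "planar_edge a = {fst (planar_ends a), snd (planar_ends a)}"

text \<open>Each base, below the axis, is joined only to the hubs on its own side and to hub 0, so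
  that edges from the two bases cannot cross. Hub 0 alone sees both.\<close>

definition planar_arcs :: "template_arc set" where
  "planar_arcs = range Apex_arc \<union> Left_arc ` {..0} \<union> Right_arc ` {0..} \<union> range Leaf_arc"

definition planar_segment :: "template_arc \<Rightarrow> complex \<times> complex" where
  "planar_segment a = (planar_position (fst (planar_ends a)), planar_position (snd (planar_ends a)))"

lemma planar_segment_points:
  "segment_point (planar_segment (Apex_arc z)) u = Complex (u * of_int z) (1 - u)"
  "segment_point (planar_segment (Left_arc z)) u = Complex (u * of_int z - (1 - u)) (u - 1)"
  "segment_point (planar_segment (Right_arc z)) u = Complex (u * of_int z + (1 - u)) (u - 1)"
  "segment_point (planar_segment (Leaf_arc z)) u = Complex (of_int z + u / 3) 0"
  by (simp_all add: planar_segment_def complex_eq_iff algebra_simps)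

lemma inj_planar_position: "inj planar_position"
proof -
  have frac: "real_of_int z \<noteq> of_int w + 1/3" for z w
  proof
    assume "real_of_int z = of_int w + 1/3"
    then have "real_of_int (3 * z) = of_int (3 * w + 1)" by simp
    then have "3 * z = 3 * w + 1" by (simp only: of_int_eq_iff)
    then show False by presburger
  qed
  have "planar_position v = planar_position w \<Longrightarrow> v = w" for v w
    using frac frac[symmetric] by (cases v; cases w) (auto simp: complex_eq_iff)
  then show ?thesis by (rule injI)
qed

lemma int_offset_eqD:
  fixes a b :: real
  assumes "of_int z + a = of_int w + b" "0 \<le> a" "a < 1" "0 \<le> b" "b < 1"
  shows "z = w \<and> a = b"
proof -
  have "\<lfloor>of_int z + a\<rfloor> = z" "\<lfloor>of_int w + b\<rfloor> = w" using assms(2-5) by (simp_all add: floor_eq_iff)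
  then have "z = w" using assms(1) by simp
  then show ?thesis using assms(1) by simp
qed

text \<open>The real axis separates the edges at the apex from those at the bases, leaf edges lie on
  it, and edges at the two bases lie on opposite sides of the imaginary axis. For edges at one
  common outer vertex, the imaginary part gives \<open>u = w\<close> and then the real part
  determines the hub.\<close>

lemma planar_segments_disjoint:
  assumes "a \<in> planar_arcs" "b \<in> planar_arcs" and u: "u \<in> {0<..<1}" and w: "w \<in> {0<..<1}"
    and eq: "segment_point (planar_segment a) u = segment_point (planar_segment b) w"
  shows "a = b \<and> u = w"
proof -
  have mixed: False if "x \<le> 0" "0 \<le> y" "u * of_int x - (1 - u) = u * of_int y + (1 - u)" for x y
  proof -
    have "u * real_of_int x \<le> 0" "0 \<le> u * real_of_int y" using that u by (auto simp: mult_le_0_iff)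
    then show False using that(3) u by simp
  qed
  have leaf: "x = y \<and> u = w" if "real_of_int x + u / 3 = of_int y + w / 3" for x y
    using int_offset_eqD[OF that] u w by simp
  show ?thesis
    using assms(1,2) eq u w mixed leaf mixed[OF _ _ sym]
    unfolding planar_arcs_def
    by (elim UnE imageE; simp only: planar_segment_points complex.inject) auto
qed

lemma planar_segments_avoid:
  assumes "a \<in> planar_arcs" and u: "u \<in> {0<..<1}"
  shows "segment_point (planar_segment a) u \<noteq> planar_position v"
proof
  assume eq: "segment_point (planar_segment a) u = planar_position v"
  have hub: False if "real_of_int x + u / 3 = of_int y" for x y
    using int_offset_eqD[of x "u / 3" y 0] that u by simp
  have leaf: False if "real_of_int x + u / 3 = of_int y + 1 / 3" for x y
    using int_offset_eqD[of x "u / 3" y "1 / 3"] that u by simp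
  show False
    using eq u hub leaf by (cases a; cases v; simp only: planar_segment_points planar_position.simps complex.inject) auto
qed

lemma planar_template_embeddable:
  fixes \<Phi> :: "complex \<Rightarrow> 'p"
  assumes "continuous_map euclidean X \<Phi>" "inj \<Phi>" "Hausdorff_space X"
  shows "embeddable_in X (UNIV, planar_edge ` planar_arcs)"
proof (rule embeddable_in_segments[where \<Phi> = \<Phi> and s = planar_segment and pos = "\<Phi> \<circ> planar_position"])
  show "inj_on (\<Phi> \<circ> planar_position) UNIV" using assms(2) inj_planar_position by (simp add: inj_compose)
  show "(\<Phi> \<circ> planar_position) ` UNIV \<subseteq> topspace X"
    using continuous_map_image_subset_topspace[OF assms(1)] by auto
  show "inj_on planar_edge planar_arcs"
  proof (rule inj_onI)
    fix a b assume "planar_edge a = planar_edge b"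
    then show "a = b" by (cases a; cases b) (auto simp: planar_edge_def doubleton_eq_iff)
  qed
  show "planar_edge a \<subseteq> UNIV \<and> card (planar_edge a) = 2" for a by (cases a) (auto simp: planar_edge_def)
  show "{\<Phi> (fst (planar_segment a)), \<Phi> (snd (planar_segment a))} = (\<Phi> \<circ> planar_position) ` planar_edge a" for a
    by (simp add: planar_segment_def planar_edge_def)
  show "continuous_map (top_of_set (closed_segment (fst (planar_segment a)) (snd (planar_segment a)))) X \<Phi>" for a
    using assms(1) by (rule continuous_map_from_subtopology)
  show "a = b \<and> u = w" if "a \<in> planar_arcs" "b \<in> planar_arcs" "u \<in> {0<..<1}" "w \<in> {0<..<1}"
      "\<Phi> (segment_point (planar_segment a) u) = \<Phi> (segment_point (planar_segment b) w)" for a b u w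
    using planar_segments_disjoint[OF that(1-4)] that(5) assms(2) by (simp add: inj_eq)
  show "\<Phi> (segment_point (planar_segment a) u) \<noteq> (\<Phi> \<circ> planar_position) v" if "a \<in> planar_arcs" "u \<in> {0<..<1}" for a v u
    using planar_segments_avoid[OF that] assms(2) by (simp add: inj_eq)
qed (rule assms(3))

lemma planar_template_torus: "embeddable_in torus (UNIV, planar_edge ` planar_arcs)"
proof (rule planar_template_embeddable[OF _ _ Hausdorff_torus])
  \<comment> \<open>\<open>arctan\<close> shrinks the plane to an open square of side 1, on which
    \<open>torus_map\<close> is injective.\<close>
  define h :: "complex \<Rightarrow> complex" where "h z = Complex (arctan (Re z) / pi) (arctan (Im z) / pi)" for z
  have "continuous_on UNIV h" unfolding h_def Complex_eq by (intro continuous_intros) auto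
  then show "continuous_map euclidean torus (\<lambda>z. torus_map (h z))"
    using continuous_map_torus_map[of UNIV h] by simp
  have bound: "\<bar>arctan x / pi\<bar> < 1/2" for x
  proof -
    have "arctan x / pi < 1/2" "- (1/2) < arctan x / pi" using arctan_bounded[of x] by (simp_all add: field_simps)
    then show ?thesis by linarith
  qed
  have eqD: "x = y" if "arctan x / pi = arctan y / pi + of_int k" for x y k
  proof -
    have "\<bar>real_of_int k\<bar> < 1" using that bound[of x] bound[of y] by linarith
    then have "k = 0" by linarith
    then show ?thesis using that by (simp add: arctan_eq_iff)
  qed
  show "inj (\<lambda>z. torus_map (h z))"
  proof (rule injI)
    fix x y assume "torus_map (h x) = torus_map (h y)"
    then obtain k where "h x = h y + lattice_point k" unfolding torus_map_eq_iff by blast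
    then show "x = y" using eqD by (auto simp: h_def lattice_point_def complex_eq_iff)
  qed
qed

lemma planar_template_projective_plane: "embeddable_in projective_plane (UNIV, planar_edge ` planar_arcs)"
proof (rule planar_template_embeddable[OF _ _ Hausdorff_projective_plane])
  \<comment> \<open>The affine chart of the projective plane: the line through \<open>h z\<close>
    determines \<open>z\<close> because the last coordinate is 1.\<close>
  define h :: "complex \<Rightarrow> real ^ 3" where "h z = vector [Re z, Im z, 1]" for z
  have comp: "h z = (\<chi> i. if i = 1 then Re z else if i = 2 then Im z else 1)" for z
    by (simp add: h_def vec_eq_iff forall_3)
  have "continuous_on UNIV h" unfolding comp
  proof (intro continuous_on_vec_lambda)
    show "continuous_on UNIV (\<lambda>z. if i = 1 then Re z else if i = 2 then Im z else 1)" for i :: 3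
      by (cases "i = 1"; cases "i = 2") (simp_all add: continuous_on_Re continuous_on_Im)
  qed
  moreover have nz: "h z \<noteq> 0" for z by (simp add: h_def vec_eq_iff forall_3)
  ultimately have "continuous_map euclidean (top_of_set (- {0})) h"
    by (auto simp: continuous_map_in_subtopology)
  then have "continuous_map euclidean projective_plane (projective_point \<circ> h)"
    using continuous_map_projective_point by (rule continuous_map_compose) simp
  then show "continuous_map euclidean projective_plane (\<lambda>z. projective_point (h z))" by (simp add: o_def)
  show "inj (\<lambda>z. projective_point (h z))"
  proof (rule injI)
    fix x y assume "projective_point (h x) = projective_point (h y)"
    then obtain c where "h x = c *\<^sub>R h y" using projective_point_eqD nz by metis
    then show "x = y" by (auto simp: h_def vec_eq_iff forall_3 complex_eq_iff)
  qed
qed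

section \<open>Incidence graphs inside a template\<close>

lemma pairwise_comaximal_insertI:
  assumes "pairwise_comaximal G E" "\<And>K. K \<in> E \<Longrightarrow> K \<noteq> H \<Longrightarrow> H <#>\<^bsub>G\<^esub> K = carrier G \<and> K <#>\<^bsub>G\<^esub> H = carrier G"
  shows "pairwise_comaximal G (insert H E)"
  using assms unfolding pairwise_comaximal_def by (metis insert_iff)

lemma comaximal_hyperedge_memI:
  assumes "E \<in> comaximal_hyperedges G" "H \<in> comaximal_vertices G"
    and "\<And>K. K \<in> E \<Longrightarrow> K \<noteq> H \<Longrightarrow> H <#>\<^bsub>G\<^esub> K = carrier G \<and> K <#>\<^bsub>G\<^esub> H = carrier G"
  shows "H \<in> E"
proof -
  have "pairwise_comaximal G (insert H E)"
  proof (rule pairwise_comaximal_insertI)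
    show "pairwise_comaximal G E" using assms(1) by (simp add: comaximal_hyperedges_def)
  qed (rule assms(3))
  moreover have "insert H E \<subseteq> comaximal_vertices G"
    using assms(2) comaximal_hyperedge_subset[OF assms(1)] by simp
  ultimately have "E = insert H E" by (intro comaximal_hyperedge_maximal[OF assms(1)] subset_insertI)
  then show ?thesis using insertI1[of H E] by simp
qed

lemma embeddable_incidence_graph:
  assumes emb: "embeddable_in X (W, F)"
    and inj: "inj_on f (comaximal_vertices G)" "inj_on g (comaximal_hyperedges G)"
    and fg: "\<And>H E. H \<in> comaximal_vertices G \<Longrightarrow> E \<in> comaximal_hyperedges G \<Longrightarrow> f H \<noteq> g E"
    and W: "\<And>H. H \<in> comaximal_vertices G \<Longrightarrow> f H \<in> W" "\<And>E. E \<in> comaximal_hyperedges G \<Longrightarrow> g E \<in> W"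
    and inc: "\<And>H E. E \<in> comaximal_hyperedges G \<Longrightarrow> H \<in> E \<Longrightarrow> {f H, g E} \<in> F"
  shows "embeddable_in X (incidence_graph (comaximal_hypergraph G))"
  unfolding incidence_graph_eq
proof (rule embeddable_in_mono[OF emb, where f = "case_sum f g"])
  show "inj_on (case_sum f g) (fst (comaximal_hypergraph G) <+> snd (comaximal_hypergraph G))"
  proof (rule inj_onI)
    fix x y
    assume x: "x \<in> fst (comaximal_hypergraph G) <+> snd (comaximal_hypergraph G)"
      and y: "y \<in> fst (comaximal_hypergraph G) <+> snd (comaximal_hypergraph G)"
      and eq: "case_sum f g x = case_sum f g y"
    show "x = y"
    proof (cases x; cases y)
      fix H K assume "x = Inl H" "y = Inl K"
      then show ?thesis using x y eq inj_onD[OF inj(1), of H K] by (simp add: comaximal_hypergraph_def Plus_def image_iff)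
    next
      fix H E assume "x = Inl H" "y = Inr E"
      then show ?thesis using x y eq fg[of H E] by (simp add: comaximal_hypergraph_def Plus_def image_iff)
    next
      fix H E assume "x = Inr E" "y = Inl H"
      then show ?thesis using x y eq fg[of H E] by (simp add: comaximal_hypergraph_def Plus_def image_iff)
    next
      fix E E' assume "x = Inr E" "y = Inr E'"
      then show ?thesis using x y eq inj_onD[OF inj(2), of E E'] by (simp add: comaximal_hypergraph_def Plus_def image_iff)
    qed
  qed
  show "case_sum f g ` (fst (comaximal_hypergraph G) <+> snd (comaximal_hypergraph G)) \<subseteq> W"
    using W by (auto simp: comaximal_hypergraph_def)
  show "e \<subseteq> fst (comaximal_hypergraph G) <+> snd (comaximal_hypergraph G) \<and> case_sum f g ` e \<in> F"
    if "e \<in> incidence_edges (comaximal_hypergraph G)" for e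
    using incidence_edges_subset[OF that] that inc by (auto simp: incidence_edges_def comaximal_hypergraph_def)
qed

lemma planar_edge_simps:
  "{Apex, Hub z} \<in> planar_edge ` planar_arcs" "{Leaf z, Hub z} \<in> planar_edge ` planar_arcs"
  "z \<le> 0 \<Longrightarrow> {Left_base, Hub z} \<in> planar_edge ` planar_arcs"
  "0 \<le> z \<Longrightarrow> {Right_base, Hub z} \<in> planar_edge ` planar_arcs"
proof -
  have "planar_edge a \<in> planar_edge ` planar_arcs" if "a \<in> planar_arcs" for a using that by blast
  from this[of "Apex_arc z"] this[of "Leaf_arc z"] this[of "Left_arc z"] this[of "Right_arc z"]
  show "{Apex, Hub z} \<in> planar_edge ` planar_arcs" "{Leaf z, Hub z} \<in> planar_edge ` planar_arcs"
    "z \<le> 0 \<Longrightarrow> {Left_base, Hub z} \<in> planar_edge ` planar_arcs"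
    "0 \<le> z \<Longrightarrow> {Right_base, Hub z} \<in> planar_edge ` planar_arcs"
    by (simp_all add: planar_edge_def planar_arcs_def insert_commute)
qed

lemma planar_vertex_cases:
  assumes "(if H = A then Apex else if H = B then Left_base else if H = C then Right_base else Leaf (z H))
    = (if K = A then Apex else if K = B then Left_base else if K = C then Right_base else Leaf (z K))"
  shows "H = K \<or> H \<notin> {A, B, C} \<and> K \<notin> {A, B, C} \<and> z H = z K"
  using assms by (simp split: if_splits)

text \<open>The apex stands for \<open>A\<close>, the two bases for \<open>B\<close> and \<open>C\<close>, the leaves for the other vertices; the hub
  next to a leaf is the unique hyperedge through that vertex, and the hub at \<open>0\<close> is \<open>{A, B, C}\<close>.\<close>

lemma embeddable_planar_template:
  fixes G :: "('a, 'b) monoid_scheme"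
  assumes emb: "embeddable_in X (UNIV, planar_edge ` planar_arcs)" and fin: "finite (carrier G)"
    and A: "A \<in> comaximal_vertices G" "\<And>H. H \<in> comaximal_vertices G \<Longrightarrow> H \<noteq> A \<Longrightarrow> A <#>\<^bsub>G\<^esub> H = carrier G \<and> H <#>\<^bsub>G\<^esub> A = carrier G"
    and BC: "B \<in> comaximal_vertices G \<Longrightarrow> C \<in> comaximal_vertices G \<Longrightarrow> B <#>\<^bsub>G\<^esub> C = carrier G \<and> C <#>\<^bsub>G\<^esub> B = carrier G"
    and dist: "A \<noteq> B" "A \<noteq> C" "B \<noteq> C"
    and rest: "\<And>H K. H \<in> comaximal_vertices G - {A, B, C} \<Longrightarrow> K \<in> comaximal_vertices G - {A, B, C} \<Longrightarrow>
        H \<noteq> K \<Longrightarrow> H <#>\<^bsub>G\<^esub> K \<noteq> carrier G"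
    and one: "\<And>H. H \<in> comaximal_vertices G - {A, B, C} \<Longrightarrow> B \<in> comaximal_vertices G \<Longrightarrow> C \<in> comaximal_vertices G \<Longrightarrow>
        H <#>\<^bsub>G\<^esub> B \<noteq> carrier G \<or> H <#>\<^bsub>G\<^esub> C \<noteq> carrier G"
  shows "embeddable_in X (incidence_graph (comaximal_hypergraph G))"
proof -
  let ?V = "comaximal_vertices G"
  define O' where "O' = ?V - {A, B, C}"
  have "finite O'" unfolding O'_def using finite_comaximal_vertices[OF fin] by simp
  then obtain m :: "'a set \<Rightarrow> nat" where m: "inj_on m O'" using finite_imp_inj_to_nat_seg by metis
  \<comment> \<open>The sign tells which of \<open>B\<close> and \<open>C\<close> can share a
    hyperedge with \<open>H\<close>: negative hubs see the left base, positive ones the right base.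
    \<open>Suc\<close> keeps 0 free for the hyperedge without further vertices.\<close>
  define z where "z H = (if H <#>\<^bsub>G\<^esub> B = carrier G \<and> B \<in> ?V then - int (Suc (m H)) else int (Suc (m H)))" for H
  have z0: "z H \<noteq> 0" for H by (simp add: z_def)
  have zinj: "H = K" if "H \<in> O'" "K \<in> O'" "z H = z K" for H K
  proof -
    have "m H = m K" using that(3) by (auto simp: z_def split: if_splits)
    then show ?thesis using m that by (auto dest: inj_onD)
  qed
  define f where "f H = (if H = A then Apex else if H = B then Left_base else if H = C then Right_base else Leaf (z H))" for H
  define g where "g E = (if \<exists>H. H \<in> E \<inter> O' then Hub (z (THE H. H \<in> E \<inter> O')) else Hub 0)" for E
  have uniq: "H = K" if "E \<in> comaximal_hyperedges G" "H \<in> E \<inter> O'" "K \<in> E \<inter> O'" for E H K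
  proof (rule ccontr)
    assume "H \<noteq> K"
    then show False
      using pairwise_comaximal_hyperedgeD[OF that(1), of H K] rest[of H K] that(2,3) by (auto simp: O'_def)
  qed
  have g1: "g E = Hub (z H)" if E: "E \<in> comaximal_hyperedges G" "H \<in> E \<inter> O'" for E H
  proof -
    have "(THE H. H \<in> E \<inter> O') = H" using E uniq[OF E(1)] by (intro the_equality) auto
    then show ?thesis using E(2) by (auto simp: g_def)
  qed
  have g0: "g E = Hub 0" if "E \<inter> O' = {}" for E using that by (auto simp: g_def)
  have AE: "A \<in> E" if E: "E \<in> comaximal_hyperedges G" for E
    using comaximal_hyperedge_memI[OF E A(1)] A(2) comaximal_hyperedge_subset[OF E] by blast
  have sub: "E \<subseteq> ({A, B, C} \<inter> ?V) \<union> (E \<inter> O')" if E: "E \<in> comaximal_hyperedges G" for E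
    using comaximal_hyperedge_subset[OF E] by (auto simp: O'_def)
  have zB: "z H < 0" if "E \<in> comaximal_hyperedges G" "H \<in> E \<inter> O'" "B \<in> E" for E H
    using pairwise_comaximal_hyperedgeD[OF that(1), of H B] that comaximal_hyperedge_subset[OF that(1)]
    by (auto simp: z_def O'_def)
  have zC: "z H > 0" if "E \<in> comaximal_hyperedges G" "H \<in> E \<inter> O'" "C \<in> E" for E H
    using pairwise_comaximal_hyperedgeD[OF that(1), of H C] that comaximal_hyperedge_subset[OF that(1)] one[of H]
    by (auto simp: z_def O'_def)
  \<comment> \<open>A hub determines its hyperedge. At 0, both hyperedges lie in the clique of those
    among \<open>A\<close>, \<open>B\<close>, \<open>C\<close> that are vertices. Elsewhere both
    contain \<open>A\<close> and the same \<open>H\<close>, and by the sign of \<open>z H\<close>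
    only one of \<open>B\<close> and \<open>C\<close> can occur in either of them; so one contains
    the other, and maximality makes them equal.\<close>
  have eqE: "E = E'" if E: "E \<in> comaximal_hyperedges G" and E': "E' \<in> comaximal_hyperedges G" and g: "g E = g E'" for E E'
  proof (cases "E \<inter> O' = {}")
    case True
    have "E' \<inter> O' = {}"
    proof (rule ccontr)
      assume "E' \<inter> O' \<noteq> {}"
      then obtain H where "H \<in> E' \<inter> O'" by blast
      then show False using g1[OF E', of H] g0[OF True] g z0[of H] by simp
    qed
    let ?Q = "{A, B, C} \<inter> ?V"
    have "pairwise_comaximal G ?Q"
      unfolding pairwise_comaximal_def
    proof (intro ballI impI)
      fix H K assume HK: "H \<in> ?Q" "K \<in> ?Q" "H \<noteq> K"
      then have V: "H \<in> ?V" "K \<in> ?V" by simp_all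
      consider "H = A" | "K = A" | "H = B" "K = C" | "H = C" "K = B" using HK by fast
      then show "H <#>\<^bsub>G\<^esub> K = carrier G"
      proof cases
        case 1 then show ?thesis using A(2)[OF V(2)] HK(3) by simp
      next
        case 2 then show ?thesis using A(2)[OF V(1)] HK(3) by simp
      next
        case 3 then show ?thesis using BC V by simp
      next
        case 4 then show ?thesis using BC V by simp
      qed
    qed
    moreover have "E \<subseteq> ?Q" "E' \<subseteq> ?Q" using sub[OF E] sub[OF E'] True \<open>E' \<inter> O' = {}\<close> by auto
    ultimately show ?thesis
      using comaximal_hyperedge_maximal[OF E] comaximal_hyperedge_maximal[OF E'] by (metis Int_lower2)
  next
    case False
    then obtain H where H: "H \<in> E \<inter> O'" by blast
    have "E' \<inter> O' \<noteq> {}"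
    proof
      assume "E' \<inter> O' = {}"
      then show False using g1[OF E H] g0[of E'] g z0[of H] by simp
    qed
    then obtain K where K: "K \<in> E' \<inter> O'" by blast
    have "z H = z K" using g1[OF E H] g1[OF E' K] g by simp
    then have "H = K" using zinj H K by blast
    then have HE: "E \<inter> O' = {H}" "E' \<inter> O' = {H}" using uniq[OF E] uniq[OF E'] H K by blast+
    have excl: "B \<notin> E \<or> C \<notin> E'" "C \<notin> E \<or> B \<notin> E'" "B \<notin> E \<or> C \<notin> E" "B \<notin> E' \<or> C \<notin> E'"
      using zB[OF E H] zC[OF E H] zB[OF E' K] zC[OF E' K] \<open>H = K\<close> by auto
    have mem: "x = A \<or> x = B \<or> x = C \<or> x = H" if "x \<in> E \<or> x \<in> E'" for x
    proof -
      have "x \<in> insert A (insert B (insert C (insert H {})))"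
        using that subsetD[OF sub[OF E], of x] subsetD[OF sub[OF E'], of x] unfolding HE by (elim disjE; simp; metis)
      then show ?thesis by simp
    qed
    have HEE: "H \<in> E" "H \<in> E'" using H K \<open>H = K\<close> by simp_all
    have "E \<subseteq> E' \<or> E' \<subseteq> E"
    proof (rule ccontr)
      assume "\<not> (E \<subseteq> E' \<or> E' \<subseteq> E)"
      then have "\<not> E \<subseteq> E'" "\<not> E' \<subseteq> E" by simp_all
      then obtain x y where x: "x \<in> E" "x \<notin> E'" and y: "y \<in> E'" "y \<notin> E" unfolding subset_iff by metis
      have "x = B \<or> x = C" using mem[of x] x AE[OF E'] HEE(2) by metis
      moreover have "y = B \<or> y = C" using mem[of y] y AE[OF E] HEE(1) by metis
      ultimately show False using x y excl by metis
    qed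
    then show ?thesis
    proof
      assume "E \<subseteq> E'"
      then show ?thesis
        using E' by (intro comaximal_hyperedge_maximal[OF E]) (simp_all add: comaximal_hyperedges_def)
    next
      assume "E' \<subseteq> E"
      then have "E' = E"
        using E by (intro comaximal_hyperedge_maximal[OF E']) (simp_all add: comaximal_hyperedges_def)
      then show ?thesis by (rule sym)
    qed
  qed
  have gHub: "\<exists>w. g E = Hub w" for E by (simp add: g_def)
  show ?thesis
  proof (rule embeddable_incidence_graph[OF emb, where f = f and g = g])
    show "inj_on f ?V"
    proof (rule inj_onI)
      fix H K assume HK: "H \<in> ?V" "K \<in> ?V" "f H = f K"
      from planar_vertex_cases[OF HK(3)[unfolded f_def]] show "H = K"
      proof
        assume "H \<notin> {A, B, C} \<and> K \<notin> {A, B, C} \<and> z H = z K"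
        then show ?thesis using HK(1,2) by (intro zinj) (simp_all add: O'_def)
      qed
    qed
    show "inj_on g (comaximal_hyperedges G)" by (intro inj_onI eqE)
    show "f H \<noteq> g E" for H E
    proof -
      from gHub obtain w where "g E = Hub w" by blast
      then show ?thesis by (simp add: f_def)
    qed
    fix H E assume E: "E \<in> comaximal_hyperedges G" "H \<in> E"
    then have "H \<in> ?V" using comaximal_hyperedge_subset by blast
    show "{f H, g E} \<in> planar_edge ` planar_arcs"
    proof (cases "E \<inter> O' = {}")
      case True
      then have "H \<notin> O'" using E(2) by blast
      then consider "H = A" | "H = B" | "H = C" using \<open>H \<in> ?V\<close> by (simp add: O'_def) metis
      then show ?thesis
        by cases (use g0[OF True] planar_edge_simps[of 0] dist in \<open>simp_all add: f_def\<close>)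
    next
      case False
      then obtain K where K: "K \<in> E \<inter> O'" by blast
      consider "H = A" | "H = B" | "H = C" | "H \<in> E \<inter> O'" using \<open>H \<in> ?V\<close> E(2) by (simp add: O'_def) metis
      then show ?thesis
      proof cases
        case 4
        then show ?thesis using g1[OF E(1) 4] planar_edge_simps(2)[of "z H"] by (simp add: f_def O'_def)
      qed (use g1[OF E(1) K] planar_edge_simps[of "z K"] zB[OF E(1) K] zC[OF E(1) K] E(2) dist in \<open>simp_all add: f_def\<close>)
    qed
  qed simp_all
qed

section \<open>Comaximal subgroups for prime powers\<close>

context dihedral_coordinates
begin

lemma rotations_1_comaximal_vertex:
  assumes "n \<ge> 2"
  shows "rotations 1 \<in> comaximal_vertices G"
proof -
  have "rotations 1 \<in> nontrivial_proper_subgroups G" "dihedrals (int n) 0 \<in> nontrivial_proper_subgroups G"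
    using assms by (auto intro!: rotations_nontrivial dihedrals_nontrivial)
  moreover have "rotations 1 <#> dihedrals (int n) 0 = carrier G" by (simp add: comaximal_rotations_dihedrals)
  ultimately show ?thesis unfolding comaximal_vertices_def by blast
qed

text \<open>The divisors of a prime power form a chain, and those above 1 are never coprime. So the
  comaximal pairs are those with \<open>rotations 1\<close> and those of dihedral subgroups whose
  parameters have gcd 2, where one parameter is then 2 itself.\<close>

lemma embeddable_primepow:
  assumes n: "n \<ge> 2" "primepow n" and emb: "embeddable_in X (UNIV, planar_edge ` planar_arcs)"
  shows "embeddable_in X (incidence_graph (comaximal_hypergraph G))"
proof -
  obtain p k where pk: "prime p" "k > 0" "n = p ^ k" using n(2) by (auto simp: primepow_def)
  have divp: "\<exists>j. d = int (p ^ j)" if "d dvd int n" "d > 0" for d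
  proof -
    have "nat d dvd p ^ k" using that pk(3) by (metis int_dvd_int_iff int_nat_eq less_imp_le nat_dvd_iff)
    then obtain j where "nat d = p ^ j" using divides_primepow_nat[OF pk(1)] by blast
    then have "d = int (p ^ j)" using that(2) by (metis int_nat_eq less_imp_le)
    then show ?thesis ..
  qed
  have ncop: "\<not> coprime d e" if "d dvd int n" "e dvd int n" "d > 1" "e > 1" for d e
  proof -
    from that obtain i j where ij: "d = int (p ^ i)" "e = int (p ^ j)" using divp[of d] divp[of e] by auto
    have "i \<noteq> 0" using that(3) ij(1) by (cases "i = 0") simp_all
    have "j \<noteq> 0" using that(4) ij(2) by (cases "j = 0") simp_all
    have "int p dvd d" "int p dvd e" using ij \<open>i \<noteq> 0\<close> \<open>j \<noteq> 0\<close> by (simp_all add: dvd_power)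
    moreover have "\<not> int p dvd 1" using prime_gt_1_nat[OF pk(1)] by simp
    ultimately show ?thesis by (meson coprime_common_divisor)
  qed
  have two: "d = 2 \<or> e = 2" if "d dvd int n" "e dvd int n" "d > 0" "e > 0" "gcd d e = 2" for d e
  proof -
    from that obtain i j where ij: "d = int (p ^ i)" "e = int (p ^ j)" using divp[of d] divp[of e] by auto
    then have "gcd d e = d \<or> gcd d e = e" by (cases "i \<le> j") (auto simp: gcd_int_int_eq le_imp_power_dvd gcd_proj1_iff gcd_proj2_iff)
    then show ?thesis using that(5) by auto
  qed
  have cases: "H = rotations 1 \<or> (\<exists>d i. d > 1 \<and> d dvd int n \<and> H = dihedrals d i)" if "H \<in> comaximal_vertices G" for H
  proof -
    from that obtain K where HK: "H \<in> nontrivial_proper_subgroups G" "K \<in> nontrivial_proper_subgroups G" "H <#> K = carrier G"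
      unfolding comaximal_vertices_def by blast
    from HK(1) show ?thesis
    proof (cases rule: nontrivial_proper_subgroup_cases)
      case (1 d)
      from HK(2) show ?thesis
      proof (cases rule: nontrivial_proper_subgroup_cases)
        case (1 e) then show ?thesis using HK(3) \<open>H = rotations d\<close> comaximal_rotations_rotations by metis
      next
        case (2 e i)
        then have "coprime d e" using HK(3) 1 comaximal_rotations_dihedrals by metis
        then have "\<not> d > 1" using ncop 1 2 by blast
        then have "d = 1" using 1 by linarith
        then show ?thesis using 1 by simp
      qed
    next
      case (2 d i) then show ?thesis by blast
    qed
  qed
  have D2: "dihedrals 2 i \<in> {dihedrals 2 0, dihedrals 2 1}" if "2 dvd int n" for i
    using that dihedrals_eq_iff[of 2 2 i 0] dihedrals_eq_iff[of 2 2 i 1] by (cases "even i") auto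
  \<comment> \<open>For odd \<open>n\<close> there are no subgroups with parameter 2; two distinct
    sets that are not vertices take their places.\<close>
  define B where "B = (if even n then dihedrals 2 0 else {})"
  define C where "C = (if even n then dihedrals 2 1 else {\<one>})"
  have "H \<noteq> {}" if "H \<in> comaximal_vertices G" for H
    using that by (auto simp: comaximal_vertices_def nontrivial_proper_subgroups_def dest: subgroup.one_closed)
  moreover have "H \<noteq> {\<one>}" if "H \<in> comaximal_vertices G" for H
    using that by (simp add: comaximal_vertices_def nontrivial_proper_subgroups_def)
  ultimately have BC_even: "even n" if "B \<in> comaximal_vertices G \<or> C \<in> comaximal_vertices G"
    using that by (auto simp: B_def C_def split: if_splits)
  have other: "\<exists>d i. d > 1 \<and> d \<noteq> 2 \<and> d dvd int n \<and> H = dihedrals d i"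
    if H: "H \<in> comaximal_vertices G - {rotations 1, B, C}" for H
  proof -
    from H cases[of H] obtain d i where di: "d > 1" "d dvd int n" "H = dihedrals d i" by blast
    have "d \<noteq> 2"
    proof
      assume "d = 2"
      then have "2 dvd int n" "even n" using di(2) by simp_all
      then have "H \<in> {B, C}" using D2[of i] di(3) \<open>d = 2\<close> by (simp add: B_def C_def)
      then show False using H by blast
    qed
    then show ?thesis using di by blast
  qed
  show ?thesis
  proof (rule embeddable_planar_template[OF emb finite_carrier, where A = "rotations 1" and B = B and C = C])
    show "rotations 1 \<in> comaximal_vertices G" using n(1) by (rule rotations_1_comaximal_vertex)
    show "rotations 1 <#> H = carrier G \<and> H <#> rotations 1 = carrier G" if "H \<in> comaximal_vertices G" "H \<noteq> rotations 1" for H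
    proof -
      from that cases obtain d i where "d dvd int n" "H = dihedrals d i" by blast
      then show ?thesis by (simp add: comaximal_rotations_dihedrals)
    qed
    show "B <#> C = carrier G \<and> C <#> B = carrier G" if "B \<in> comaximal_vertices G"
      using BC_even that by (simp add: B_def C_def comaximal_dihedrals_dihedrals)
    have "rot 1 \<in> rotations 1" "rot 1 \<noteq> \<one>"
      using n(1) by (simp_all flip: rot_0 add: rot_eq_iff)
    then have "rotations 1 \<noteq> {}" "rotations 1 \<noteq> {\<one>}" by blast+
    then show "rotations 1 \<noteq> B" "rotations 1 \<noteq> C" by (simp_all add: B_def C_def)
    show "B \<noteq> C" by (simp add: B_def C_def dihedrals_eq_iff)
    fix H assume "H \<in> comaximal_vertices G - {rotations 1, B, C}"
    then obtain d i where di: "d > 1" "d \<noteq> 2" "d dvd int n" "H = dihedrals d i" using other by blast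
    show "H <#> B \<noteq> carrier G \<or> H <#> C \<noteq> carrier G" if "B \<in> comaximal_vertices G"
    proof -
      have ev: "even n" using BC_even that by blast
      then have "\<not> coprime d 2" using di(1,3) by (intro ncop) simp_all
      then have "H <#> dihedrals 2 0 \<noteq> carrier G \<or> H <#> dihedrals 2 1 \<noteq> carrier G"
        using di(3,4) ev by (simp add: comaximal_dihedrals_dihedrals)
      then show ?thesis using ev by (simp add: B_def C_def)
    qed
    fix K assume "K \<in> comaximal_vertices G - {rotations 1, B, C}"
    then obtain e j where ej: "e > 1" "e \<noteq> 2" "e dvd int n" "K = dihedrals e j" using other by blast
    have "\<not> coprime d e" using di ej by (intro ncop)
    moreover have "gcd d e \<noteq> 2" using two[of d e] di ej by force
    ultimately show "H <#> K \<noteq> carrier G" using di ej by (simp add: comaximal_dihedrals_dihedrals)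
  qed
qed

end

section \<open>The dihedral group of order twelve\<close>

text \<open>A subgroup of the dihedral group is coded by \<open>(True, d, 0)\<close> if it is \<open>\<langle>a^d\<rangle>\<close>, and by
  \<open>(False, d, i)\<close> if it is \<open>\<langle>a^d, a^i b\<rangle>\<close>; the list follows the numbering of \<open>hex_edges\<close>.\<close>

definition hex_codes :: "(bool \<times> int \<times> int) list" where
  "hex_codes = [(True, 1, 0), (False, 2, 0), (False, 2, 1), (True, 2, 0), (True, 3, 0),
    (False, 3, 0), (False, 3, 1), (False, 3, 2),
    (False, 6, 0), (False, 6, 1), (False, 6, 2), (False, 6, 3), (False, 6, 4), (False, 6, 5)]"

section \<open>Cliques of subgroups for n = 6\<close>

fun code_comaximal :: "bool \<times> int \<times> int \<Rightarrow> bool \<times> int \<times> int \<Rightarrow> bool" where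
  "code_comaximal (r, d, i) (r', e, j) \<longleftrightarrow>
     (if r then \<not> r' \<and> gcd d e = 1 else if r' then gcd d e = 1
      else gcd d e = 1 \<or> gcd d e = 2 \<and> (i - j) mod 2 \<noteq> 0)"

definition hex_neighbours :: "nat \<Rightarrow> nat list" where
  "hex_neighbours a = filter (\<lambda>b. code_comaximal (hex_codes ! a) (hex_codes ! b)) [0..<14]"

definition hex_members :: "nat \<Rightarrow> nat list" where
  "hex_members k = map fst (filter (\<lambda>e. snd e = k) hex_edges)"

lemma hex_members_cliques:
  "\<forall>k\<in>set [14..<27]. \<forall>a\<in>set (hex_members k). \<forall>b\<in>set (hex_members k). a \<noteq> b \<longrightarrow> code_comaximal (hex_codes ! a) (hex_codes ! b)"
  by code_simp

lemma hex_neighbours_table: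
  "map hex_neighbours [0..<14] = [[1, 2, 5, 6, 7, 8, 9, 10, 11, 12, 13], [0, 2, 4, 5, 6, 7, 9, 11, 13],
    [0, 1, 4, 5, 6, 7, 8, 10, 12], [5, 6, 7], [1, 2], [0, 1, 2, 3], [0, 1, 2, 3], [0, 1, 2, 3],
    [0, 2], [0, 1], [0, 2], [0, 1], [0, 2], [0, 1]]"
  by code_simp

lemma hex_members_table:
  "map hex_members [14..<27] = [[0, 1, 2, 5], [0, 1, 2, 6], [0, 1, 2, 7], [3, 5], [3, 6], [3, 7], [4, 1, 2],
    [0, 2, 8], [0, 1, 9], [0, 2, 10], [0, 1, 11], [0, 2, 12], [0, 1, 13]]"
  by code_simp

text \<open>A clique lies within any of its members and the neighbours of that member. For 4 and for
  8 to 13 this set is already a listed clique. The neighbours 5, 6, 7 of 3 are not comaximal to each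
  other, so a clique with 3 contains at most one of them. Without 3, each of 5, 6, 7 sees just 0, 1,
  2.\<close>

lemma hex_clique_cases:
  assumes A: "A \<subseteq> {..<14}" and clique: "\<And>a b. a \<in> A \<Longrightarrow> b \<in> A \<Longrightarrow> a \<noteq> b \<Longrightarrow> code_comaximal (hex_codes ! a) (hex_codes ! b)"
  shows "\<exists>k\<in>{14..<27}. A \<subseteq> set (hex_members k)"
proof -
  have nb: "b = a \<or> b \<in> set (hex_neighbours a)" if "a \<in> A" "b \<in> A" for a b
    using clique[OF that] A that by (auto simp: hex_neighbours_def)
  have "[0..<14] = [0, 1, 2, 3, 4, 5, 6, 7, 8, 9, 10, 11, 12, 13::nat]" by (simp add: upt_rec)
  then have N: "hex_neighbours 3 = [5, 6, 7]" "hex_neighbours 4 = [1, 2]" "hex_neighbours 5 = [0, 1, 2, 3]"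
    "hex_neighbours 6 = [0, 1, 2, 3]" "hex_neighbours 7 = [0, 1, 2, 3]" "hex_neighbours 8 = [0, 2]" "hex_neighbours 9 = [0, 1]"
    "hex_neighbours 10 = [0, 2]" "hex_neighbours 11 = [0, 1]" "hex_neighbours 12 = [0, 2]" "hex_neighbours 13 = [0, 1]"
    using hex_neighbours_table by simp_all
  have "[14..<27] = [14, 15, 16, 17, 18, 19, 20, 21, 22, 23, 24, 25, 26::nat]" by (simp add: upt_rec)
  then have M: "hex_members 14 = [0, 1, 2, 5]" "hex_members 15 = [0, 1, 2, 6]" "hex_members 16 = [0, 1, 2, 7]"
    "hex_members 17 = [3, 5]" "hex_members 18 = [3, 6]" "hex_members 19 = [3, 7]" "hex_members 20 = [4, 1, 2]"
    "hex_members 21 = [0, 2, 8]" "hex_members 22 = [0, 1, 9]" "hex_members 23 = [0, 2, 10]" "hex_members 24 = [0, 1, 11]"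
    "hex_members 25 = [0, 2, 12]" "hex_members 26 = [0, 1, 13]"
    using hex_members_table by simp_all
  have sub: "A \<subseteq> insert a (set (hex_neighbours a))" if "a \<in> A" for a using nb[OF that] by blast
  have res: "\<exists>k\<in>{14..<27}. A \<subseteq> set (hex_members k)" if "A \<subseteq> set (hex_members k)" "k \<in> {14..<27}" for k
    using that by blast
  have triple: "A \<subseteq> {a, 0, 1, 2, 3}" if "a \<in> A" "a = 5 \<or> a = 6 \<or> a = 7" for a
    using sub[OF that(1)] that(2) N by auto
  consider "3 \<in> A" | "4 \<in> A" | "8 \<in> A" | "9 \<in> A" | "10 \<in> A" | "11 \<in> A" | "12 \<in> A" | "13 \<in> A"
    | "5 \<in> A" "3 \<notin> A" | "6 \<in> A" "3 \<notin> A" | "7 \<in> A" "3 \<notin> A" | "A \<subseteq> {0, 1, 2}"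
  proof -
    have "{..<14::nat} = {0, 1, 2, 3, 4, 5, 6, 7, 8, 9, 10, 11, 12, 13}" by auto presburger
    then have "A \<subseteq> {0, 1, 2}" if "{3, 4, 5, 6, 7, 8, 9, 10, 11, 12, 13} \<inter> A = {}" using A that by auto
    then show thesis using that by auto
  qed
  then show ?thesis
  proof cases
    case 1
    then have A3: "A \<subseteq> {3, 5, 6, 7}" using sub[OF 1] N by simp
    consider "5 \<in> A" | "6 \<in> A" | "7 \<in> A" | "A \<subseteq> {3}" using A3 by auto
    then show ?thesis
    proof cases
      case 1
      then have "A \<subseteq> {5, 0, 1, 2, 3} \<inter> {3, 5, 6, 7}" using triple[of 5] A3 by (intro Int_greatest) simp_all
      then have "A \<subseteq> {3, 5}" by simp
      then show ?thesis using M by (intro res[of 17]) simp_all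
    next
      case 2
      then have "A \<subseteq> {6, 0, 1, 2, 3} \<inter> {3, 5, 6, 7}" using triple[of 6] A3 by (intro Int_greatest) simp_all
      then have "A \<subseteq> {3, 6}" by simp
      then show ?thesis using M by (intro res[of 18]) simp_all
    next
      case 3
      then have "A \<subseteq> {7, 0, 1, 2, 3} \<inter> {3, 5, 6, 7}" using triple[of 7] A3 by (intro Int_greatest) simp_all
      then have "A \<subseteq> {3, 7}" by simp
      then show ?thesis using M by (intro res[of 19]) simp_all
    next
      case 4 then show ?thesis using M by (intro res[of 17]) auto
    qed
  next
    case 2 then show ?thesis using sub[OF 2] N M by (intro res[of 20]) simp_all
  next
    case 3 then show ?thesis using sub[OF 3] N M by (intro res[of 21]) auto
  next
    case 4 then show ?thesis using sub[OF 4] N M by (intro res[of 22]) auto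
  next
    case 5 then show ?thesis using sub[OF 5] N M by (intro res[of 23]) auto
  next
    case 6 then show ?thesis using sub[OF 6] N M by (intro res[of 24]) auto
  next
    case 7 then show ?thesis using sub[OF 7] N M by (intro res[of 25]) auto
  next
    case 8 then show ?thesis using sub[OF 8] N M by (intro res[of 26]) auto
  next
    case 9 then show ?thesis using triple[of 5] M by (intro res[of 14]) auto
  next
    case 10 then show ?thesis using triple[of 6] M by (intro res[of 15]) auto
  next
    case 11 then show ?thesis using triple[of 7] M by (intro res[of 16]) auto
  next
    case 12 then show ?thesis using M by (intro res[of 14]) auto
  qed
qed

lemma hex_codes_valid:
  "list_all (\<lambda>(r, d, i). (d = 1 \<or> d = 2 \<or> d = 3 \<or> d = 6) \<and> (if r then d < 6 else 1 < d)) hex_codes"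
  by code_simp

lemma hex_codes_distinct:
  "sorted_wrt (\<lambda>(r, d, i) (r', e, j). r \<noteq> r' \<or> d \<noteq> e \<or> (\<not> r \<and> (i - j) mod d \<noteq> 0)) hex_codes"
  by code_simp

lemma hex_codes_complete:
  "\<forall>d\<in>set [1, 2, 3]. (True, d, 0) \<in> set hex_codes" "\<forall>d\<in>set [2, 3, 6]. \<forall>i\<in>set [0..d - 1]. (False, d, i) \<in> set hex_codes"
  by code_simp+

section \<open>The incidence graph for n = 6 inside its template\<close>

context dihedral_coordinates
begin

definition coded_subgroup :: "bool \<times> int \<times> int \<Rightarrow> 'a set" where
  "coded_subgroup c = (case c of (r, d, i) \<Rightarrow> if r then rotations d else dihedrals d i)"

lemma coded_subgroup_comaximal:
  assumes "fst (snd c) dvd int n" "fst (snd c') dvd int n"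
  shows "coded_subgroup c <#> coded_subgroup c' = carrier G \<longleftrightarrow> code_comaximal c c'"
proof -
  obtain r d i r' e j where c: "c = (r, d, i)" "c' = (r', e, j)" by (metis prod.exhaust)
  have "odd (i - j) \<longleftrightarrow> (i - j) mod 2 \<noteq> 0" by presburger
  then show ?thesis
    using assms unfolding c
    by (cases r; cases r')
      (simp_all add: coded_subgroup_def comaximal_rotations_rotations comaximal_rotations_dihedrals
        comaximal_dihedrals_dihedrals coprime_iff_gcd_eq_1 gcd.commute)
qed

text \<open>The fourteen codes exhaust the nontrivial proper subgroups. A hyperedge is contained in
  one of the thirteen listed cliques, and as these consist of vertices, maximality gives equality.
  So subgroups and hyperedges map injectively to the numbers of the template.\<close>

lemma embeddable_six:
  assumes n: "n = 6" and emb: "embeddable_in X ({..<27}, template_edge ` {..<39})"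
  shows "embeddable_in X (incidence_graph (comaximal_hypergraph G))"
proof -
  define S where "S a = coded_subgroup (hex_codes ! a)" for a
  let ?V = "comaximal_vertices G"
  have len: "length hex_codes = 14" by (simp add: hex_codes_def)
  have valid: "fst (snd (hex_codes ! a)) \<in> {1, 2, 3, 6}" "if fst (hex_codes ! a) then fst (snd (hex_codes ! a)) < 6 else 1 < fst (snd (hex_codes ! a))"
    if "a < 14" for a
    using hex_codes_valid that unfolding list_all_length len split_beta by blast+
  have dvd: "fst (snd (hex_codes ! a)) dvd int n" if "a < 14" for a
    using valid(1)[OF that] n by auto
  have com: "S a <#> S b = carrier G \<longleftrightarrow> code_comaximal (hex_codes ! a) (hex_codes ! b)" if "a < 14" "b < 14" for a b
    unfolding S_def using dvd that by (intro coded_subgroup_comaximal)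
  have S_nt: "S a \<in> nontrivial_proper_subgroups G" if "a < 14" for a
    using valid[OF that] dvd[OF that] n
    by (auto simp: S_def coded_subgroup_def split_beta intro!: rotations_nontrivial dihedrals_nontrivial)
  have lt: "S a \<noteq> S b" if "a < b" "b < 14" for a b
  proof -
    obtain r d i r' e j where c: "hex_codes ! a = (r, d, i)" "hex_codes ! b = (r', e, j)" by (metis prod.exhaust)
    have "a < 14" using that by simp
    have "r \<noteq> r' \<or> d \<noteq> e \<or> (\<not> r \<and> (i - j) mod d \<noteq> 0)"
      using sorted_wrt_nth_less[OF hex_codes_distinct that(1)] that(2) len c by simp
    moreover have "0 < d" "0 < e" using valid(1)[OF \<open>a < 14\<close>] valid(1)[OF that(2)] c by auto
    moreover have "d dvd int n" "e dvd int n" using dvd[OF \<open>a < 14\<close>] dvd[OF that(2)] c by auto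
    ultimately show ?thesis
      by (cases r; cases r') (simp_all add: S_def c coded_subgroup_def rotations_eq_iff dihedrals_eq_iff mod_eq_0_iff_dvd)
  qed
  have S_inj: "a = b" if "S a = S b" "a < 14" "b < 14" for a b
    using lt[of a b] lt[of b a] that by (metis linorder_neqE_nat)
  have div6: "d \<in> {1, 2, 3, 6}" if "d dvd int n" "d > 0" for d
  proof -
    have "d dvd 6" using that(1) n by simp
    moreover from this have "d \<le> 6" by (rule zdvd_imp_le) simp
    moreover have "\<not> (4::int) dvd 6" "\<not> (5::int) dvd 6" by presburger+
    ultimately have "d \<noteq> 4" "d \<noteq> 5" "d \<le> 6" by auto
    then show ?thesis using that(2) by simp linarith
  qed
  have S_onto: "\<exists>a<14. H = S a" if H: "H \<in> nontrivial_proper_subgroups G" for H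
  proof -
    have in_codes: "\<exists>a<14. coded_subgroup c = S a" if "c \<in> set hex_codes" for c
      using that unfolding in_set_conv_nth S_def len by metis
    from H show ?thesis
    proof (cases rule: nontrivial_proper_subgroup_cases)
      case (1 d)
      then have "d \<in> set [1, 2, 3]" using div6[of d] n by auto
      then have "(True, d, 0) \<in> set hex_codes" using hex_codes_complete(1) by blast
      then show ?thesis using in_codes 1 by (fastforce simp: coded_subgroup_def)
    next
      case (2 d i)
      have "d \<in> set [2, 3, 6]" using div6[of d] 2 by auto
      moreover have "i mod d \<in> set [0..d - 1]" using 2(1) by simp
      ultimately have "(False, d, i mod d) \<in> set hex_codes" using hex_codes_complete(2) by blast
      moreover have "dihedrals d (i mod d) = dihedrals d i"
        using 2 by (subst dihedrals_eq_iff) (auto simp: mod_eq_dvd_iff[symmetric])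
      ultimately show ?thesis using in_codes 2 by (fastforce simp: coded_subgroup_def)
    qed
  qed
  have V_S: "\<exists>a<14. H = S a" if "H \<in> ?V" for H
    using that S_onto by (simp add: comaximal_vertices_def)
  define C where "C k = S ` set (hex_members k)" for k
  have mem_lt: "a < 14" if "a \<in> set (hex_members k)" for a k
    using that hex_edges_bounds unfolding hex_members_def list_all_iff by fastforce
  have members_ne: "set (hex_members k) \<noteq> {a}" if "k \<in> {14..<27}" for k a
  proof -
    have "\<forall>k\<in>set [14..<27]. 2 \<le> card (set (hex_members k))" by code_simp
    then have "2 \<le> card (set (hex_members k))" by (rule bspec) (use that in \<open>simp only: set_upt\<close>)
    then show ?thesis by auto
  qed
  have C_clique: "pairwise_comaximal G (C k)" "C k \<subseteq> ?V" if k: "k \<in> {14..<27}" for k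
  proof -
    show pw: "pairwise_comaximal G (C k)"
      unfolding pairwise_comaximal_def C_def
    proof (intro ballI impI; elim imageE)
      fix H K a b assume a: "H = S a" "a \<in> set (hex_members k)" and b: "K = S b" "b \<in> set (hex_members k)" and "H \<noteq> K"
      then have "a \<noteq> b" by metis
      moreover have "k \<in> set [14..<27]" using k by (simp only: set_upt)
      ultimately have "code_comaximal (hex_codes ! a) (hex_codes ! b)" using hex_members_cliques a(2) b(2) by metis
      then show "H <#> K = carrier G" using com mem_lt a b by simp
    qed
    show "C k \<subseteq> ?V"
    proof (rule clique_subset_comaximal_vertices[OF _ pw])
      show "C k \<subseteq> nontrivial_proper_subgroups G" using S_nt mem_lt unfolding C_def by (intro image_subsetI) blast
      fix H assume "H \<in> C k"
      then obtain a where a: "H = S a" "a \<in> set (hex_members k)" unfolding C_def by (rule imageE)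
      then obtain b where b: "b \<in> set (hex_members k)" "b \<noteq> a" using members_ne[OF k, of a] by blast
      then have "S b \<noteq> H" using S_inj[of b a] mem_lt a by metis
      moreover have "S b \<in> C k" unfolding C_def using b(1) by (rule imageI)
      ultimately show "C k \<noteq> {H}" by (metis singletonD)
    qed
  qed
  have hyper: "\<exists>k\<in>{14..<27}. E = C k" if E: "E \<in> comaximal_hyperedges G" for E
  proof -
    define A where "A = {a. a < 14 \<and> S a \<in> E}"
    have "\<exists>k\<in>{14..<27}. A \<subseteq> set (hex_members k)"
    proof (rule hex_clique_cases)
      show "A \<subseteq> {..<14}" by (auto simp: A_def)
      fix a b assume ab: "a \<in> A" "b \<in> A" "a \<noteq> b"
      then have l: "a < 14" "b < 14" "S a \<in> E" "S b \<in> E" by (simp_all add: A_def)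
      then have "S a \<noteq> S b" using S_inj ab(3) by metis
      then show "code_comaximal (hex_codes ! a) (hex_codes ! b)"
        using pairwise_comaximal_hyperedgeD[OF E l(3,4)] com l by simp
    qed
    then obtain k where k: "k \<in> {14..<27}" "A \<subseteq> set (hex_members k)" by blast
    have "E \<subseteq> C k"
    proof
      fix H assume H: "H \<in> E"
      then obtain a where "a < 14" "H = S a" using V_S comaximal_hyperedge_subset[OF E] by (metis subsetD)
      then show "H \<in> C k" using H k(2) unfolding C_def A_def by (intro image_eqI[of _ _ a]) auto
    qed
    then have "E = C k" by (rule comaximal_hyperedge_maximal[OF E _ C_clique(2,1)[OF k(1)]])
    then show ?thesis using k(1) by blast
  qed
  define f where "f H = (SOME a. a < 14 \<and> H = S a)" for H
  define g where "g E = (SOME k. k \<in> {14..<27} \<and> E = C k)" for E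
  have f: "f H < 14 \<and> H = S (f H)" if "H \<in> ?V" for H
    unfolding f_def by (rule someI_ex) (rule V_S[OF that])
  have g: "g E \<in> {14..<27} \<and> E = C (g E)" if "E \<in> comaximal_hyperedges G" for E
    unfolding g_def by (rule someI_ex) (use hyper[OF that] in blast)
  show ?thesis
  proof (rule embeddable_incidence_graph[OF emb, where f = f and g = g])
    show "inj_on f ?V" by (rule inj_onI) (metis f)
    show "inj_on g (comaximal_hyperedges G)" by (rule inj_onI) (metis g)
    show "f H \<noteq> g E" if "H \<in> ?V" "E \<in> comaximal_hyperedges G" for H E
      using f[OF that(1)] g[OF that(2)] by simp
    show "f H \<in> {..<27}" if "H \<in> ?V" for H using f[OF that] by simp
    show "g E \<in> {..<27}" if "E \<in> comaximal_hyperedges G" for E using g[OF that] by simp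
    fix H E assume E: "E \<in> comaximal_hyperedges G" "H \<in> E"
    then have H: "H \<in> ?V" using comaximal_hyperedge_subset by blast
    have "H \<in> C (g E)" using g[OF E(1)] E(2) by metis
    then obtain a where a: "H = S a" "a \<in> set (hex_members (g E))" unfolding C_def by (rule imageE)
    then have "a = f H" using S_inj[of a "f H"] f[OF H] mem_lt by metis
    then have "(f H, g E) \<in> set hex_edges" using a(2) by (auto simp: hex_members_def)
    then obtain i where "i < 39" "hex_edges ! i = (f H, g E)" by (metis in_set_conv_nth length_hex_edges)
    then show "{f H, g E} \<in> template_edge ` {..<39}"
      by (intro image_eqI[of _ _ i]) (auto simp: template_edge_def)
  qed
qed

end

theorem theorem3p7:
  fixes G :: "('a, 'b) monoid_scheme" and n :: nat
  assumes "n \<ge> 2" and "dihedral_group G n"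
  shows "((n = 6 \<or> primepow n) \<longleftrightarrow> toroidal (comaximal_hypergraph G)) \<and>
         (toroidal (comaximal_hypergraph G) \<longleftrightarrow> projective (comaximal_hypergraph G))"
proof -
  obtain rot ref where "dihedral_coordinates G n rot ref"
    using dihedral_group_coordinates[OF assms(2)] assms(1) by auto
  then interpret dihedral_coordinates G n rot ref .
  \<comment> \<open>For each \<open>n\<close> the two surfaces behave alike, so one case distinction
    yields both equivalences.\<close>
  have "toroidal (comaximal_hypergraph G) \<and> projective (comaximal_hypergraph G)" if "n = 6 \<or> primepow n"
    using that embeddable_six[OF _ torus_template_embeddable] embeddable_six[OF _ projective_template_embeddable]
      embeddable_primepow[OF assms(1) _ planar_template_torus]
      embeddable_primepow[OF assms(1) _ planar_template_projective_plane]
    by (auto simp: toroidal_def projective_def)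
  moreover have "\<not> toroidal (comaximal_hypergraph G) \<and> \<not> projective (comaximal_hypergraph G)"
    if "\<not> (n = 6 \<or> primepow n)"
    using that not_embeddable[OF bipartite_bounded_torus assms(1)]
      not_embeddable[OF bipartite_bounded_projective_plane assms(1)]
    by (auto simp: toroidal_def projective_def)
  ultimately show ?thesis by blast
qed

end
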